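(* Let $1\le p\le q$, $p+q=n+2\ge 3$. A proper subalgebra of $\mathfrak{su}(p,q)$ of maximal dimension is a parabolic subalgebra of maximal dimension; namely, it is conjugate to $\mathfrak{p}_{1,n+1}$ (of dimension $n^2+2n+2$), except in the case $n=2$, $(p,q)=(2,2)$, where it is conjugate to $\mathfrak{p}_2$ (of dimension $11$), and in the case $n=4$, $(p,q)=(3,3)$, where it is conjugate to $\mathfrak{p}_{1,5}$ or $\mathfrak{p}_3$ (both of dimension $26$).
   Context: $\mathfrak{su}(p,q)$ is the real Lie algebra of traceless endomorphisms of $\mathbb{C}^{n+2}$ skew-Hermitian with respect to a Hermitian form of signature $(p,q)$. For $1\le s\le p$, $\mathfrak{p}_{s,n-s+2}\subset\mathfrak{su}(p,q)$ denotes the maximal parabolic subalgebra that is the stabilizer of an $s$-dimensional null (totally isotropic) complex subspace of $\mathbb{C}^{n+2}$; for $n=2m-2$ (and $p=q=m$) one writes $\mathfrak{p}_m$ for $\mathfrak{p}_{m,m}$. *)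

theory Defs
  imports "HOL-Analysis.Analysis"
begin

section \<open>Hermitian forms and the Lie algebra su(p,q)\<close>

definition hermitian_form :: "(complex^'d \<Rightarrow> complex^'d \<Rightarrow> complex) \<Rightarrow> bool" where
  "hermitian_form B \<longleftrightarrow>
     (\<forall>x y z. B (x + y) z = B x z + B y z) \<and>
     (\<forall>c x y. B (c *s x) y = c * B x y) \<and>
     (\<forall>x y. B y x = cnj (B x y))"

text \<open>Signature (p,q), with p plus signs and q minus signs, witnessed by an orthogonal basis of the
  whole space on which the form takes the values 1 and -1 only; in particular the form is
  nondegenerate. The prefix \<open>vec\<close> refers to complex linear algebra.\<close>

definition has_signature :: "(complex^'d \<Rightarrow> complex^'d \<Rightarrow> complex) \<Rightarrow> nat \<Rightarrow> nat \<Rightarrow> bool" where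
  "has_signature B p q \<longleftrightarrow>
     (\<exists>E. vec.independent E \<and> vec.span E = UNIV \<and>
        (\<forall>x\<in>E. \<forall>y\<in>E. x \<noteq> y \<longrightarrow> B x y = 0) \<and>
        (\<forall>x\<in>E. B x x = 1 \<or> B x x = -1) \<and>
        card {x\<in>E. B x x = 1} = p \<and> card {x\<in>E. B x x = -1} = q)"

definition su_alg :: "(complex^'d \<Rightarrow> complex^'d \<Rightarrow> complex) \<Rightarrow> (complex^'d^'d) set" where
  "su_alg B = {A. trace A = 0 \<and> (\<forall>x y. B (A *v x) y + B x (A *v y) = 0)}"

definition SU_group :: "(complex^'d \<Rightarrow> complex^'d \<Rightarrow> complex) \<Rightarrow> (complex^'d^'d) set" where
  "SU_group B = {g. det g = 1 \<and> (\<forall>x y. B (g *v x) (g *v y) = B x y)}"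

text \<open>Conjugacy of subalgebras under the adjoint action of SU(p,q). As SU(p,q) is connected, this
  is conjugacy under the inner automorphisms of su(p,q).\<close>

definition conjugate_in_SU ::
    "(complex^'d \<Rightarrow> complex^'d \<Rightarrow> complex) \<Rightarrow> (complex^'d^'d) set \<Rightarrow> (complex^'d^'d) set \<Rightarrow> bool" where
  "conjugate_in_SU B h k \<longleftrightarrow> (\<exists>g\<in>SU_group B. k = (\<lambda>A. g ** A ** matrix_inv g) ` h)"


section \<open>Matrix Lie algebras\<close>

definition lie_bracket :: "complex^'d^'d \<Rightarrow> complex^'d^'d \<Rightarrow> complex^'d^'d" where
  "lie_bracket A C = A ** C - C ** A"

text \<open>The notions \<open>subspace\<close>, \<open>span\<close> and \<open>dim\<close> for matrices are the real ones.\<close>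

definition lie_subalgebra :: "(complex^'d^'d) set \<Rightarrow> (complex^'d^'d) set \<Rightarrow> bool" where
  "lie_subalgebra g h \<longleftrightarrow> subspace h \<and> h \<subseteq> g \<and> (\<forall>A\<in>h. \<forall>C\<in>h. lie_bracket A C \<in> h)"

definition proper_subalgebra :: "(complex^'d^'d) set \<Rightarrow> (complex^'d^'d) set \<Rightarrow> bool" where
  "proper_subalgebra g h \<longleftrightarrow> lie_subalgebra g h \<and> h \<noteq> g"

definition sl_alg :: "(complex^'d^'d) set" where
  "sl_alg = {A. trace A = 0}"

definition complex_lie_subalgebra :: "(complex^'d^'d) set \<Rightarrow> (complex^'d^'d) set \<Rightarrow> bool" where
  "complex_lie_subalgebra g h \<longleftrightarrow> lie_subalgebra g h \<and> (\<forall>A\<in>h. mat \<i> ** A \<in> h)"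

definition derived_alg :: "(complex^'d^'d) set \<Rightarrow> (complex^'d^'d) set" where
  "derived_alg h = span {lie_bracket A C | A C. A \<in> h \<and> C \<in> h}"

definition solvable_alg :: "(complex^'d^'d) set \<Rightarrow> bool" where
  "solvable_alg h \<longleftrightarrow> (\<exists>k. (derived_alg ^^ k) h = {0})"

definition borel_subalgebra :: "(complex^'d^'d) set \<Rightarrow> bool" where
  "borel_subalgebra b \<longleftrightarrow>
     complex_lie_subalgebra sl_alg b \<and> solvable_alg b \<and>
     (\<forall>c. complex_lie_subalgebra sl_alg c \<and> solvable_alg c \<and> b \<subseteq> c \<longrightarrow> c = b)"

text \<open>For a nondegenerate form, sl(N,C) is the direct sum of su(p,q) and i su(p,q), so the
  complexification of a real subspace h of su(p,q) is h + i h inside sl(N,C).\<close>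

definition complexification :: "(complex^'d^'d) set \<Rightarrow> (complex^'d^'d) set" where
  "complexification h = {A + mat \<i> ** C | A C. A \<in> h \<and> C \<in> h}"

definition parabolic_subalgebra ::
    "(complex^'d \<Rightarrow> complex^'d \<Rightarrow> complex) \<Rightarrow> (complex^'d^'d) set \<Rightarrow> bool" where
  "parabolic_subalgebra B h \<longleftrightarrow>
     lie_subalgebra (su_alg B) h \<and> (\<exists>b. borel_subalgebra b \<and> b \<subseteq> complexification h)"


section \<open>Stabilizers of null subspaces\<close>

definition null_subspace ::
    "(complex^'d \<Rightarrow> complex^'d \<Rightarrow> complex) \<Rightarrow> nat \<Rightarrow> (complex^'d) set \<Rightarrow> bool" where
  "null_subspace B s W \<longleftrightarrow>
     vec.subspace W \<and> vec.dim W = s \<and> (\<forall>x\<in>W. \<forall>y\<in>W. B x y = 0)"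

definition stabilizer_alg ::
    "(complex^'d \<Rightarrow> complex^'d \<Rightarrow> complex) \<Rightarrow> (complex^'d) set \<Rightarrow> (complex^'d^'d) set" where
  "stabilizer_alg B W = {A \<in> su_alg B. \<forall>w\<in>W. A *v w \<in> W}"

text \<open>Null subspaces of every dimension up to p exist.\<close>

lemma null_subspace_exists:
  fixes B :: "complex^'d \<Rightarrow> complex^'d \<Rightarrow> complex"
  assumes B: "hermitian_form B" and sig: "has_signature B p q" and "p \<le> q" and "s \<le> p"
  shows "\<exists>W. null_subspace B s W"
proof -
  have add: "B (x + y) z = B x z + B y z" and scale: "B (c *s x) y = c * B x y"
    and symm: "B x y = cnj (B y x)" for x y z c
    using B unfolding hermitian_form_def by blast+
  have addr: "B z (x + y) = B z x + B z y" for x y z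
    by (simp only: symm[of z "x + y"] symm[of z x] symm[of z y] add complex_cnj_add)
  have scaler: "B y (c *s x) = cnj c * B y x" for x y c
    by (simp only: symm[of y "c *s x"] symm[of y x] scale complex_cnj_mult)
  have zero: "B 0 y = 0" for y
    using scale[of 0 0 y] by (simp only: vector_smult_lzero mult_zero_left)
  have zeror: "B y 0 = 0" for y
    by (subst symm) (simp add: zero)
  obtain E where E: "vec.independent E" "\<forall>x\<in>E. \<forall>y\<in>E. x \<noteq> y \<longrightarrow> B x y = 0"
    "card {x\<in>E. B x x = 1} = p" "card {x\<in>E. B x x = -1} = q"
    using sig unfolding has_signature_def by blast
  have finE: "finite E"
    using E(1) vec.finiteI_independent by blast
  have "s \<le> card {x\<in>E. B x x = 1}"
    using E(3) \<open>s \<le> p\<close> by simp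
  then obtain P where P: "P \<subseteq> {x\<in>E. B x x = 1}" "card P = s"
    by (rule obtain_subset_with_card_n)
  have finP: "finite P"
    by (rule finite_subset[OF P(1)]) (use finE in simp)
  have "\<exists>f. f ` P \<subseteq> {x\<in>E. B x x = -1} \<and> inj_on f P"
    using card_le_inj[of P "{x\<in>E. B x x = -1}"] finP finE P(2) E(4) assms(3,4) by auto
  then obtain f where f: "f ` P \<subseteq> {x\<in>E. B x x = -1}" "inj_on f P"
    by blast
  define g where "g x = x + f x" for x
  have PE: "x \<in> E" "B x x = 1" "f x \<in> E" "B (f x) (f x) = -1" if "x \<in> P" for x
    using that P(1) f(1) by auto
  have fne: "x \<noteq> f y" if "x \<in> P" "y \<in> P" for x y
    using PE[OF that(1)] PE[OF that(2)] by auto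
  have Bg: "B (g x) (g y) = 0" if "x \<in> P" "y \<in> P" for x y
  proof (cases "x = y")
    case True
    then show ?thesis
      using PE[OF that(1)] fne[OF that(1) that(1)] fne[OF that(1) that(1), symmetric] E(2)
      by (simp add: g_def add addr)
  next
    case False
    then have "f x \<noteq> f y" using f(2) that by (auto dest: inj_onD)
    have "B x (f y) = 0" "B (f x) y = 0" "B x y = 0" "B (f x) (f y) = 0"
      using PE[OF that(1)] PE[OF that(2)] fne[OF that] fne[OF that(2) that(1)] E(2) False
        \<open>f x \<noteq> f y\<close> by auto
    then show ?thesis by (simp add: g_def add addr)
  qed
  have Bgx: "B (g y) x = (if y = x then 1 else 0)" if "x \<in> P" "y \<in> P" for x y
  proof -
    have "B (f y) x = 0" using PE[OF that(1)] PE[OF that(2)] fne[OF that] E(2) by auto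
    moreover have "B y x = (if y = x then 1 else 0)"
      using PE[OF that(1)] PE[OF that(2)] E(2) by auto
    ultimately show ?thesis by (simp add: g_def add)
  qed
  have inj: "inj_on g P"
    using Bgx by (metis inj_onI zero_neq_one)
  let ?W = "vec.span (g ` P)"
  have ind: "vec.independent (g ` P)"
    unfolding vec.independent_explicit_module
  proof (intro allI impI)
    fix t u v
    assume t: "finite t" "t \<subseteq> g ` P" "(\<Sum>v\<in>t. u v *s v) = 0" "v \<in> t"
    then obtain x where x: "x \<in> P" "v = g x" by blast
    have Bsum: "B (\<Sum>v\<in>t. u v *s v) x = (\<Sum>v\<in>t. u v * B v x)"
      using t(1) by (induction t rule: finite_induct) (auto simp: zero add scale)
    have "B w x = (if w = v then 1 else 0)" if "w \<in> t" for w
      using that t(2) x Bgx inj by (auto dest: inj_onD)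
    then have "(\<Sum>w\<in>t. u w * B w x) = (\<Sum>w\<in>t. if w = v then u w else 0)"
      by (intro sum.cong) auto
    also have "\<dots> = u v" using t(1,4) by simp
    finally show "u v = 0" using Bsum t(3) zero by simp
  qed
  have 1: "B x (g y) = 0" if "x \<in> ?W" "y \<in> P" for x y
    using that(1)
  proof (induction rule: vec.span_induct_alt)
    case base show ?case by (rule zero)
  next
    case (step c x z)
    then show ?case using Bg that(2) by (auto simp: add scale)
  qed
  have 2: "B x y = 0" if "x \<in> ?W" "y \<in> ?W" for x y
    using that(2)
  proof (induction rule: vec.span_induct_alt)
    case base show ?case by (rule zeror)
  next
    case (step c z y)
    then show ?case using 1 that(1) by (auto simp: addr scaler)
  qed
  have "vec.dim ?W = s"
    using ind inj P(2) by (simp add: vec.dim_eq_card_independent card_image)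
  then have "null_subspace B s ?W"
    using 2 by (simp add: null_subspace_def vec.subspace_span)
  then show ?thesis by blast
qed

end

theory Submission
  imports Defs
begin

text \<open>Write \<open>N = n + 2\<close>, let \<open>V\<close> be the ambient complex space and \<open>h\<close> a proper subalgebra of maximal
  dimension. The stabilizer of a null line has dimension \<open>N\<^sup>2 - 2 N + 2\<close>, so \<open>h\<close> has at least this
  dimension. The proof needs no classification of Lie algebras: it separates the case where \<open>h\<close>
  preserves a complex subspace from the case where it acts irreducibly, and settles both by counting
  dimensions.

  Suppose that \<open>h\<close> preserves a subspace \<open>U\<close> other than \<open>0\<close> and \<open>V\<close>. Then it preserves
  \<open>R = U \<inter> U\<^sup>\<bottom>\<close>. If \<open>R = 0\<close>, the elements of \<open>h\<close> are block diagonal for \<open>V = U \<oplus> U\<^sup>\<bottom>\<close>, which makes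
  \<open>h\<close> too small (\<open>dim_nondegenerate_stabilizer\<close>). So \<open>R\<close> is a nonzero null subspace, and \<open>h\<close> is its
  stabilizer by maximality. For \<open>R\<close> of dimension \<open>s\<close> the stabilizer has dimension
  \<open>N\<^sup>2 - 1 - 2 s N + 3 s\<^sup>2\<close> (\<open>dim_stabilizer_null\<close>), and comparison with \<open>s = 1\<close> leaves only \<open>s = 1\<close>,
  \<open>(N, s) = (4, 2)\<close>, where the dimension is \<open>11\<close> instead of \<open>10\<close>, and \<open>(N, s) = (6, 3)\<close>, where it is
  \<open>26\<close> in both cases. Stabilizers of null subspaces of the same dimension are
  conjugate by Witt's theorem (\<open>null_subspaces_isometric\<close>), and they are parabolic because the
  stabilizer of a complete flag through \<open>R\<close> and \<open>R\<^sup>\<bottom>\<close> is a Borel subalgebra of \<open>sl(N, \<complex>)\<close>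
  (\<open>flag_stabilizer_is_borel\<close>).

  Suppose now that \<open>h\<close> acts irreducibly. Its complexification \<open>g\<close> is an irreducible algebra of
  traceless matrices, of complex codimension at most \<open>2 N - 2\<close> among all matrices. Such a \<open>g\<close> is
  either all of \<open>sl(N, \<complex>)\<close>, which makes \<open>h\<close> all of \<open>su(p, q)\<close>, or it is contained in a symplectic
  algebra and \<open>N = 4\<close> (\<open>large_irreducible_is_full_or_symplectic\<close>). The reason is that an algebra of
  small codimension contains many matrices of rank one. Let \<open>D\<close> be the annihilator of \<open>g\<close> under the
  trace form. For every plane \<open>P\<close>, counting dimensions gives two independent elements of \<open>g\<close> with
  image in \<open>P\<close>, hence a nilpotent one \<open>X\<close>; from \<open>X\<close> and products such as \<open>X d X\<close> with \<open>d \<in> D\<close> one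
  obtains rank-one elements of \<open>g\<close> or \<open>D\<close>, and a second count moves them from \<open>D\<close> to \<open>g\<close>. Two such
  elements form a root pair of an \<open>sl\<^sub>2\<close> inside \<open>g\<close> (\<open>opposite_rank_ones\<close>), and the elements of
  weight one for it either generate all of \<open>sl(N, \<complex>)\<close> or form the graph of a map that extends to an
  invariant symplectic form. In the symplectic case \<open>h\<close> has dimension at most \<open>10\<close>. This is less than
  the dimension \<open>11\<close> of the stabilizer of a null plane if \<open>(p, q) = (2, 2)\<close>. If \<open>(p, q) = (1, 3)\<close>,
  the symplectic and the Hermitian form together give an antilinear map commuting with \<open>h\<close> whose
  square is a scalar, and no value of that scalar is compatible with the signature
  (\<open>no_invariant_symplectic_form\<close>).\<close>

section \<open>Rank-one matrices\<close>

text \<open>Bilinear, so that covectors are written as vectors and complex conjugation enters only through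
  the Hermitian form.\<close>

definition pair :: "complex^'d \<Rightarrow> complex^'d \<Rightarrow> complex" where
  "pair a x = (\<Sum>i\<in>UNIV. a$i * x$i)"

definition outer :: "complex^'d \<Rightarrow> complex^'d \<Rightarrow> complex^'d^'d" where
  "outer v a = (\<chi> i j. v$i * a$j)"

lemma pair_add_left: "pair (a + b) x = pair a x + pair b x"
  by (simp add: pair_def sum.distrib algebra_simps)

lemma pair_add_right: "pair a (x + y) = pair a x + pair a y"
  by (simp add: pair_def sum.distrib algebra_simps)

lemma pair_diff_left: "pair (a - b) x = pair a x - pair b x"
  by (simp add: pair_def sum_subtractf algebra_simps)

lemma pair_diff_right: "pair a (x - y) = pair a x - pair a y"
  by (simp add: pair_def sum_subtractf algebra_simps)

lemma pair_minus_left: "pair (- a) x = - pair a x"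
  by (simp add: pair_def sum_negf)

lemma pair_minus_right: "pair a (- x) = - pair a x"
  by (simp add: pair_def sum_negf)

lemma pair_scale_left: "pair (c *s a) x = c * pair a x"
  by (simp add: pair_def sum_distrib_left mult.assoc)

lemma pair_scale_right: "pair a (c *s x) = c * pair a x"
  by (simp add: pair_def sum_distrib_left mult.assoc mult.left_commute)

lemma pair_zero_left [simp]: "pair 0 x = 0"
  by (simp add: pair_def)

lemma pair_zero_right [simp]: "pair a 0 = 0"
  by (simp add: pair_def)

lemmas pair_simps = pair_add_left pair_add_right pair_diff_left pair_diff_right
  pair_minus_left pair_minus_right pair_scale_left pair_scale_right

lemma pair_axis_left: "pair (axis i 1) x = x $ i"
  by (simp add: pair_def axis_def if_distrib[of "\<lambda>z. z * _"] cong: if_cong)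

lemma pair_commute: "pair a x = pair x a"
  by (simp add: pair_def mult.commute)

lemma pair_vector_matrix: "pair (a v* A) x = pair a (A *v x)"
  unfolding pair_def vector_matrix_mult_def matrix_vector_mult_def vec_lambda_beta
    sum_distrib_left sum_distrib_right
  by (subst sum.swap) (simp add: mult.assoc)

lemma pair_ext: "(\<And>x. pair a x = pair b x) \<Longrightarrow> a = b"
  by (simp add: vec_eq_iff) (metis pair_axis_left pair_commute)

lemma mat_mult_vec: "mat c *v x = (c::complex) *s x"
  by (simp add: vec_eq_iff matrix_vector_mult_def mat_def if_distrib[of "\<lambda>z. z * _"] cong: if_cong)

lemma mat_mult_entry: "(mat c ** A) $ i $ j = (c::complex) * A $ i $ j"
  by (simp add: matrix_matrix_mult_def mat_def if_distrib[of "\<lambda>z. z * _"] cong: if_cong)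

lemma mat_mult_vec_assoc: "(mat c ** A) *v x = (c::complex) *s (A *v x)"
  by (simp add: mat_mult_vec matrix_vector_mul_assoc[symmetric])

lemma outer_mult_vec: "outer v a *v x = pair a x *s v"
  by (simp add: vec_eq_iff outer_def matrix_vector_mult_def pair_def sum_distrib_left sum_distrib_right mult_ac)

lemma vec_mult_outer: "b v* outer v a = pair b v *s a"
  by (simp add: vec_eq_iff outer_def vector_matrix_mult_def pair_def sum_distrib_left sum_distrib_right mult_ac)

lemma mult_outer: "X ** outer v a = outer (X *v v) a"
  by (simp add: matrix_eq matrix_vector_mul_assoc[symmetric] outer_mult_vec vec.scale)

lemma outer_mult: "outer v a ** X = outer v (a v* X)"
  by (simp add: matrix_eq matrix_vector_mul_assoc[symmetric] outer_mult_vec pair_vector_matrix)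

lemma outer_mult_outer: "outer v a ** outer w b = outer (pair a w *s v) b"
  by (simp add: mult_outer outer_mult_vec)

lemma trace_outer_mult: "trace (outer v a ** X) = pair a (X *v v)"
  by (simp add: outer_mult pair_vector_matrix[symmetric]) (simp add: trace_def outer_def pair_def mult.commute)

lemma trace_outer: "trace (outer v a) = pair a v"
  by (simp add: trace_def outer_def pair_def mult.commute)

lemma outer_eq_0_iff: "outer v a = 0 \<longleftrightarrow> v = 0 \<or> a = 0"
  by (auto simp: outer_def vec_eq_iff)

lemma outer_zero_left [simp]: "outer 0 a = 0" and outer_zero_right [simp]: "outer v 0 = 0"
  by (simp_all add: outer_eq_0_iff)

lemma outer_add_left: "outer (v + w) a = outer v a + outer w a"
  and outer_add_right: "outer v (a + b) = outer v a + outer v b"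
  and outer_diff_left: "outer (v - w) a = outer v a - outer w a"
  and outer_diff_right: "outer v (a - b) = outer v a - outer v b"
  and outer_minus_left: "outer (- v) a = - outer v a"
  and outer_minus_right: "outer v (- a) = - outer v a"
  and outer_scale_left: "outer (c *s v) a = mat c ** outer v a"
  and outer_scale_right: "outer v (c *s a) = mat c ** outer v a"
  and outer_scaleR_right: "outer v (r *\<^sub>R a) = r *\<^sub>R outer v a"
  by (simp_all add: outer_def vec_eq_iff algebra_simps mat_mult_entry)

lemmas outer_linear = outer_add_left outer_add_right outer_diff_left outer_diff_right
  outer_minus_left outer_minus_right

lemma mat_mult_comm: "mat c ** A = A ** mat (c::complex)"
  by (simp add: matrix_eq mat_mult_vec matrix_vector_mul_assoc[symmetric] vec.scale)

lemma mat_mult_mat: "mat a ** (mat b ** A) = mat (a * b) ** (A :: complex^'d^'d)"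
  by (simp add: matrix_eq mat_mult_vec matrix_vector_mul_assoc[symmetric])

lemma trace_mat_mult: "trace (mat c ** A) = (c::complex) * trace A"
  by (simp add: trace_def mat_mult_entry sum_distrib_left)

lemma trace_scaleR: "trace (r *\<^sub>R A) = r *\<^sub>R trace (A :: complex^'d^'d)"
  by (simp add: trace_def scaleR_sum_right)

lemma trace_zero [simp]: "trace (0 :: complex^'d^'d) = 0"
  by (simp add: trace_def)

lemma vec_scaleR_scale: "r *\<^sub>R x = complex_of_real r *s (x :: complex^'d)"
  by (simp add: vec_eq_iff scaleR_conv_of_real[where 'a=complex])

lemma mat_scaleR_scale: "r *\<^sub>R A = mat (complex_of_real r) ** (A :: complex^'d^'d)"
  by (simp add: vec_eq_iff scaleR_conv_of_real[where 'a=complex] mat_mult_entry)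

lemma matrix_scaleR_mult_left: "(r *\<^sub>R A) ** B = r *\<^sub>R (A ** (B :: complex^'d^'d))"
  and matrix_scaleR_mult_right: "A ** (r *\<^sub>R B) = r *\<^sub>R (A ** (B :: complex^'d^'d))"
  by (simp_all add: matrix_matrix_mult_def vec_eq_iff scaleR_sum_right)

lemma lie_bracket_outer: "lie_bracket X (outer v a) = outer (X *v v) a - outer v (a v* X)"
  by (simp add: lie_bracket_def mult_outer outer_mult)

lemma lie_bracket_outer_left: "lie_bracket (outer v a) X = outer v (a v* X) - outer (X *v v) a"
  by (simp add: lie_bracket_def mult_outer outer_mult)

section \<open>Real and complex dimension\<close>

lemma vec_subspace_imp_subspace: "vec.subspace U \<Longrightarrow> subspace (U :: (complex^'d) set)"
  unfolding vec.subspace_def subspace_def by (simp add: vec_scaleR_scale)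

text \<open>The orthogonal complement of the kernel inside \<open>S\<close> maps bijectively onto the image.\<close>

lemma dim_kernel_image:
  fixes f :: "'a::euclidean_space \<Rightarrow> 'b::euclidean_space"
  assumes f: "linear f" and S: "subspace S"
  shows "dim (f ` S) + dim {x \<in> S. f x = 0} = dim S"
proof -
  let ?K = "{x \<in> S. f x = 0}"
  let ?C = "{y \<in> S. \<forall>x \<in> ?K. orthogonal x y}"
  have K: "subspace ?K"
    using S unfolding subspace_def by (simp add: linear_add[OF f] linear_scale[OF f] linear_0[OF f])
  have C: "subspace ?C"
    using S unfolding subspace_def orthogonal_def by (simp add: inner_right_distrib)
  have inj: "inj_on f (span ?C)"
  proof (rule inj_onI)
    fix x y assume xy: "x \<in> span ?C" "y \<in> span ?C" "f x = f y"
    then have "x - y \<in> span ?C"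
      by (intro span_diff)
    then have "x - y \<in> ?C"
      by (simp only: span_eq_iff[THEN iffD2, OF C])
    moreover from this have "x - y \<in> ?K"
      using xy(3) by (simp add: linear_diff[OF f])
    ultimately have "orthogonal (x - y) (x - y)" by simp
    then show "x = y" by (simp add: orthogonal_def)
  qed
  have "f ` S = f ` ?C"
  proof (intro equalityI subsetI)
    fix z assume "z \<in> f ` S"
    then obtain x where x: "x \<in> S" "z = f x" by blast
    obtain y u where yu: "x = y + u" "y \<in> span ?K" "\<And>w. w \<in> span ?K \<Longrightarrow> orthogonal u w"
      by (rule orthogonal_subspace_decomp_exists[of ?K x]) (rule that)
    have y: "y \<in> ?K" using yu(2) by (simp only: span_eq_iff[THEN iffD2, OF K])
    have "u = x - y" using yu(1) by simp
    then have "u \<in> S" using x(1) y S subspace_diff by blast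
    moreover have "orthogonal w u" if "w \<in> ?K" for w
      using yu(3)[OF span_base[OF that]] by (simp add: orthogonal_commute)
    ultimately have "u \<in> ?C" by blast
    moreover have "f u = z" using x(2) yu(1) y by (simp add: linear_add[OF f])
    ultimately show "z \<in> f ` ?C" by blast
  qed auto
  then have "dim (f ` S) = dim ?C"
    using dim_image_eq[OF f inj] by simp
  moreover have "dim ?C + dim ?K = dim S"
    by (rule dim_subspace_orthogonal_to_vectors[OF K S]) auto
  ultimately show ?thesis by simp
qed

text \<open>A new complex direction \<open>e\<close> contributes the two real directions \<open>e\<close> and \<open>\<i> e\<close>.\<close>

lemma dim_vec_span_insert:
  fixes e :: "complex^'d"
  assumes "e \<notin> vec.span E"
  shows "dim (vec.span (insert e E)) = dim (vec.span E) + 2"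
proof -
  let ?U = "vec.span E"
  have U: "subspace ?U" by (simp add: vec_subspace_imp_subspace)
  have eq: "vec.span (insert e E) = span (insert (\<i> *s e) (insert e ?U))"
  proof
    show "span (insert (\<i> *s e) (insert e ?U)) \<subseteq> vec.span (insert e E)"
    proof (rule span_minimal)
      show "subspace (vec.span (insert e E))"
        by (simp add: vec_subspace_imp_subspace)
      show "insert (\<i> *s e) (insert e ?U) \<subseteq> vec.span (insert e E)"
        using vec.span_mono[of E "insert e E"] vec.span_base[of e "insert e E"] vec.span_scale by auto
    qed
    show "vec.span (insert e E) \<subseteq> span (insert (\<i> *s e) (insert e ?U))"
    proof
      fix x assume "x \<in> vec.span (insert e E)"
      then obtain k where k: "x - k *s e \<in> ?U"
        by (auto simp: vec.span_insert)
      have k2: "k = complex_of_real (Re k) + \<i> * complex_of_real (Im k)"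
        by (rule complex_eq)
      have "x = Im k *\<^sub>R (\<i> *s e) + (Re k *\<^sub>R e + (x - k *s e))"
        by (subst (3) k2) (simp add: vec_eq_iff scaleR_conv_of_real[where 'a=complex] algebra_simps)
      then show "x \<in> span (insert (\<i> *s e) (insert e ?U))"
        using k by (metis insertI1 insertI2 span_add span_base span_scale)
    qed
  qed
  have e: "e \<notin> span ?U" using assms U by (metis span_eq_iff)
  have ie: "\<i> *s e \<notin> span (insert e ?U)"
  proof
    assume "\<i> *s e \<in> span (insert e ?U)"
    then obtain k where "\<i> *s e - k *\<^sub>R e \<in> span ?U"
      by (auto simp: span_insert)
    then have "(\<i> - complex_of_real k) *s e \<in> ?U"
      using U by (simp add: vec_scaleR_scale vec.scale_left_diff_distrib span_eq_iff[THEN iffD2])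
    moreover have "\<i> - complex_of_real k \<noteq> 0" by (simp add: complex_eq_iff)
    ultimately have "e \<in> ?U"
      by (metis vec.span_scale vec.scale_scale left_inverse vec.scale_one)
    then show False using assms by simp
  qed
  show ?thesis
    unfolding eq using e ie by (simp add: dim_insert)
qed

lemma dim_eq_twice_vec_dim:
  fixes U :: "(complex^'d) set"
  assumes "vec.subspace U"
  shows "dim U = 2 * vec.dim U"
proof -
  have *: "dim (vec.span E) = 2 * card E" if "finite E" "vec.independent E" for E :: "(complex^'d) set"
    using that
  proof (induction E rule: finite_induct)
    case empty then show ?case by simp
  next
    case (insert e E)
    then have "e \<notin> vec.span E" "vec.independent E"
      using vec.independent_insert[of e E] by (auto split: if_splits)
    then show ?case using insert dim_vec_span_insert[of e E] by simp
  qed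
  obtain E where E: "E \<subseteq> U" "vec.independent E" "U \<subseteq> vec.span E" "card E = vec.dim U"
    using vec.basis_exists by blast
  have "vec.span E = U" using E assms vec.span_minimal by blast
  then show ?thesis using *[of E] E vec.finiteI_independent by auto
qed

text \<open>Complex scalars act on matrices through products with scalar matrices, and closure under \<open>\<i>\<close> is
  all that complex linearity adds to real linearity.\<close>

definition csubspace :: "(complex^'d^'d) set \<Rightarrow> bool" where
  "csubspace S \<longleftrightarrow> subspace S \<and> (\<forall>A\<in>S. mat \<i> ** A \<in> S)"

lemma csubspace_scale: "csubspace S \<Longrightarrow> A \<in> S \<Longrightarrow> mat c ** A \<in> S"
proof -
  assume S: "csubspace S" "A \<in> S"
  have c: "c = complex_of_real (Re c) + \<i> * complex_of_real (Im c)"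
    by (rule complex_eq)
  have "mat c ** A = Re c *\<^sub>R A + Im c *\<^sub>R (mat \<i> ** A)"
    by (subst c) (simp add: vec_eq_iff mat_mult_entry scaleR_conv_of_real[where 'a=complex] algebra_simps)
  then show ?thesis
    using S unfolding csubspace_def by (simp add: subspace_add subspace_scale)
qed

text \<open>The annihilator under the trace form. Its dimension is the codimension of \<open>g\<close>, and membership in
  \<open>g\<close> can be tested against it.\<close>

definition ann :: "(complex^'d^'d) set \<Rightarrow> (complex^'d^'d) set" where
  "ann g = {d. \<forall>X\<in>g. trace (d ** X) = 0}"

definition ann_vec :: "(complex^'d) set \<Rightarrow> (complex^'d) set" where
  "ann_vec U = {a. \<forall>u\<in>U. pair a u = 0}"

lemma matrix_inner_conv_trace:
  fixes d X :: "complex^'d^'d"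
  shows "inner (\<chi> i j. cnj (d$j$i)) X = Re (trace (d ** X))"
proof -
  have "Re (trace (d ** X)) = (\<Sum>i\<in>UNIV. \<Sum>j\<in>UNIV. Re (d$i$j * X$j$i))"
    by (simp add: trace_def matrix_matrix_mult_def)
  also have "\<dots> = (\<Sum>j\<in>UNIV. \<Sum>i\<in>UNIV. Re (d$i$j * X$j$i))"
    by (rule sum.swap)
  finally show ?thesis
    by (simp add: inner_vec_def inner_complex_def)
qed

lemma vec_inner_conv_pair: "inner (\<chi> i. cnj (a$i)) x = Re (pair a x)"
  by (simp add: inner_vec_def inner_complex_def pair_def)

lemma dim_UNIV_matrix: "dim (UNIV :: (complex^'d^'d) set) = 2 * CARD('d)^2"
  by (simp add: power2_eq_square)

lemma dim_UNIV_vec: "dim (UNIV :: (complex^'d) set) = 2 * CARD('d)"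
  by simp

lemma matrix_add_rdistrib: "(A + B) ** C = A ** C + B ** (C :: complex^'d^'d)"
  and matrix_diff_rdistrib: "(A - B) ** C = A ** C - B ** (C :: complex^'d^'d)"
  and matrix_diff_ldistrib: "C ** (A - B) = C ** A - C ** (B :: complex^'d^'d)"
  by (simp_all add: matrix_eq matrix_vector_mul_assoc[symmetric] algebra_simps)

lemma csubspace_ann: "csubspace (ann g)"
  unfolding csubspace_def subspace_def ann_def
  by (auto simp: matrix_add_rdistrib trace_add matrix_scaleR_mult_left trace_scaleR
      matrix_mul_assoc[symmetric] trace_mat_mult)

lemma vec_subspace_orbit:
  assumes D: "csubspace D"
  shows "vec.subspace ((\<lambda>d. d *v w) ` D)"
  unfolding vec.subspace_def
proof (intro conjI ballI allI)
  have S: "subspace D" using D by (simp add: csubspace_def)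
  show "0 \<in> (\<lambda>d. d *v w) ` D" using subspace_0[OF S] by (auto intro!: image_eqI[of _ _ 0])
  show "x + y \<in> (\<lambda>d. d *v w) ` D" if "x \<in> (\<lambda>d. d *v w) ` D" "y \<in> (\<lambda>d. d *v w) ` D" for x y
    using that subspace_add[OF S] by (auto simp: matrix_vector_mult_add_rdistrib[symmetric])
  show "c *s x \<in> (\<lambda>d. d *v w) ` D" if "x \<in> (\<lambda>d. d *v w) ` D" for c x
    using that csubspace_scale[OF D] by (auto simp: mat_mult_vec_assoc[symmetric])
qed

text \<open>A complex functional whose real part vanishes on a complex subspace vanishes there, so a complex
  annihilator is a real orthogonal complement, up to the conjugation \<open>c\<close> that turns the real part of
  the pairing \<open>\<beta>\<close> into the inner product. This covers the trace form on matrices as well as the pairing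
  of vectors.\<close>

lemma dim_real_annihilator:
  fixes \<beta> :: "'a::euclidean_space \<Rightarrow> 'a \<Rightarrow> complex" and c :: "'a \<Rightarrow> 'a"
  assumes lin: "linear c" and cc: "\<And>d. c (c d) = d" and ct: "\<And>d x. inner (c d) x = Re (\<beta> d x)"
    and V: "subspace V"
    and Re: "\<And>d x. (\<And>x. x \<in> V \<Longrightarrow> Re (\<beta> d x) = 0) \<Longrightarrow> x \<in> V \<Longrightarrow> \<beta> d x = 0"
  shows "dim {d. \<forall>x\<in>V. \<beta> d x = 0} + dim V = DIM('a)"
proof -
  let ?A = "{d. \<forall>x\<in>V. \<beta> d x = 0}"
  have "inj c" by (metis cc injI)
  then have inj: "inj_on c (span ?A)" using inj_on_subset by blast
  have "c ` ?A = {y \<in> UNIV. \<forall>x\<in>V. orthogonal x y}"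
  proof (intro equalityI subsetI)
    fix y assume "y \<in> c ` ?A"
    then show "y \<in> {y \<in> UNIV. \<forall>x\<in>V. orthogonal x y}"
      by (auto simp: orthogonal_def inner_commute[of _ "c _"] ct)
  next
    fix y assume "y \<in> {y \<in> UNIV. \<forall>x\<in>V. orthogonal x y}"
    then have "inner (c (c y)) x = 0" if "x \<in> V" for x
      using that cc[of y] by (auto simp: orthogonal_def inner_commute)
    then have "Re (\<beta> (c y) x) = 0" if "x \<in> V" for x
      using that ct[of "c y" x] by simp
    then have "c y \<in> ?A" using Re[of "c y"] by auto
    then show "y \<in> c ` ?A" by (rule rev_image_eqI) (simp only: cc)
  qed
  then have "dim ?A = dim {y \<in> UNIV. \<forall>x\<in>V. orthogonal x y}"
    using dim_image_eq[OF lin inj] by simp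
  moreover have "dim {y \<in> UNIV. \<forall>x\<in>V. orthogonal x y} + dim V = DIM('a)"
    using dim_subspace_orthogonal_to_vectors[of V UNIV] V by simp
  ultimately show ?thesis by simp
qed

lemma dim_ann:
  assumes g: "csubspace (g :: (complex^'d^'d) set)"
  shows "dim (ann g) + dim g = 2 * CARD('d)^2"
proof -
  have "trace (d ** X) = 0" if "\<And>X. X \<in> g \<Longrightarrow> Re (trace (d ** X)) = 0" "X \<in> g" for d X
  proof -
    have "Re (trace (d ** (mat \<i> ** X))) = 0"
      using that g by (auto simp: csubspace_def)
    moreover have "d ** (mat \<i> ** X) = mat \<i> ** (d ** X)"
      by (metis mat_mult_comm matrix_mul_assoc)
    ultimately show ?thesis using that by (simp add: trace_mat_mult complex_eq_iff)
  qed
  moreover have "linear (\<lambda>d :: complex^'d^'d. \<chi> i j. cnj (d$j$i))"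
    by (rule linearI) (simp_all add: vec_eq_iff)
  ultimately have "dim (ann g) + dim g = DIM(complex^'d^'d)"
    unfolding ann_def using g
    by (intro dim_real_annihilator[where c = "\<lambda>d. \<chi> i j. cnj (d$j$i)"])
      (simp_all add: matrix_inner_conv_trace csubspace_def vec_eq_iff)
  then show ?thesis by (simp add: power2_eq_square)
qed

lemma ann_ann:
  assumes g: "csubspace (g :: (complex^'d^'d) set)"
  shows "ann (ann g) = g"
proof -
  have sub: "g \<subseteq> ann (ann g)"
  proof
    fix X assume "X \<in> g"
    then have "trace (X ** d) = 0" if "d \<in> ann g" for d
      using that by (simp add: ann_def trace_mul_sym[of X d])
    then show "X \<in> ann (ann g)" by (simp add: ann_def[of "ann g"])
  qed
  have "dim (ann (ann g)) = dim g"
    using dim_ann[OF g] dim_ann[OF csubspace_ann[of g]] by simp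
  then show ?thesis
    using sub subspace_dim_equal[of g "ann (ann g)"] g csubspace_ann[of "ann g"]
    by (auto simp: csubspace_def)
qed

lemma vec_subspace_pair_kernel: "vec.subspace {x. pair a x = 0}"
  by (simp add: vec.subspace_def pair_simps)

lemma vec_subspace_ann_vec: "vec.subspace (ann_vec U)"
  by (auto simp: vec.subspace_def ann_vec_def pair_simps)

lemma dim_ann_vec:
  assumes U: "vec.subspace (U :: (complex^'d) set)"
  shows "dim (ann_vec U) + dim U = 2 * CARD('d)"
proof -
  have "pair a x = 0" if "\<And>X. X \<in> U \<Longrightarrow> Re (pair a X) = 0" "x \<in> U" for a x
  proof -
    have "Re (pair a (\<i> *s x)) = 0"
      using that U by (auto simp: vec.subspace_def)
    then show ?thesis using that by (simp add: pair_simps complex_eq_iff)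
  qed
  moreover have "linear (\<lambda>a :: complex^'d. \<chi> i. cnj (a$i))"
    by (rule linearI) (simp_all add: vec_eq_iff)
  ultimately have "dim (ann_vec U) + dim U = DIM(complex^'d)"
    unfolding ann_vec_def using vec_subspace_imp_subspace[OF U]
    by (intro dim_real_annihilator[where c = "\<lambda>a. \<chi> i. cnj (a$i)"])
      (simp_all add: vec_inner_conv_pair vec_eq_iff)
  then show ?thesis by simp
qed

lemma proper_subspace_annihilated:
  assumes "vec.subspace (U :: (complex^'d) set)" "U \<noteq> UNIV"
  obtains a where "a \<noteq> 0" "\<And>u. u \<in> U \<Longrightarrow> pair a u = 0"
proof -
  have "dim U < 2 * CARD('d)"
  proof -
    have U: "span U = U"
      using vec_subspace_imp_subspace[OF assms(1)] by (simp only: span_eq_iff)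
    have "dim U < dim (UNIV :: (complex^'d) set)"
      by (rule dim_psubset) (use U assms(2) in \<open>simp only: span_UNIV psubset_eq subset_UNIV, blast\<close>)
    then show ?thesis by (simp only: dim_UNIV_vec)
  qed
  then have "dim (ann_vec U) \<noteq> 0"
    using dim_ann_vec[OF assms(1)] by linarith
  then have "\<not> ann_vec U \<subseteq> {0}"
    by (simp only: dim_eq_0 not_False_eq_True)
  then obtain a where "a \<in> ann_vec U" "a \<noteq> 0"
    by blast
  then show ?thesis using that by (auto simp: ann_vec_def)
qed

lemma ann_vec_ann_vec:
  assumes U: "vec.subspace (U :: (complex^'d) set)"
  shows "ann_vec (ann_vec U) = U"
proof -
  have sub: "U \<subseteq> ann_vec (ann_vec U)"
  proof
    fix u assume "u \<in> U"
    then have "pair u a = 0" if "a \<in> ann_vec U" for a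
      using that by (simp add: ann_vec_def pair_commute[of u a])
    then show "u \<in> ann_vec (ann_vec U)" by (simp add: ann_vec_def[of "ann_vec U"])
  qed
  have "dim (ann_vec (ann_vec U)) = dim U"
    using dim_ann_vec[OF U] dim_ann_vec[OF vec_subspace_ann_vec[of U]] by simp
  then show ?thesis
    using sub subspace_dim_equal[of U "ann_vec (ann_vec U)"] U vec_subspace_imp_subspace
      vec_subspace_ann_vec by (metis order_refl)
qed

lemma functional_separating_subspace:
  assumes U: "vec.subspace (U :: (complex^'d) set)" and x: "x \<notin> U"
  obtains a where "\<And>u. u \<in> U \<Longrightarrow> pair a u = 0" "pair a x = 1"
proof -
  have "x \<notin> ann_vec (ann_vec U)" using ann_vec_ann_vec[OF U] x by simp
  then obtain b where b: "b \<in> ann_vec U" "pair x b \<noteq> 0" unfolding ann_vec_def[of "ann_vec U"] by blast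
  define a where "a = (1 / pair b x) *s b"
  have "pair b x \<noteq> 0" using b(2) pair_commute[of x b] by simp
  then have "pair a x = 1" by (simp add: a_def pair_simps)
  moreover have "pair a u = 0" if "u \<in> U" for u
    using b(1) that by (simp add: a_def pair_simps ann_vec_def)
  ultimately show ?thesis using that by blast
qed

lemma mem_span_insert_subspace:
  assumes "vec.subspace K"
  shows "z \<in> vec.span (insert x K) \<longleftrightarrow> (\<exists>k. z - k *s x \<in> K)"
  unfolding vec.span_insert vec.span_eq_iff[THEN iffD2, OF assms] by simp

section \<open>Rank-one elements of large irreducible Lie algebras\<close>

text \<open>Used for determinants: a pencil spanned by two \<open>2 \<times> 2\<close> matrices contains a singular one.\<close>

lemma binary_quadratic_form_isotropic:
  fixes \<alpha> \<beta> \<gamma> :: complex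
  obtains s t where "s \<noteq> 0 \<or> t \<noteq> 0" "\<alpha> * s^2 + \<beta> * (s * t) + \<gamma> * t^2 = 0"
proof (cases "\<alpha> = 0")
  case True
  then show ?thesis using that[of 1 0] by simp
next
  case False
  define r where "r = csqrt (\<beta>^2 - 4 * \<alpha> * \<gamma>)"
  have r: "r^2 = \<beta>^2 - 4 * \<alpha> * \<gamma>" by (simp add: r_def)
  define s where "s = (r - \<beta>) / (2 * \<alpha>)"
  have s: "2 * \<alpha> * s = r - \<beta>" using False by (simp add: s_def)
  have "4 * \<alpha> * (\<alpha> * s^2 + \<beta> * s + \<gamma>) = (2 * \<alpha> * s)^2 + 2 * \<beta> * (2 * \<alpha> * s) + 4 * \<alpha> * \<gamma>"
    by (simp add: power2_eq_square algebra_simps)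
  also have "\<dots> = (r - \<beta>)^2 + 2 * \<beta> * (r - \<beta>) + 4 * \<alpha> * \<gamma>" by (simp only: s)
  also have "\<dots> = r^2 - \<beta>^2 + 4 * \<alpha> * \<gamma>" by (simp add: power2_eq_square algebra_simps)
  also have "\<dots> = 0" by (simp add: r)
  finally have "\<alpha> * s^2 + \<beta> * s + \<gamma> = 0" using False by simp
  then show ?thesis using that[of s 1] by simp
qed

text \<open>A singular matrix has rank at most one: its columns \<open>(A, C)\<close> and \<open>(B, D)\<close> are multiples of one
  nonzero column.\<close>

lemma singular_two_by_two:
  fixes A B C D :: complex
  assumes "A * D = B * C"
  obtains x y c1 c2 where "x \<noteq> 0 \<or> y \<noteq> 0" "A = c1 * x" "C = c1 * y" "B = c2 * x" "D = c2 * y"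
proof (cases "A = 0 \<and> C = 0")
  case True
  show ?thesis
  proof (cases "B = 0 \<and> D = 0")
    case True
    then show ?thesis using that[of 1 0 0 0] \<open>A = 0 \<and> C = 0\<close> by simp
  next
    case False
    then show ?thesis using that[of B D 0 1] \<open>A = 0 \<and> C = 0\<close> by auto
  qed
next
  case False
  show ?thesis
  proof (cases "A = 0")
    case True
    then have "C \<noteq> 0" "B = 0" using False assms by auto
    then show ?thesis using that[of A C 1 "D / C"] True by simp
  next
    case False
    then show ?thesis using that[of A C 1 "B / A"] assms by (simp add: field_simps)
  qed
qed

definition indep2 :: "complex^'d \<Rightarrow> complex^'d \<Rightarrow> bool" where
  "indep2 p q \<longleftrightarrow> (\<forall>s t. s *s p + t *s q = 0 \<longrightarrow> s = 0 \<and> t = 0)"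

lemma indep2D: "indep2 p q \<Longrightarrow> s *s p + t *s q = 0 \<Longrightarrow> s = 0 \<and> t = 0"
  by (simp add: indep2_def)

lemma indep2_nonzero: "indep2 p q \<Longrightarrow> s \<noteq> 0 \<or> t \<noteq> 0 \<Longrightarrow> s *s p + t *s q \<noteq> 0"
  by (auto simp: indep2_def)

lemma indep2_outer:
  assumes "indep2 p q" "outer p a + outer q b = 0"
  shows "a = 0 \<and> b = 0"
proof -
  have "pair a x *s p + pair b x *s q = 0" for x
    using arg_cong[OF assms(2), of "\<lambda>A. A *v x"]
    by (simp add: matrix_vector_mult_add_rdistrib outer_mult_vec)
  then have "pair a x = 0" "pair b x = 0" for x
    using indep2D[OF assms(1)] by blast+
  then show ?thesis by (auto intro!: pair_ext)
qed

text \<open>The bound \<open>small_codim\<close> on the real dimension says that \<open>g\<close> has complex codimension at most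
  \<open>2 N - 2\<close> among the \<open>N \<times> N\<close> matrices. The complexification of a subalgebra of \<open>su(p, q)\<close> satisfies
  it as soon as that subalgebra is at least as large as the stabilizer of a null line.\<close>

locale irreducible_lie_algebra =
  fixes g :: "(complex^'d^'d) set"
  assumes csub: "csubspace g"
    and bracket: "A \<in> g \<Longrightarrow> C \<in> g \<Longrightarrow> lie_bracket A C \<in> g"
    and traceless: "A \<in> g \<Longrightarrow> trace A = 0"
    and irreducible: "vec.subspace U \<Longrightarrow> (\<And>X u. X \<in> g \<Longrightarrow> u \<in> U \<Longrightarrow> X *v u \<in> U) \<Longrightarrow> U = {0} \<or> U = UNIV"
    and small_codim: "dim (ann g) + 4 \<le> 4 * CARD('d)"
    and card_ge_3: "3 \<le> CARD('d)"
begin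

lemma subspace_g: "subspace g"
  using csub by (simp add: csubspace_def)

lemma subspace_ann: "subspace (ann g)"
  using csubspace_ann[of g] by (simp add: csubspace_def)

lemmas g_scale = csubspace_scale[OF csub]
lemmas ann_scale = csubspace_scale[OF csubspace_ann[of g]]
lemmas g_add = subspace_add[OF subspace_g]
lemmas g_diff = subspace_diff[OF subspace_g]
lemmas g_neg = subspace_neg[OF subspace_g]
lemmas ann_add = subspace_add[OF subspace_ann]

lemma g_eq: "g = {X. \<forall>d\<in>ann g. trace (X ** d) = 0}"
  using ann_ann[OF csub] unfolding ann_def[of "ann g"] by simp

text \<open>A rank-one matrix \<open>v \<otimes> a\<close> lies in \<open>g\<close> exactly when the covector \<open>a\<close> kills the orbit of \<open>v\<close> under
  \<open>ann g\<close>, and the same holds with \<open>g\<close> and \<open>ann g\<close> exchanged. The search for rank-one elements runs on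
  this duality.\<close>

lemma outer_in_g_iff: "outer v a \<in> g \<longleftrightarrow> (\<forall>d\<in>ann g. pair a (d *v v) = 0)"
  by (subst g_eq) (simp add: trace_outer_mult)

lemma outer_in_ann_iff: "outer v a \<in> ann g \<longleftrightarrow> (\<forall>X\<in>g. pair a (X *v v) = 0)"
  by (simp add: ann_def trace_outer_mult)

lemma outer_in_g_pair: "outer v a \<in> g \<Longrightarrow> pair a v = 0"
  using traceless trace_outer by metis

lemma g_scale_iff: "c \<noteq> 0 \<Longrightarrow> mat c ** A \<in> g \<longleftrightarrow> A \<in> g"
  using g_scale[of A c] g_scale[of "mat c ** A" "1 / c"] by (auto simp: mat_mult_mat)

lemma ann_scale_iff: "c \<noteq> 0 \<Longrightarrow> mat c ** A \<in> ann g \<longleftrightarrow> A \<in> ann g"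
  using ann_scale[of A c] ann_scale[of "mat c ** A" "1 / c"] by (auto simp: mat_mult_mat)

text \<open>The trace form is invariant, so its annihilator is a module over \<open>g\<close>.\<close>

lemma ann_bracket:
  assumes "X \<in> g" "d \<in> ann g"
  shows "lie_bracket X d \<in> ann g"
proof -
  have "trace (lie_bracket X d ** Y) = 0" if "Y \<in> g" for Y
  proof -
    have "trace (lie_bracket X d ** Y) = trace (X ** (d ** Y)) - trace (d ** (X ** Y))"
      by (simp add: lie_bracket_def matrix_diff_rdistrib trace_sub matrix_mul_assoc)
    also have "trace (X ** (d ** Y)) = trace (d ** (Y ** X))"
      using trace_mul_sym[of X "d ** Y"] by (simp add: matrix_mul_assoc)
    also have "trace (d ** (Y ** X)) - trace (d ** (X ** Y)) = trace (d ** lie_bracket Y X)"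
      by (simp add: lie_bracket_def matrix_diff_ldistrib trace_sub)
    also have "\<dots> = 0"
      using assms that bracket by (simp add: ann_def)
    finally show ?thesis .
  qed
  then show ?thesis by (simp add: ann_def)
qed

text \<open>If \<open>X\<^sup>2 = 0\<close>, then \<open>(ad X)\<^sup>2 d = - 2 X d X\<close>.\<close>

lemma ann_square_zero_sandwich:
  assumes X: "X \<in> g" "X ** X = 0" and d: "d \<in> ann g"
  shows "X ** d ** X \<in> ann g"
proof -
  have z: "A ** X ** X = 0" for A
    using X(2) by (simp add: matrix_mul_assoc[symmetric])
  have "lie_bracket X (lie_bracket X d) = (- 2) *\<^sub>R (X ** d ** X)"
    by (simp add: lie_bracket_def matrix_diff_ldistrib matrix_diff_rdistrib matrix_mul_assoc X(2) z scaleR_2)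
  then have "(- 2) *\<^sub>R (X ** d ** X) \<in> ann g"
    using ann_bracket[OF X(1) ann_bracket[OF X(1) d]] by simp
  then have "(- 1/2) *\<^sub>R ((- 2) *\<^sub>R (X ** d ** X)) \<in> ann g"
    by (rule subspace_scale[OF subspace_ann])
  then show ?thesis by simp
qed

text \<open>If \<open>X\<^sup>3 = 0\<close>, then \<open>(ad X)\<^sup>4 d = 6 X\<^sup>2 d X\<^sup>2\<close>.\<close>

lemma ann_cube_zero_sandwich:
  assumes X: "X \<in> g" "X ** X ** X = 0" and d: "d \<in> ann g"
  shows "X ** X ** d ** X ** X \<in> ann g"
proof -
  have z: "A ** X ** X ** X = 0" for A
    using X(2) by (simp add: matrix_mul_assoc[symmetric])
  have ad2: "lie_bracket X (lie_bracket X e) = X ** X ** e - (2 *\<^sub>R (X ** e ** X) - e ** X ** X)" for e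
    unfolding lie_bracket_def matrix_diff_ldistrib matrix_diff_rdistrib matrix_mul_assoc scaleR_2
    by (simp only: algebra_simps)
  define d2 where "d2 = X ** X ** d - (2 *\<^sub>R (X ** d ** X) - d ** X ** X)"
  have "X ** X ** d2 = X ** X ** d ** X ** X" "X ** d2 ** X = - 2 *\<^sub>R (X ** X ** d ** X ** X)"
    "d2 ** X ** X = X ** X ** d ** X ** X"
    by (simp_all add: d2_def matrix_diff_ldistrib matrix_diff_rdistrib matrix_mul_assoc X(2) z
        matrix_scaleR_mult_left matrix_scaleR_mult_right)
  then have "lie_bracket X (lie_bracket X d2) = 6 *\<^sub>R (X ** X ** d ** X ** X)"
    unfolding ad2 by (simp only:) (simp add: vec_eq_iff scaleR_conv_of_real[where 'a=complex])
  then have "lie_bracket X (lie_bracket X (lie_bracket X (lie_bracket X d))) = 6 *\<^sub>R (X ** X ** d ** X ** X)"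
    by (simp only: ad2[of d] d2_def)
  then have "6 *\<^sub>R (X ** X ** d ** X ** X) \<in> ann g"
    using X(1) d ann_bracket by metis
  then have "(1/6) *\<^sub>R (6 *\<^sub>R (X ** X ** d ** X ** X)) \<in> ann g"
    by (rule subspace_scale[OF subspace_ann])
  then show ?thesis by simp
qed

text \<open>The element \<open>X = p1 \<otimes> a + p2 \<otimes> b\<close> maps into the plane of \<open>p1\<close> and \<open>p2\<close> and kills it, and for
  \<open>d \<in> ann g\<close> the product \<open>X d X\<close> is governed by the \<open>2 \<times> 2\<close> matrix with entries \<open>a (d p1)\<close>, \<open>b (d p1)\<close>,
  \<open>a (d p2)\<close>, \<open>b (d p2)\<close>. Either some combination \<open>s a + t b\<close> kills the orbit of \<open>p1\<close> under \<open>ann g\<close>, and then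
  \<open>p1 \<otimes> (s a + t b)\<close> lies in \<open>g\<close>; or some \<open>d\<close> makes that matrix singular but not zero, and then \<open>X d X\<close>
  is an element of \<open>ann g\<close> of rank one.\<close>

lemma square_zero_rank_two_gives_rank_one:
  assumes X: "outer p1 a + outer p2 b \<in> g" and p: "indep2 p1 p2" and ab: "indep2 a b"
    and kill: "pair a p1 = 0" "pair a p2 = 0" "pair b p1 = 0" "pair b p2 = 0"
  shows "\<exists>s t \<psi>. s *s p1 + t *s p2 \<noteq> 0 \<and> \<psi> \<noteq> 0 \<and> pair \<psi> (s *s p1 + t *s p2) = 0 \<and>
    outer (s *s p1 + t *s p2) \<psi> \<in> g \<union> ann g"
proof (cases "\<exists>s t. (s \<noteq> 0 \<or> t \<noteq> 0) \<and> (\<forall>d\<in>ann g. pair (s *s a + t *s b) (d *v p1) = 0)")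
  case True
  then obtain s t where st: "s \<noteq> 0 \<or> t \<noteq> 0" "outer p1 (s *s a + t *s b) \<in> g"
    unfolding outer_in_g_iff by blast
  have "s *s a + t *s b \<noteq> 0" using indep2_nonzero[OF ab st(1)] .
  moreover have "p1 \<noteq> 0" using indep2_nonzero[OF p, of 1 0] by simp
  moreover have "1 *s p1 + 0 *s p2 = p1" by simp
  ultimately show ?thesis using st(2) kill
    by (intro exI[of _ 1] exI[of _ 0] exI[of _ "s *s a + t *s b"]) (simp add: pair_simps)
next
  case False
  then have no: "\<exists>d\<in>ann g. s * pair a (d *v p1) + t * pair b (d *v p1) \<noteq> 0" if "s \<noteq> 0 \<or> t \<noteq> 0" for s t
    using that by (auto simp: pair_simps)
  \<comment> \<open>the vectors \<open>(a (d p1), b (d p1))\<close> for \<open>d = d1\<close> and \<open>d = d2\<close> are independent, so no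
    nontrivial combination of \<open>d1\<close> and \<open>d2\<close> gives the zero matrix\<close>
  obtain d1 where d1: "d1 \<in> ann g" "pair a (d1 *v p1) \<noteq> 0"
    using no[of 1 0] by auto
  obtain d2 where d2: "d2 \<in> ann g"
      "pair b (d1 *v p1) * pair a (d2 *v p1) - pair a (d1 *v p1) * pair b (d2 *v p1) \<noteq> 0"
    using no[of "pair b (d1 *v p1)" "- pair a (d1 *v p1)"] d1(2) by auto
  let ?m = "\<lambda>d. pair a (d *v p1)" and ?n = "\<lambda>d. pair b (d *v p1)"
  let ?k = "\<lambda>d. pair a (d *v p2)" and ?l = "\<lambda>d. pair b (d *v p2)"
  obtain s t where st: "s \<noteq> 0 \<or> t \<noteq> 0"
    "(?m d1 * ?l d1 - ?k d1 * ?n d1) * s^2 +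
     (?m d1 * ?l d2 + ?m d2 * ?l d1 - ?k d1 * ?n d2 - ?k d2 * ?n d1) * (s * t) +
     (?m d2 * ?l d2 - ?k d2 * ?n d2) * t^2 = 0"
    by (rule binary_quadratic_form_isotropic)
  define d where "d = mat s ** d1 + mat t ** d2"
  have d: "d \<in> ann g" unfolding d_def using d1(1) d2(1) ann_scale ann_add by blast
  have lin: "pair c (d *v x) = s * pair c (d1 *v x) + t * pair c (d2 *v x)" for c x
    by (simp add: d_def matrix_vector_mult_add_rdistrib mat_mult_vec_assoc pair_simps)
  have det: "?m d * ?l d = ?k d * ?n d"
    using st(2) unfolding lin by (simp add: power2_eq_square algebra_simps)
  have nz: "?m d \<noteq> 0 \<or> ?n d \<noteq> 0"
  proof (rule ccontr)
    assume "\<not> ?thesis"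
    then have eq: "s * ?m d1 + t * ?m d2 = 0" "s * ?n d1 + t * ?n d2 = 0" by (auto simp: lin)
    have "s * (?n d1 * ?m d2 - ?m d1 * ?n d2) = ?m d2 * (s * ?n d1 + t * ?n d2) - ?n d2 * (s * ?m d1 + t * ?m d2)"
      "t * (?n d1 * ?m d2 - ?m d1 * ?n d2) = ?n d1 * (s * ?m d1 + t * ?m d2) - ?m d1 * (s * ?n d1 + t * ?n d2)"
      by (simp_all add: algebra_simps)
    then show False using eq d2(2) st(1) by auto
  qed
  obtain x y c1 c2 where xy: "x \<noteq> 0 \<or> y \<noteq> 0" "?m d = c1 * x" "?n d = c1 * y" "?k d = c2 * x" "?l d = c2 * y"
    using det by (rule singular_two_by_two)
  define q where "q = x *s p1 + y *s p2"
  define \<psi> where "\<psi> = c1 *s a + c2 *s b"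
  let ?X = "outer p1 a + outer p2 b"
  have "?X ** ?X = 0"
    by (simp add: matrix_add_ldistrib matrix_add_rdistrib outer_mult_outer kill)
  then have "?X ** d ** ?X \<in> ann g"
    using ann_square_zero_sandwich[OF X _ d] by simp
  moreover have "?X ** d ** ?X = outer q \<psi>"
  proof -
    have "?X ** d ** ?X = outer (?X *v (d *v p1)) a + outer (?X *v (d *v p2)) b"
      by (simp add: matrix_add_ldistrib mult_outer matrix_vector_mul_assoc)
    also have "?X *v (d *v p1) = c1 *s q"
      by (simp add: q_def matrix_vector_mult_add_rdistrib outer_mult_vec xy vec.scale_right_distrib)
    also have "?X *v (d *v p2) = c2 *s q"
      by (simp add: q_def matrix_vector_mult_add_rdistrib outer_mult_vec xy vec.scale_right_distrib)
    finally show ?thesis by (simp add: \<psi>_def outer_linear outer_scale_left outer_scale_right)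
  qed
  ultimately have "outer q \<psi> \<in> ann g" by simp
  moreover have "q \<noteq> 0" unfolding q_def by (rule indep2_nonzero[OF p xy(1)])
  moreover have "c1 \<noteq> 0" using nz xy by auto
  then have "\<psi> \<noteq> 0" unfolding \<psi>_def by (intro indep2_nonzero[OF ab]) simp
  moreover have "pair \<psi> q = 0" by (simp add: q_def \<psi>_def pair_simps kill)
  ultimately show ?thesis unfolding q_def by blast
qed

text \<open>On the plane of \<open>p1\<close> and \<open>p2\<close> the element \<open>X = p1 \<otimes> a + p2 \<otimes> b\<close> has determinant zero by assumption
  and trace zero because \<open>g\<close> is traceless; so \<open>X\<^sup>2\<close> vanishes on the plane and \<open>X\<^sup>3 = 0\<close>. If \<open>X\<^sup>2\<close> is not
  zero, it has rank one; it lies in \<open>g\<close> if all of \<open>ann g\<close> pairs to zero with it, and otherwise some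
  \<open>X\<^sup>2 d X\<^sup>2\<close> is a nonzero multiple of it and lies in \<open>ann g\<close>. If \<open>X\<^sup>2 = 0\<close>, then either \<open>X\<close> itself has
  rank one or the previous lemma applies.\<close>

lemma rank_two_gives_rank_one:
  assumes X: "outer p1 a + outer p2 b \<in> g" "outer p1 a + outer p2 b \<noteq> 0" and p: "indep2 p1 p2"
    and det: "pair a p1 * pair b p2 = pair a p2 * pair b p1"
  shows "\<exists>s t \<psi>. s *s p1 + t *s p2 \<noteq> 0 \<and> \<psi> \<noteq> 0 \<and> pair \<psi> (s *s p1 + t *s p2) = 0 \<and>
    outer (s *s p1 + t *s p2) \<psi> \<in> g \<union> ann g"
proof -
  let ?X = "outer p1 a + outer p2 b"
  have tr: "pair a p1 + pair b p2 = 0"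
    using traceless[OF X(1)] by (simp add: trace_add trace_outer)
  obtain x y c1 c2 where xy: "x \<noteq> 0 \<or> y \<noteq> 0" "pair a p1 = c1 * x" "pair b p1 = c1 * y"
      "pair a p2 = c2 * x" "pair b p2 = c2 * y"
    using det by (rule singular_two_by_two)
  define q where "q = x *s p1 + y *s p2"
  define \<psi> where "\<psi> = c1 *s a + c2 *s b"
  have tr': "x * c1 + y * c2 = 0" using tr xy by (simp add: mult.commute)
  have Xp: "?X *v p1 = c1 *s q" "?X *v p2 = c2 *s q"
    by (simp_all add: q_def matrix_vector_mult_add_rdistrib outer_mult_vec xy vec.scale_right_distrib)
  have "?X *v q = x *s (?X *v p1) + y *s (?X *v p2)"
    by (simp only: q_def vec.add vec.scale)
  then have "?X *v q = (x * c1 + y * c2) *s q"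
    unfolding Xp by (simp add: vec.scale_left_distrib)
  then have Xq: "?X *v q = 0" using tr' by simp
  have XX: "?X ** ?X = outer q \<psi>"
  proof -
    have "?X ** ?X = outer (?X *v p1) a + outer (?X *v p2) b"
      by (simp only: matrix_add_ldistrib mult_outer)
    then show ?thesis unfolding Xp by (simp add: \<psi>_def outer_linear outer_scale_left outer_scale_right)
  qed
  have \<psi>q: "pair \<psi> q = 0"
  proof -
    have "pair \<psi> q = (x * c1 + y * c2) * (c1 * x + c2 * y)"
      by (simp add: \<psi>_def q_def pair_simps xy algebra_simps)
    then show ?thesis using tr' by simp
  qed
  have q: "q \<noteq> 0" unfolding q_def by (rule indep2_nonzero[OF p xy(1)])
  show ?thesis
  proof (cases "\<psi> = 0")
    case False
    have XXX: "?X ** ?X ** ?X = 0"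
      by (metis XX Xq matrix_mul_assoc mult_outer outer_zero_left)
    have "outer q \<psi> \<in> g \<union> ann g"
    proof (cases "\<exists>d\<in>ann g. pair \<psi> (d *v q) \<noteq> 0")
      case True
      then obtain d where d: "d \<in> ann g" "pair \<psi> (d *v q) \<noteq> 0" by blast
      have "?X ** ?X ** d ** ?X ** ?X = outer q \<psi> ** d ** outer q \<psi>"
        by (metis XX matrix_mul_assoc)
      also have "\<dots> = mat (pair \<psi> (d *v q)) ** outer q \<psi>"
        by (simp add: outer_mult outer_mult_outer pair_vector_matrix outer_scale_left vec_mult_outer outer_scale_right)
      finally have "mat (pair \<psi> (d *v q)) ** outer q \<psi> \<in> ann g"
        using ann_cube_zero_sandwich[OF X(1) XXX d(1)] by simp
      then show ?thesis using ann_scale_iff[OF d(2)] by simp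
    next
      case False
      then show ?thesis using outer_in_g_iff by blast
    qed
    then show ?thesis using q False \<psi>q unfolding q_def by blast
  next
    case True
    show ?thesis
    proof (cases "indep2 a b")
      case True
      then have "c1 = 0" "c2 = 0" using indep2D[OF True] \<open>\<psi> = 0\<close> unfolding \<psi>_def by blast+
      then show ?thesis
        using square_zero_rank_two_gives_rank_one[OF X(1) p True] xy by simp
    next
      case False
      then obtain s t where st: "s *s a + t *s b = 0" "s \<noteq> 0 \<or> t \<noteq> 0" unfolding indep2_def by blast
      have "\<exists>x y \<eta>. (x \<noteq> 0 \<or> y \<noteq> 0) \<and> ?X = outer (x *s p1 + y *s p2) \<eta>"
      proof (cases "s = 0")
        case True
        then have "b = 0" using st by simp
        then have "?X = outer (1 *s p1 + 0 *s p2) a" by simp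
        then show ?thesis by (metis one_neq_zero)
      next
        case False
        have "s *s a = (- t) *s b" using st(1) by (simp add: add_eq_0_iff)
        then have "a = (- t / s) *s b"
          using False by (metis divide_self_if mult.commute times_divide_eq_left vec.scale_one vec.scale_scale)
        then have "?X = outer ((- t / s) *s p1 + 1 *s p2) b"
          by (metis outer_add_left outer_scale_left outer_scale_right vec.scale_one)
        then show ?thesis by (metis one_neq_zero)
      qed
      then obtain x y \<eta> where e: "x \<noteq> 0 \<or> y \<noteq> 0" "?X = outer (x *s p1 + y *s p2) \<eta>" by blast
      have "\<eta> \<noteq> 0" using X(2) e(2) by auto
      moreover have "outer (x *s p1 + y *s p2) \<eta> \<in> g" using X(1) e(2) by simp
      ultimately show ?thesis
        using indep2_nonzero[OF p e(1)] outer_in_g_pair by blast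
    qed
  qed
qed

text \<open>The matrices with image in the plane form a space of complex dimension \<open>2 N\<close>, which meets \<open>g\<close> in
  dimension at least two since \<open>g\<close> has codimension at most \<open>2 N - 2\<close>. On two independent elements of the
  intersection the determinant on the plane is a binary quadratic form and therefore has a nontrivial
  zero.\<close>

lemma plane_meets_rank_one_centers_weak:
  assumes p: "indep2 p1 p2"
  shows "\<exists>s t \<psi>. s *s p1 + t *s p2 \<noteq> 0 \<and> \<psi> \<noteq> 0 \<and> pair \<psi> (s *s p1 + t *s p2) = 0 \<and>
    outer (s *s p1 + t *s p2) \<psi> \<in> g \<union> ann g"
proof -
  define F where "F z = outer p1 (fst z) + outer p2 (snd z)" for z :: "(complex^'d) \<times> (complex^'d)"
  have lin: "linear F"
    by (rule linearI) (simp_all add: F_def outer_linear outer_scaleR_right algebra_simps)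
  have "inj F"
  proof (rule injI)
    fix z z' assume "F z = F z'"
    then have "outer p1 (fst z - fst z') + outer p2 (snd z - snd z') = 0"
      by (simp add: F_def outer_linear algebra_simps)
    from indep2_outer[OF p this] show "z = z'" by (auto simp: prod_eq_iff)
  qed
  then have "inj_on F (span UNIV)" by simp
  then have dT: "dim (range F) = 4 * CARD('d)"
    using dim_image_eq[OF lin, of UNIV] by simp
  have T: "subspace (range F)" by (rule linear_subspace_image[OF lin subspace_UNIV])
  have "dim {x + y | x y. x \<in> g \<and> y \<in> range F} + dim (g \<inter> range F) = dim g + dim (range F)"
    by (rule dim_sums_Int[OF subspace_g T])
  moreover have "dim {x + y | x y. x \<in> g \<and> y \<in> range F} \<le> 2 * CARD('d)^2"
    unfolding dim_UNIV_matrix[symmetric] by (rule dim_subset[OF subset_UNIV])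
  ultimately have d4: "4 \<le> dim (g \<inter> range F)"
    using dT dim_ann[OF csub] small_codim by linarith
  then have "\<not> g \<inter> range F \<subseteq> {0}" using dim_eq_0[of "g \<inter> range F"] by linarith
  then obtain X1 where X1: "X1 \<in> g" "X1 \<in> range F" "X1 \<noteq> 0" by blast
  have "\<not> g \<inter> range F \<subseteq> span {X1, mat \<i> ** X1}"
  proof
    assume "g \<inter> range F \<subseteq> span {X1, mat \<i> ** X1}"
    then have "dim (g \<inter> range F) \<le> card {X1, mat \<i> ** X1}"
      by (intro dim_le_card) auto
    also have "\<dots> \<le> 2" by (simp add: card_insert_if)
    finally show False using d4 by simp
  qed
  then obtain X2 where X2: "X2 \<in> g" "X2 \<in> range F" "X2 \<notin> span {X1, mat \<i> ** X1}" by blast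
  have comb: "mat c ** X1 \<in> span {X1, mat \<i> ** X1}" for c
  proof -
    have c: "c = complex_of_real (Re c) + \<i> * complex_of_real (Im c)" by (rule complex_eq)
    have "mat c ** X1 = Re c *\<^sub>R X1 + Im c *\<^sub>R (mat \<i> ** X1)"
      by (subst c) (simp add: vec_eq_iff mat_mult_entry scaleR_conv_of_real[where 'a=complex] algebra_simps)
    then show ?thesis by (simp add: span_add span_scale span_base)
  qed
  have nz: "mat s ** X1 + mat t ** X2 \<noteq> 0" if st: "s \<noteq> 0 \<or> t \<noteq> 0" for s t
  proof
    assume 0: "mat s ** X1 + mat t ** X2 = 0"
    show False
    proof (cases "t = 0")
      case True
      then have "mat s ** X1 = 0" "s \<noteq> 0" using 0 st by (auto simp: vec_eq_iff mat_mult_entry)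
      then show False using X1(3) by (auto simp: vec_eq_iff mat_mult_entry)
    next
      case False
      have "X2 = mat (- s / t) ** X1"
        using 0 False by (simp add: vec_eq_iff mat_mult_entry field_simps eq_neg_iff_add_eq_0 add.commute)
      then show False using X2(3) comb by metis
    qed
  qed
  obtain a1 b1 where ab1: "X1 = outer p1 a1 + outer p2 b1" using X1(2) by (auto simp: F_def)
  obtain a2 b2 where ab2: "X2 = outer p1 a2 + outer p2 b2" using X2(2) by (auto simp: F_def)
  obtain s t where st: "s \<noteq> 0 \<or> t \<noteq> 0"
    "(pair a1 p1 * pair b1 p2 - pair a1 p2 * pair b1 p1) * s^2 +
     (pair a1 p1 * pair b2 p2 + pair a2 p1 * pair b1 p2 - pair a1 p2 * pair b2 p1 - pair a2 p2 * pair b1 p1) * (s * t) +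
     (pair a2 p1 * pair b2 p2 - pair a2 p2 * pair b2 p1) * t^2 = 0"
    by (rule binary_quadratic_form_isotropic)
  define a where "a = s *s a1 + t *s a2"
  define b where "b = s *s b1 + t *s b2"
  have X: "outer p1 a + outer p2 b = mat s ** X1 + mat t ** X2"
    by (simp add: a_def b_def ab1 ab2 outer_linear outer_scale_right matrix_add_ldistrib)
  have "outer p1 a + outer p2 b \<in> g"
    unfolding X using X1(1) X2(1) g_scale g_add by blast
  moreover have "outer p1 a + outer p2 b \<noteq> 0"
    unfolding X by (rule nz[OF st(1)])
  moreover have "pair a p1 * pair b p2 = pair a p2 * pair b p1"
    using st(2) by (simp add: a_def b_def pair_simps power2_eq_square algebra_simps)
  ultimately show ?thesis by (intro rank_two_gives_rank_one[OF _ _ p])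
qed

end

lemma exists_pair_one:
  assumes "a \<noteq> 0"
  obtains u where "pair a u = 1"
proof -
  obtain x where "pair a x \<noteq> 0"
    using assms pair_ext[of a 0] by auto
  then have "pair a ((1 / pair a x) *s x) = 1" by (simp add: pair_simps)
  then show ?thesis by (rule that)
qed

lemma indep2_exists:
  assumes "2 \<le> CARD('d)"
  obtains p q :: "complex^'d" where "indep2 p q"
proof -
  obtain i j :: 'd where ij: "i \<noteq> j"
    using assms by (metis (mono_tags, lifting) UNIV_I card_le_Suc0_iff_eq finite not_less_eq_eq numeral_2_eq_2)
  have "s = 0 \<and> t = 0" if "s *s axis i 1 + t *s axis j 1 = (0 :: complex^'d)" for s t
    using arg_cong[OF that, of "\<lambda>x. x $ i"] arg_cong[OF that, of "\<lambda>x. x $ j"] ij by (simp add: axis_def)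
  then show ?thesis using that unfolding indep2_def by blast
qed

context irreducible_lie_algebra
begin

text \<open>If no \<open>w \<otimes> \<psi>\<close> lies in \<open>g\<close>, then by duality the orbit of \<open>w\<close> under \<open>ann g\<close> is the whole space, so
  the elements of \<open>ann g\<close> that kill \<open>w\<close> form a space \<open>K\<close> of real dimension at most \<open>2 N - 4\<close>. But
  \<open>w \<otimes> \<phi> \<in> ann g\<close> provides more of them. Let \<open>G\<close> be the sum of the line of \<open>w\<close> and its orbit under \<open>g\<close>, and
  choose \<open>u\<close> with \<open>\<phi> u = 1\<close>. Brackets of \<open>w \<otimes> \<phi>\<close> with \<open>g\<close> give elements of \<open>K\<close> that map \<open>u\<close> to any given
  vector of \<open>G\<close>, and all \<open>w \<otimes> \<epsilon>\<close> with \<open>\<epsilon>\<close> killing \<open>G\<close> and \<open>u\<close> are elements of \<open>K\<close> that kill \<open>u\<close>.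
  Together this makes \<open>K\<close> at least \<open>2 N - 2\<close> dimensional.\<close>

lemma rank_one_in_ann_gives_rank_one_in_g:
  assumes w\<phi>: "outer w \<phi> \<in> ann g" and w: "w \<noteq> 0" and \<phi>: "\<phi> \<noteq> 0" and \<phi>w: "pair \<phi> w = 0"
  shows "\<exists>\<psi>. \<psi> \<noteq> 0 \<and> outer w \<psi> \<in> g"
proof (rule ccontr)
  assume no: "\<not> ?thesis"
  have \<phi>g: "pair \<phi> (X *v w) = 0" if "X \<in> g" for X
    using w\<phi> that outer_in_ann_iff by blast
  define ev where "ev x d = d *v x" for x :: "complex^'d" and d :: "complex^'d^'d"
  have lin: "linear (ev x)" for x
    unfolding ev_def
    by (rule linearI) (simp_all add: matrix_vector_mult_add_rdistrib mat_scaleR_scale mat_mult_vec_assoc vec_scaleR_scale)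
  have "vec.subspace (ev w ` ann g)"
    unfolding ev_def by (rule vec_subspace_orbit[OF csubspace_ann])
  moreover have "\<not> (\<exists>\<psi>. \<psi> \<noteq> 0 \<and> (\<forall>u\<in>ev w ` ann g. pair \<psi> u = 0))"
    using no unfolding outer_in_g_iff ev_def by blast
  ultimately have "ev w ` ann g = UNIV"
    by (metis proper_subspace_annihilated)
  then have "dim (ev w ` ann g) = 2 * CARD('d)" by simp
  moreover define K where "K = {d \<in> ann g. ev w d = 0}"
  ultimately have dK: "2 * CARD('d) + dim K = dim (ann g)"
    using dim_kernel_image[OF lin[of w] subspace_ann] by simp
  have K: "subspace K"
    using subspace_ann unfolding K_def subspace_def
    by (simp add: linear_add[OF lin] linear_scale[OF lin] linear_0[OF lin])
  obtain u where u: "pair \<phi> u = 1" using exists_pair_one[OF \<phi>] .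
  define G where "G = vec.span (insert w ((\<lambda>X. X *v w) ` g))"
  have G: "vec.subspace G" by (simp add: G_def)
  have wG: "w \<in> G" unfolding G_def by (rule vec.span_base) simp
  have gG: "X *v w \<in> G" if "X \<in> g" for X
    unfolding G_def by (rule vec.span_base) (use that in simp)
  have \<phi>G: "pair \<phi> x = 0" if "x \<in> G" for x
    using that vec.span_minimal[of "insert w ((\<lambda>X. X *v w) ` g)" "{x. pair \<phi> x = 0}"] \<phi>g \<phi>w vec_subspace_pair_kernel
    unfolding G_def by auto
  have "G \<subseteq> ev u ` K"
  proof
    fix x assume "x \<in> G"
    then obtain X c where "X \<in> g" "x - c *s w = X *v w"
      unfolding G_def mem_span_insert_subspace[OF vec_subspace_orbit[OF csub]] by blast
    then have X: "X \<in> g" "x = X *v w + c *s w" by (simp_all add: algebra_simps)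
    \<comment> \<open>the multiple of \<open>w \<otimes> \<phi>\<close> corrects the component of \<open>d u\<close> along \<open>w\<close> and still kills \<open>w\<close>\<close>
    define d where "d = lie_bracket X (outer w \<phi>) + mat (c + pair \<phi> (X *v u)) ** outer w \<phi>"
    have "d \<in> ann g"
      unfolding d_def using ann_bracket[OF X(1) w\<phi>] ann_scale[OF w\<phi>] ann_add by blast
    moreover have "ev w d = 0"
      using \<phi>g[OF X(1)] \<phi>w
      by (simp add: d_def ev_def lie_bracket_outer algebra_simps outer_mult_vec mat_mult_vec_assoc pair_vector_matrix)
    moreover have "ev u d = x"
      using u X(2)
      by (simp add: d_def ev_def lie_bracket_outer matrix_vector_mult_add_rdistrib matrix_vector_mult_diff_rdistrib
          outer_mult_vec mat_mult_vec_assoc pair_vector_matrix vec.scale_left_distrib)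
    ultimately show "x \<in> ev u ` K" unfolding K_def by blast
  qed
  then have 1: "dim G \<le> dim (ev u ` K)" by (rule dim_subset)
  let ?E = "ann_vec (vec.span (insert u G))"
  have "u \<notin> G" using \<phi>G u by force
  then have "dim (vec.span (insert u G)) = dim G + 2"
    using dim_vec_span_insert[of u G] G by (simp add: vec.span_eq_iff[THEN iffD2])
  then have dE: "dim ?E + dim G + 2 = 2 * CARD('d)"
    using dim_ann_vec[of "vec.span (insert u G)"] by simp
  have "linear (outer w)"
    by (rule linearI) (simp_all add: outer_linear outer_scaleR_right)
  moreover have "inj (outer w)"
  proof (rule injI)
    fix a b assume "outer w a = outer w b"
    then have "outer w (a - b) = 0" by (simp add: outer_linear)
    then show "a = b" using w outer_eq_0_iff[of w "a - b"] by simp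
  qed
  ultimately have dE': "dim (outer w ` ?E) = dim ?E"
    using dim_image_eq[of "outer w" ?E] inj_on_subset[of "outer w" UNIV] by blast
  have "outer w ` ?E \<subseteq> {d \<in> K. ev u d = 0}"
  proof
    fix d assume "d \<in> outer w ` ?E"
    then obtain \<epsilon> where d: "d = outer w \<epsilon>" and \<epsilon>: "\<epsilon> \<in> ?E" by blast
    have "pair \<epsilon> x = 0" if "x \<in> insert u G" for x
      using \<epsilon> vec.span_base[OF that] by (simp add: ann_vec_def)
    then show "d \<in> {d \<in> K. ev u d = 0}"
      using wG gG by (simp add: d K_def ev_def outer_mult_vec outer_in_ann_iff)
  qed
  then have 2: "dim ?E \<le> dim {d \<in> K. ev u d = 0}"
    unfolding dE'[symmetric] by (rule dim_subset)
  have "dim (ev u ` K) + dim {d \<in> K. ev u d = 0} = dim K"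
    by (rule dim_kernel_image[OF lin K])
  then show False using 1 2 dE dK small_codim by linarith
qed

lemma plane_meets_rank_one_centers:
  assumes "indep2 p1 p2"
  shows "\<exists>s t \<psi>. s *s p1 + t *s p2 \<noteq> 0 \<and> \<psi> \<noteq> 0 \<and> outer (s *s p1 + t *s p2) \<psi> \<in> g"
  using plane_meets_rank_one_centers_weak[OF assms] rank_one_in_ann_gives_rank_one_in_g by (meson UnE)

text \<open>Otherwise all rank-one elements of \<open>g\<close> lie in \<open>ann g\<close> too. Let \<open>\<Psi> p\<close> be the space of covectors \<open>\<psi>\<close>
  with \<open>p \<otimes> \<psi> \<in> g\<close>, and call \<open>p\<close> a center if this space is not zero. If some \<open>\<psi> \<in> \<Psi> p\<close> does not kill \<open>q\<close>,
  brackets show that \<open>\<Psi> q\<close> is a proper subspace of \<open>\<Psi> p\<close>. Hence, if \<open>w\<close> is a center with \<open>\<Psi> w\<close> of least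
  dimension, any \<open>\<phi> \<in> \<Psi> w\<close> kills all centers; as every plane contains a center, the centers fill the
  kernel of \<open>\<phi>\<close>. Descent along the proper inclusions shows \<open>\<phi> \<in> \<Psi> p\<close> for every \<open>p\<close> in this kernel, and
  then the kernel is invariant under \<open>g\<close>, against irreducibility.\<close>

lemma rank_one_not_orthogonal_to_g:
  "\<exists>v \<psi> X. outer v \<psi> \<in> g \<and> X \<in> g \<and> pair \<psi> (X *v v) \<noteq> 0"
proof (rule ccontr)
  assume "\<not> ?thesis"
  then have orth: "pair \<psi> (X *v v) = 0" if "outer v \<psi> \<in> g" "X \<in> g" for v \<psi> X
    using that by blast
  define \<Psi> where "\<Psi> p = {\<psi>. outer p \<psi> \<in> g}" for p
  have sub\<Psi>: "subspace (\<Psi> p)" for p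
    unfolding \<Psi>_def subspace_def
    using subspace_0[OF subspace_g] g_add subspace_scale[OF subspace_g]
    by (simp add: outer_linear outer_scaleR_right)
  have step: "\<Psi> q \<subseteq> \<Psi> p \<and> dim (\<Psi> q) < dim (\<Psi> p)" if "\<psi> \<in> \<Psi> p" "pair \<psi> q \<noteq> 0" for p q \<psi>
  proof -
    have \<psi>: "outer p \<psi> \<in> g" using that by (simp add: \<Psi>_def)
    have "\<Psi> q \<subseteq> \<Psi> p"
    proof
      fix \<eta> assume "\<eta> \<in> \<Psi> q"
      then have \<eta>: "outer q \<eta> \<in> g" by (simp add: \<Psi>_def)
      have "pair \<eta> p * pair \<psi> q = 0"
        using orth[OF \<psi> \<eta>] by (simp add: outer_mult_vec pair_simps)
      then have "pair \<eta> p = 0" using that by simp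
      then have "lie_bracket (outer p \<psi>) (outer q \<eta>) = mat (pair \<psi> q) ** outer p \<eta>"
        by (simp add: lie_bracket_outer outer_mult_vec vec_mult_outer outer_scale_left)
      then have "mat (pair \<psi> q) ** outer p \<eta> \<in> g" using bracket[OF \<psi> \<eta>] by simp
      then show "\<eta> \<in> \<Psi> p" using g_scale_iff[OF that(2)] by (simp add: \<Psi>_def)
    qed
    moreover have "\<psi> \<notin> \<Psi> q" using that(2) outer_in_g_pair by (auto simp: \<Psi>_def)
    ultimately have "\<Psi> q \<subset> \<Psi> p" using that(1) by blast
    then have "span (\<Psi> q) \<subset> span (\<Psi> p)"
      using sub\<Psi> by (simp only: span_eq_iff[THEN iffD2])
    then show ?thesis using dim_psubset \<open>\<Psi> q \<subseteq> \<Psi> p\<close> by blast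
  qed
  define C where "C p \<longleftrightarrow> p \<noteq> 0 \<and> (\<exists>\<psi>. \<psi> \<noteq> 0 \<and> \<psi> \<in> \<Psi> p)" for p
  obtain p1 p2 :: "complex^'d" where p: "indep2 p1 p2"
    using indep2_exists card_ge_3 by (metis numeral_2_eq_2 numeral_3_eq_3 Suc_leD)
  obtain p0 where "C p0"
    using plane_meets_rank_one_centers[OF p] unfolding C_def \<Psi>_def by blast
  then obtain w where w: "C w" "\<And>q. C q \<Longrightarrow> dim (\<Psi> w) \<le> dim (\<Psi> q)"
    using ex_has_least_nat[of C p0 "\<lambda>p. dim (\<Psi> p)"] by blast
  then obtain \<phi> where \<phi>: "\<phi> \<noteq> 0" "\<phi> \<in> \<Psi> w" unfolding C_def by blast
  have Cker: "pair \<phi> q = 0" if "C q" for q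
    using step[OF \<phi>(2), of q] w(2)[OF that] by linarith
  obtain u where u: "pair \<phi> u = 1" using exists_pair_one[OF \<phi>(1)] .
  have kerC: "C p" if "p \<noteq> 0" "pair \<phi> p = 0" for p
  proof -
    have "indep2 p u"
      unfolding indep2_def
    proof (intro allI impI)
      fix s t assume 0: "s *s p + t *s u = 0"
      have "pair \<phi> (s *s p + t *s u) = t" using that(2) u by (simp add: pair_simps)
      then have "t = 0" using 0 by simp
      then show "s = 0 \<and> t = 0" using 0 that(1) by simp
    qed
    then obtain s t \<psi> where st: "s *s p + t *s u \<noteq> 0" "\<psi> \<noteq> 0" "outer (s *s p + t *s u) \<psi> \<in> g"
      using plane_meets_rank_one_centers by blast
    then have "C (s *s p + t *s u)" by (auto simp: C_def \<Psi>_def)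
    then have "t = 0" using Cker[of "s *s p + t *s u"] that(2) u by (simp add: pair_simps)
    then have "s \<noteq> 0" "mat s ** outer p \<psi> \<in> g" using st by (auto simp: outer_scale_left)
    then have "outer p \<psi> \<in> g" using g_scale_iff by blast
    then show ?thesis using that(1) st(2) by (auto simp: C_def \<Psi>_def)
  qed
  have \<phi>in: "\<phi> \<in> \<Psi> p" if "p \<noteq> 0" "pair \<phi> p = 0" for p
    using that
  proof (induction "dim (\<Psi> p)" arbitrary: p rule: less_induct)
    case less
    show ?case
    proof (cases "\<exists>\<psi>\<in>\<Psi> p. \<exists>q. pair \<phi> q = 0 \<and> pair \<psi> q \<noteq> 0")
      case True
      then obtain \<psi> q where q: "\<psi> \<in> \<Psi> p" "pair \<phi> q = 0" "pair \<psi> q \<noteq> 0" by blast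
      then have "q \<noteq> 0" by auto
      then show ?thesis using less.hyps[of q] step[OF q(1) q(3)] q(2) by blast
    next
      case False
      obtain \<psi> where \<psi>: "\<psi> \<noteq> 0" "\<psi> \<in> \<Psi> p" using kerC[OF less.prems] unfolding C_def by blast
      have eq: "\<psi> = pair \<psi> u *s \<phi>"
      proof (rule pair_ext)
        fix x
        have "pair \<phi> (x - pair \<phi> x *s u) = 0" using u by (simp add: pair_simps)
        then have "pair \<psi> (x - pair \<phi> x *s u) = 0" using False \<psi>(2) by blast
        then show "pair \<psi> x = pair (pair \<psi> u *s \<phi>) x" by (simp add: pair_simps mult.commute)
      qed
      then have nz: "pair \<psi> u \<noteq> 0" using \<psi>(1) by (metis vec.scale_zero_left)
      have "mat (pair \<psi> u) ** outer p \<phi> \<in> g"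
        using \<psi>(2) eq by (simp add: \<Psi>_def outer_scale_right[symmetric])
      then show ?thesis using g_scale_iff[OF nz] by (simp add: \<Psi>_def)
    qed
  qed
  let ?U = "{x. pair \<phi> x = 0}"
  have "vec.subspace ?U" by (simp add: vec.subspace_def pair_simps)
  moreover have "X *v x \<in> ?U" if "X \<in> g" "x \<in> ?U" for X x
  proof (cases "x = 0")
    case False
    then show ?thesis using \<phi>in[OF False] that orth[of x \<phi> X] by (simp add: \<Psi>_def)
  qed simp
  ultimately have "?U = {0} \<or> ?U = UNIV" by (rule irreducible)
  moreover have "u \<notin> ?U" using u by simp
  then have "?U \<noteq> UNIV" by blast
  ultimately have U0: "?U = {0}" by blast
  have "pair \<phi> (pair \<phi> p2 *s p1 + (- pair \<phi> p1) *s p2) = 0" by (simp add: pair_simps)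
  then have "pair \<phi> p2 *s p1 + (- pair \<phi> p1) *s p2 = 0" using U0 by blast
  then have "pair \<phi> p1 = 0" using indep2D[OF p] by fastforce
  then have "p1 = 0" using U0 by blast
  then show False using indep2_nonzero[OF p, of 1 0] by simp
qed

text \<open>Start from \<open>e = v \<otimes> \<psi>\<close> and \<open>X\<close> in \<open>g\<close> with \<open>\<psi> (X v) \<noteq> 0\<close>. A multiple \<open>H\<close> of \<open>[e, X]\<close> is
  \<open>v \<otimes> \<phi> - w \<otimes> \<psi>\<close> with dual bases \<open>v, w\<close> and \<open>\<phi>, \<psi>\<close> of a plane. Then \<open>H\<^sup>3 = H\<close>, so that
  \<open>(ad H)\<^sup>3 X - (ad H) X = 3 (H X H\<^sup>2 - H\<^sup>2 X H)\<close>, and the right-hand side is a combination of \<open>e\<close> and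
  \<open>w \<otimes> \<phi>\<close> in which the coefficient of \<open>w \<otimes> \<phi>\<close> is a nonzero multiple of \<open>\<psi> (X v)\<close>.\<close>

lemma opposite_rank_ones:
  obtains v w \<phi> \<phi>0 where "pair \<phi> v = 1" "pair \<phi> w = 0" "pair \<phi>0 v = 0" "pair \<phi>0 w = 1"
    "outer v \<phi>0 \<in> g" "outer w \<phi> \<in> g"
proof -
  obtain v \<psi> X where e: "outer v \<psi> \<in> g" and X: "X \<in> g" and nz: "pair \<psi> (X *v v) \<noteq> 0"
    using rank_one_not_orthogonal_to_g by blast
  have \<psi>v: "pair \<psi> v = 0" using outer_in_g_pair[OF e] .
  define c where "c = pair \<psi> (X *v v)"
  have c: "c \<noteq> 0" using nz by (simp add: c_def)
  \<comment> \<open>the value for which \<open>\<phi>\<close> kills \<open>w\<close>\<close>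
  define \<beta> where "\<beta> = - pair \<psi> (X *v (X *v v)) / (2 * c)"
  define w where "w = (1 / c) *s (X *v v + \<beta> *s v)"
  define \<phi> where "\<phi> = (1 / c) *s (\<psi> v* X + \<beta> *s \<psi>)"
  have \<beta>: "pair \<psi> (X *v (X *v v)) = - 2 * c * \<beta>" using c by (simp add: \<beta>_def)
  have \<phi>v: "pair \<phi> v = 1" using c \<psi>v by (simp add: \<phi>_def pair_simps pair_vector_matrix c_def[symmetric])
  have \<psi>w: "pair \<psi> w = 1" using c \<psi>v by (simp add: w_def pair_simps c_def[symmetric])
  have \<phi>w: "pair \<phi> w = 0"
    by (simp add: w_def \<phi>_def pair_simps pair_vector_matrix vec.add vec.scale c_def[symmetric] \<psi>v \<beta>)
  define H where "H = outer v \<phi> - outer w \<psi>"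
  have "H = mat (1 / c) ** lie_bracket (outer v \<psi>) X"
    by (simp add: H_def w_def \<phi>_def lie_bracket_outer_left outer_linear outer_scale_left outer_scale_right
        matrix_diff_ldistrib matrix_add_ldistrib mat_mult_mat)
  then have H: "H \<in> g" using g_scale bracket[OF e X] by simp
  have Hx: "H *v x = pair \<phi> x *s v - pair \<psi> x *s w" for x
    by (simp add: H_def matrix_vector_mult_diff_rdistrib outer_mult_vec)
  have HH: "H ** H = outer v \<phi> + outer w \<psi>"
  proof -
    have "H ** H = outer (H *v v) \<phi> - outer (H *v w) \<psi>"
      by (subst (2) H_def) (simp add: matrix_diff_ldistrib mult_outer)
    then show ?thesis by (simp add: Hx \<phi>v \<phi>w \<psi>v \<psi>w outer_linear)
  qed
  have HHx: "(H ** H) *v x = pair \<phi> x *s v + pair \<psi> x *s w" for x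
    by (simp add: HH matrix_vector_mult_add_rdistrib outer_mult_vec)
  have HHH: "H ** H ** H = H"
    by (simp add: matrix_eq matrix_vector_mul_assoc[symmetric] HHx Hx pair_simps \<phi>v \<phi>w \<psi>v \<psi>w)
  let ?T1 = "H ** H ** X ** H" and ?T2 = "H ** X ** H ** H"
  have "lie_bracket H (lie_bracket H (lie_bracket H X))
      = H ** H ** H ** X - (?T1 + ?T1 + ?T1) + (?T2 + ?T2 + ?T2) - X ** H ** H ** H"
    by (simp only: lie_bracket_def matrix_diff_ldistrib matrix_diff_rdistrib matrix_add_ldistrib
        matrix_add_rdistrib matrix_mul_assoc algebra_simps)
  also have "X ** H ** H ** H = X ** H"
    using HHH by (simp add: matrix_mul_assoc[symmetric])
  also have "H ** H ** H ** X = H ** X" by (simp only: HHH)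
  finally have 1: "lie_bracket H (lie_bracket H (lie_bracket H X)) - lie_bracket H X
      = 3 *\<^sub>R (?T2 - ?T1)"
    by (simp only: lie_bracket_def) (simp add: vec_eq_iff scaleR_conv_of_real[where 'a=complex] algebra_simps)
  have T2: "?T2 = outer (H *v (X *v v)) \<phi> + outer (H *v (X *v w)) \<psi>"
  proof -
    have "?T2 = (H ** X) ** (H ** H)" by (simp add: matrix_mul_assoc)
    then show ?thesis by (simp add: HH matrix_add_ldistrib mult_outer matrix_vector_mul_assoc)
  qed
  have T1: "?T1 = outer ((H ** H) *v (X *v v)) \<phi> - outer ((H ** H) *v (X *v w)) \<psi>"
    by (subst (3) H_def) (simp add: matrix_diff_ldistrib mult_outer matrix_vector_mul_assoc matrix_mul_assoc)
  have 2: "?T2 - ?T1 = 2 *\<^sub>R (mat (pair \<phi> (X *v w)) ** outer v \<psi> - mat (pair \<psi> (X *v v)) ** outer w \<phi>)"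
    unfolding T1 T2 Hx HHx scaleR_2
    by (simp only: outer_linear outer_scale_left[symmetric]) simp
  have "lie_bracket H (lie_bracket H (lie_bracket H X)) - lie_bracket H X \<in> g"
    using H X bracket g_diff by simp
  then have "3 *\<^sub>R 2 *\<^sub>R (mat (pair \<phi> (X *v w)) ** outer v \<psi> - mat c ** outer w \<phi>) \<in> g"
    unfolding 1 2 c_def .
  then have "(1/6) *\<^sub>R 3 *\<^sub>R 2 *\<^sub>R (mat (pair \<phi> (X *v w)) ** outer v \<psi> - mat c ** outer w \<phi>) \<in> g"
    by (rule subspace_scale[OF subspace_g])
  then have 3: "mat (pair \<phi> (X *v w)) ** outer v \<psi> - mat c ** outer w \<phi> \<in> g" by simp
  have "mat c ** outer w \<phi> = mat (pair \<phi> (X *v w)) ** outer v \<psi> -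
      (mat (pair \<phi> (X *v w)) ** outer v \<psi> - mat c ** outer w \<phi>)" by simp
  also have "\<dots> \<in> g" using g_diff[OF g_scale[OF e] 3] .
  finally have "outer w \<phi> \<in> g" using g_scale_iff[OF c] by simp
  then show ?thesis using that \<phi>v \<phi>w \<psi>v \<psi>w e by blast
qed

end

section \<open>Matrices supported on a set of positions\<close>

lemma dim_supported_matrices:
  fixes Z :: "('d::finite \<times> 'd) set"
  shows "dim {M :: ('b::euclidean_space)^'d^'d. \<forall>i j. (i, j) \<notin> Z \<longrightarrow> M$i$j = 0} = DIM('b) * card Z"
proof -
  define d where "d = (\<lambda>((i, j), u). axis i (axis j u) :: 'b^'d^'d) ` (Z \<times> Basis)"
  have B: "(Basis :: ('b^'d^'d) set) = {axis i (axis j u) | i j u. u \<in> Basis}"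
    by (auto simp: Basis_vec_def)
  have d: "d \<subseteq> Basis" unfolding B d_def by auto
  have eq: "{M :: 'b^'d^'d. \<forall>i j. (i, j) \<notin> Z \<longrightarrow> M$i$j = 0} = {x. \<forall>b\<in>Basis. b \<notin> d \<longrightarrow> x \<bullet> b = 0}"
  proof (intro set_eqI iffI; clarify)
    fix M :: "'b^'d^'d" and b :: "'b^'d^'d"
    assume M: "\<forall>i j. (i, j) \<notin> Z \<longrightarrow> M$i$j = 0" and b: "b \<in> Basis" "b \<notin> d"
    obtain i j u where u: "b = axis i (axis j u)" "u \<in> Basis" using b(1) B by blast
    have "(i, j) \<notin> Z"
    proof
      assume "(i, j) \<in> Z"
      then have "((i, j), u) \<in> Z \<times> Basis" using u by simp
      then have "b \<in> d" unfolding d_def u(1) by (rule rev_image_eqI) simp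
      then show False using b by simp
    qed
    then show "M \<bullet> b = 0" using M u by (simp add: inner_axis)
  next
    fix M :: "'b^'d^'d" and i j
    assume M: "\<forall>b\<in>Basis. b \<notin> d \<longrightarrow> M \<bullet> b = 0" and ij: "(i, j) \<notin> Z"
    have *: "M$i$j \<bullet> u = 0" if u: "u \<in> Basis" for u
    proof -
      have "axis i (axis j u) \<in> (Basis :: ('b^'d^'d) set)" using u B by blast
      moreover have "axis i (axis j u) \<notin> d"
        using ij u nonzero_Basis[OF u] unfolding d_def by (auto simp: axis_eq_axis)
      ultimately show ?thesis using M by (fastforce simp: inner_axis)
    qed
    show "M$i$j = 0" by (rule euclidean_eqI) (simp add: *)
  qed
  have "inj_on (\<lambda>((i, j), u). axis i (axis j u) :: 'b^'d^'d) (Z \<times> Basis)"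
    by (auto simp: inj_on_def axis_eq_axis nonzero_Basis)
  then have "card d = card (Z \<times> (Basis :: 'b set))"
    unfolding d_def by (rule card_image)
  then show ?thesis
    unfolding eq dim_substandard[OF d] by (simp add: card_cartesian_product mult.commute)
qed

text \<open>Any linear order of the indices will do: a symmetric matrix is determined by its entries on and above
  the diagonal.\<close>

lemma dim_symmetric_matrices_le:
  "dim {G :: complex^'d^'d. transpose G = G} \<le> CARD('d) * (CARD('d) + 1)"
proof -
  obtain r :: "'d \<Rightarrow> nat" where r: "inj r"
    using finite_imp_inj_to_nat_seg[of "UNIV :: 'd set"] by auto
  define Z where "Z = {(i, j). r i \<le> r j}"
  define f where "f G = (\<chi> i j. if r i \<le> r j then G$i$j else 0)" for G :: "complex^'d^'d"
  let ?S = "{G :: complex^'d^'d. transpose G = G}"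
  have lin: "linear f"
    by (rule linearI) (simp_all add: f_def vec_eq_iff)
  have S: "subspace ?S"
    by (simp add: subspace_def transpose_def vec_eq_iff)
  have inj: "inj_on f ?S"
  proof (rule inj_onI)
    fix G K assume GK: "G \<in> ?S" "K \<in> ?S" "f G = f K"
    have eq: "G$i$j = K$i$j" if "r i \<le> r j" for i j
      using arg_cong[OF GK(3), of "\<lambda>M. M$i$j"] that by (simp add: f_def)
    have "G$i$j = G$j$i" "K$i$j = K$j$i" for i j
      using GK(1,2) by (simp_all add: transpose_def vec_eq_iff)
    then show "G = K" using eq by (metis linear vec_eq_iff)
  qed
  have "dim ?S = dim (f ` ?S)"
  proof -
    have "inj_on f (span ?S)" using inj by (simp only: span_eq_iff[THEN iffD2, OF S])
    then show ?thesis using dim_image_eq[OF lin, of ?S] by simp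
  qed
  also have "\<dots> \<le> dim {M :: complex^'d^'d. \<forall>i j. (i, j) \<notin> Z \<longrightarrow> M$i$j = 0}"
    by (rule dim_subset) (auto simp: f_def Z_def)
  also have "\<dots> = 2 * card Z" by (simp add: dim_supported_matrices)
  also have "2 * card Z = CARD('d) * (CARD('d) + 1)"
  proof -
    have "card (Z\<inverse>) = card Z" by (rule card_inverse)
    moreover have "Z \<union> Z\<inverse> = UNIV" by (auto simp: Z_def)
    moreover have "Z \<inter> Z\<inverse> = (\<lambda>i. (i, i)) ` UNIV"
      using r by (auto simp: Z_def inj_def)
    moreover have "card ((\<lambda>i :: 'd. (i, i)) ` UNIV) = CARD('d)"
      by (intro card_image) (simp add: inj_on_def)
    moreover have "card (UNIV :: ('d \<times> 'd) set) = CARD('d) * CARD('d)"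
      by (simp only: UNIV_Times_UNIV[symmetric] card_cartesian_product)
    ultimately show ?thesis
      using card_Un_Int[of Z "Z\<inverse>"] by simp
  qed
  finally show ?thesis .
qed

section \<open>Large irreducible Lie algebras\<close>

lemma matrix_vector_mult_lie_bracket: "lie_bracket X Y *v x = X *v (Y *v x) - Y *v (X *v x)"
  by (simp add: lie_bracket_def matrix_vector_mult_diff_rdistrib matrix_vector_mul_assoc)

lemma vector_matrix_mult_lie_bracket: "a v* lie_bracket X Y = (a v* X) v* Y - (a v* Y) v* X"
  by (rule pair_ext) (simp add: pair_vector_matrix matrix_vector_mult_lie_bracket pair_simps)

text \<open>The elements \<open>e = v \<otimes> \<phi>0\<close> and \<open>f = w \<otimes> \<phi>\<close> generate an \<open>sl\<^sub>2\<close> with \<open>h = [e, f]\<close>. It acts on the plane of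
  \<open>v\<close> and \<open>w\<close> and kills the complement \<open>M\<close> on which \<open>\<phi>\<close> and \<open>\<phi>0\<close> vanish. The maps \<open>proj\<close> and \<open>coproj\<close> are
  the projection onto \<open>M\<close> along this plane and the dual projection onto the covectors killing \<open>v\<close> and \<open>w\<close>.\<close>

locale irreducible_lie_algebra_with_sl2 = irreducible_lie_algebra +
  fixes v w \<phi> \<phi>0 :: "complex^'d"
  assumes pair_vw: "pair \<phi> v = 1" "pair \<phi> w = 0" "pair \<phi>0 v = 0" "pair \<phi>0 w = 1"
    and e_in: "outer v \<phi>0 \<in> g" and f_in: "outer w \<phi> \<in> g"
begin

definition proj :: "complex^'d \<Rightarrow> complex^'d" where
  "proj x = x - pair \<phi> x *s v - pair \<phi>0 x *s w"

definition coproj :: "complex^'d \<Rightarrow> complex^'d" where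
  "coproj a = a - pair a v *s \<phi> - pair a w *s \<phi>0"

text \<open>The matrices \<open>v \<otimes> a + m \<otimes> \<phi>0\<close> are those of weight one for \<open>h\<close>, and \<open>S\<close> records which of them lie in
  \<open>g\<close>, as a relation between covectors on \<open>M\<close> and vectors of \<open>M\<close>. If it relates a nonzero covector to
  \<open>0\<close>, then \<open>g\<close> is everything; if not, it is the graph of a map from \<open>M\<close> to its dual, which is
  the restriction to \<open>M\<close> of a symplectic form invariant under \<open>g\<close>.\<close>

definition S :: "complex^'d \<Rightarrow> complex^'d \<Rightarrow> bool" where
  "S a m \<longleftrightarrow> pair a v = 0 \<and> pair a w = 0 \<and> pair \<phi> m = 0 \<and> pair \<phi>0 m = 0 \<and>
     outer v a + outer m \<phi>0 \<in> g"

lemma pair_proj: "pair \<phi> (proj x) = 0" "pair \<phi>0 (proj x) = 0"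
  by (simp_all add: proj_def pair_simps pair_vw)

lemma pair_coproj: "pair (coproj a) v = 0" "pair (coproj a) w = 0"
  by (simp_all add: coproj_def pair_simps pair_vw)

lemma pair_coproj_left: "pair (coproj a) x = pair a x - pair a v * pair \<phi> x - pair a w * pair \<phi>0 x"
  by (simp add: coproj_def pair_simps)

lemma proj_add: "proj (x + y) = proj x + proj y"
  and proj_scale: "proj (c *s x) = c *s proj x"
  and proj_diff: "proj (x - y) = proj x - proj y"
  by (simp_all add: proj_def pair_simps vec.scale_left_distrib vec.scale_left_diff_distrib
      vec.scale_right_diff_distrib)

lemma coproj_add: "coproj (x + y) = coproj x + coproj y"
  and coproj_scale: "coproj (c *s x) = c *s coproj x"
  and coproj_diff: "coproj (x - y) = coproj x - coproj y"
  by (simp_all add: coproj_def pair_simps vec.scale_left_distrib vec.scale_left_diff_distrib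
      vec.scale_right_diff_distrib)

lemma proj_vw: "proj v = 0" "proj w = 0" "coproj \<phi> = 0" "coproj \<phi>0 = 0"
  by (simp_all add: proj_def coproj_def pair_vw)

lemma proj_zero: "proj 0 = 0" "coproj 0 = 0"
  by (simp_all add: proj_def coproj_def)

lemma proj_id: "pair \<phi> m = 0 \<Longrightarrow> pair \<phi>0 m = 0 \<Longrightarrow> proj m = m"
  by (simp add: proj_def)

lemma coproj_id: "pair a v = 0 \<Longrightarrow> pair a w = 0 \<Longrightarrow> coproj a = a"
  by (simp add: coproj_def)

lemma proj_decomp: "x = pair \<phi> x *s v + pair \<phi>0 x *s w + proj x"
  by (simp add: proj_def)

lemma h_in: "outer v \<phi> - outer w \<phi>0 \<in> g"
  using bracket[OF e_in f_in] by (simp add: lie_bracket_outer outer_mult_vec vec_mult_outer pair_vw)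

text \<open>Up to multiples of \<open>e\<close> and \<open>h\<close>, the bracket \<open>[e, X]\<close> has weight one.\<close>

lemma S_of_v:
  assumes "X \<in> g"
  shows "S (coproj (\<phi>0 v* X)) (- proj (X *v v))"
proof -
  let ?e = "outer v \<phi>0" and ?h = "outer v \<phi> - outer w \<phi>0"
  have "outer v (coproj (\<phi>0 v* X)) + outer (- proj (X *v v)) \<phi>0 =
      lie_bracket ?e X - mat (pair \<phi>0 (X *v v)) ** ?h
        - mat (pair \<phi>0 (X *v w)) ** ?e + mat (pair \<phi> (X *v v)) ** ?e"
    by (simp add: lie_bracket_outer_left coproj_def proj_def pair_vector_matrix outer_linear
        outer_scale_left outer_scale_right matrix_diff_ldistrib algebra_simps)
  also have "\<dots> \<in> g"
    using assms e_in h_in bracket g_scale g_add g_diff by simp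
  finally show ?thesis
    by (simp add: S_def pair_coproj pair_minus_right pair_proj)
qed

text \<open>Up to multiples of \<open>e\<close> and \<open>h\<close>, the bracket \<open>[e, [f, X]]\<close> has weight one.\<close>

lemma S_of_w:
  assumes "X \<in> g"
  shows "S (coproj (\<phi> v* X)) (proj (X *v w))"
proof -
  let ?e = "outer v \<phi>0" and ?h = "outer v \<phi> - outer w \<phi>0" and ?f = "outer w \<phi>"
  have "outer v (coproj (\<phi> v* X)) + outer (proj (X *v w)) \<phi>0 =
      lie_bracket ?e (lie_bracket ?f X) - mat (pair \<phi> (X *v v)) ** ?h + mat (pair \<phi>0 (X *v w)) ** ?h
        - mat (pair \<phi> (X *v w)) ** ?e - mat (pair \<phi> (X *v w)) ** ?e"
    by (simp add: lie_bracket_outer_left coproj_def proj_def pair_vector_matrix outer_linear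
        outer_scale_left outer_scale_right matrix_diff_ldistrib matrix_vector_mult_diff_rdistrib
        vector_matrix_mult_diff_rdistrib outer_mult_vec vec_mult_outer pair_vw algebra_simps)
  also have "\<dots> \<in> g"
    by (intro g_diff g_add g_scale bracket assms e_in h_in f_in)
  finally show ?thesis
    by (simp add: S_def pair_coproj pair_proj)
qed

lemma S_add: "S a m \<Longrightarrow> S b n \<Longrightarrow> S (a + b) (m + n)"
  using g_add[of "outer v a + outer m \<phi>0" "outer v b + outer n \<phi>0"]
  by (simp add: S_def pair_simps outer_linear algebra_simps)

lemma S_scale: "S a m \<Longrightarrow> S (c *s a) (c *s m)"
  using g_scale[of "outer v a + outer m \<phi>0" c]
  by (simp add: S_def pair_simps outer_linear outer_scale_left outer_scale_right matrix_add_ldistrib)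

lemma S_minus: "S a m \<Longrightarrow> S (- a) (- m)"
  using S_scale[of a m "- 1"] by simp

lemma S_zero: "S 0 0"
  using subspace_0[OF subspace_g] by (simp add: S_def)

lemma S_image_of_v: "S a m \<Longrightarrow> (outer v a + outer m \<phi>0) *v x = pair a x *s v + pair \<phi>0 x *s m"
  by (simp add: matrix_vector_mult_add_rdistrib outer_mult_vec)

text \<open>The vectors whose projection to \<open>M\<close> occurs in \<open>S\<close> form a subspace which is invariant under \<open>g\<close> and
  contains \<open>v\<close>.\<close>

lemma S_total_right:
  assumes "pair \<phi> m = 0" "pair \<phi>0 m = 0"
  shows "\<exists>a. S a m"
proof -
  let ?U = "{x. \<exists>a. S a (proj x)}"
  have "vec.subspace ?U"
    unfolding vec.subspace_def
    using S_zero S_add S_scale by (auto simp: proj_add proj_scale proj_zero; blast)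
  moreover have "X *v x \<in> ?U" if X: "X \<in> g" and x: "x \<in> ?U" for X x
  proof -
    obtain a where a: "S a (proj x)" using x by blast
    define Y where "Y = outer v a + outer (proj x) \<phi>0"
    have Y: "Y \<in> g" using a by (simp add: S_def Y_def)
    have Yx: "Y *v z = pair a z *s v + pair \<phi>0 z *s proj x" for z
      unfolding Y_def by (rule S_image_of_v[OF a])
    have "proj x = Y *v w" using a by (simp add: Yx S_def pair_vw)
    then have "X *v proj x = lie_bracket X Y *v w + Y *v (X *v w)"
      by (simp add: matrix_vector_mult_lie_bracket)
    then have 1: "proj (X *v proj x) = proj (lie_bracket X Y *v w) + pair \<phi>0 (X *v w) *s proj x"
      by (simp add: Yx proj_add proj_scale proj_vw proj_id[OF pair_proj])
    have "X *v x = pair \<phi> x *s (X *v v) + pair \<phi>0 x *s (X *v w) + X *v proj x"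
      by (subst (1) proj_decomp[of x]) (simp only: vec.add vec.scale)
    then have 2: "proj (X *v x) = pair \<phi> x *s proj (X *v v) + pair \<phi>0 x *s proj (X *v w)
        + (proj (lie_bracket X Y *v w) + pair \<phi>0 (X *v w) *s proj x)"
      by (simp only: proj_add proj_scale 1)
    have Sv: "S (- coproj (\<phi>0 v* X)) (proj (X *v v))" using S_minus[OF S_of_v[OF X]] by simp
    show ?thesis
      unfolding mem_Collect_eq 2
      by (rule exI, rule S_add[OF S_add[OF S_scale[OF Sv] S_scale[OF S_of_w[OF X]]]
            S_add[OF S_of_w[OF bracket[OF X Y]] S_scale[OF a]]])
  qed
  ultimately have "?U = {0} \<or> ?U = UNIV" by (rule irreducible)
  moreover have "v \<in> ?U" using S_zero by (auto simp: proj_vw)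
  moreover have "v \<noteq> 0" using pair_vw by auto
  ultimately have "?U = UNIV" by blast
  then have "m \<in> ?U" by simp
  then show ?thesis using proj_id[OF assms] by simp
qed

text \<open>The vectors of \<open>M\<close> killed by all covectors occurring in \<open>S\<close> form an invariant subspace without \<open>v\<close>, hence
  there are none but zero, and by duality every covector on \<open>M\<close> occurs.\<close>

lemma S_total_left:
  assumes "pair a v = 0" "pair a w = 0"
  shows "\<exists>m. S a m"
proof -
  let ?K = "{u. pair \<phi> u = 0 \<and> pair \<phi>0 u = 0 \<and> (\<forall>b n. S b n \<longrightarrow> pair b u = 0)}"
  have "vec.subspace ?K"
    by (simp add: vec.subspace_def pair_simps)
  moreover have "X *v u \<in> ?K" if X: "X \<in> g" and u: "u \<in> ?K" for X u
  proof -
    have \<phi>0: "pair \<phi> (Y *v u) = 0" if "Y \<in> g" for Y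
    proof -
      have "pair (coproj (\<phi> v* Y)) u = 0" using S_of_w[OF that] u by blast
      then show ?thesis using u by (simp add: pair_coproj_left pair_vector_matrix)
    qed
    have "pair (coproj (\<phi>0 v* X)) u = 0" using S_of_v[OF X] u by blast
    then have "pair \<phi>0 (X *v u) = 0" using u by (simp add: pair_coproj_left pair_vector_matrix)
    moreover have "pair b (X *v u) = 0" if b: "S b n" for b n
    proof -
      define Y where "Y = outer v b + outer n \<phi>0"
      have Y: "Y \<in> g" using b by (simp add: S_def Y_def)
      have Yx: "Y *v z = pair b z *s v + pair \<phi>0 z *s n" for z
        unfolding Y_def by (rule S_image_of_v[OF b])
      have "pair b u = 0" "pair \<phi>0 u = 0" using u b by blast+
      then have "Y *v u = 0" by (simp add: Yx)
      then have "pair \<phi> (lie_bracket X Y *v u) = - pair \<phi> (Y *v (X *v u))"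
        by (simp add: matrix_vector_mult_lie_bracket pair_simps)
      also have "pair \<phi> (Y *v (X *v u)) = pair b (X *v u)"
        using b by (simp add: Yx pair_simps S_def pair_vw)
      finally show ?thesis using \<phi>0[OF bracket[OF X Y]] by simp
    qed
    ultimately show ?thesis using \<phi>0[OF X] by blast
  qed
  ultimately have "?K = {0} \<or> ?K = UNIV" by (rule irreducible)
  moreover have "v \<notin> ?K" using pair_vw by simp
  ultimately have K: "?K = {0}" by blast
  let ?U = "{b. \<exists>m. S (coproj b) m}"
  have "?U = UNIV"
  proof (rule ccontr)
    assume "?U \<noteq> UNIV"
    moreover have "vec.subspace ?U"
      unfolding vec.subspace_def
      using S_zero S_add S_scale by (auto simp: coproj_add coproj_scale proj_zero; blast)
    ultimately obtain u where u: "u \<noteq> 0" "\<And>b. b \<in> ?U \<Longrightarrow> pair u b = 0"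
      using proper_subspace_annihilated[of ?U] by blast
    have "\<phi> \<in> ?U" "\<phi>0 \<in> ?U" using S_zero by (auto simp: proj_vw)
    then have "pair \<phi> u = 0" "pair \<phi>0 u = 0" using u(2) by (simp_all add: pair_commute[of _ u])
    moreover have "pair b u = 0" if "S b n" for b n
    proof -
      have "coproj b = b" using that by (intro coproj_id) (simp_all add: S_def)
      then have "b \<in> ?U" using that by auto
      then show ?thesis using u(2) by (simp add: pair_commute[of _ u])
    qed
    ultimately have "u \<in> ?K" by blast
    then show False using K u(1) by blast
  qed
  then have "a \<in> ?U" by simp
  then show ?thesis using coproj_id[OF assms] by simp
qed

lemma coordinates_eqI:
  assumes "pair \<phi> x = pair \<phi> y" "pair \<phi>0 x = pair \<phi>0 y"
    "\<And>b. pair b v = 0 \<Longrightarrow> pair b w = 0 \<Longrightarrow> pair b x = pair b y"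
  shows "x = y"
proof (rule pair_ext)
  fix c
  have "pair (coproj c) x = pair (coproj c) y" by (intro assms(3) pair_coproj)
  then have "pair c x = pair c y" using assms(1,2) by (simp add: pair_coproj_left)
  then show "pair x c = pair y c" by (simp add: pair_commute[of _ c])
qed

text \<open>This matrix is the bracket of \<open>v \<otimes> b\<close> with \<open>[f, v \<otimes> \<beta> + n \<otimes> \<phi>0]\<close>, where \<open>\<beta>\<close> is related to \<open>n\<close> by
  \<open>S\<close>.\<close>

lemma M_times_covector:
  assumes b: "outer v b \<in> g" "pair b v = 0" "pair b w = 0" and n: "pair \<phi> n = 0" "pair \<phi>0 n = 0"
  shows "outer n b - mat (pair b n) ** outer v \<phi> \<in> g"
proof -
  obtain \<beta> where \<beta>: "S \<beta> n" using S_total_right[OF n] by blast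
  have Y: "outer v \<beta> + outer n \<phi>0 \<in> g" using \<beta> by (simp add: S_def)
  have "lie_bracket (outer w \<phi>) (outer v \<beta> + outer n \<phi>0) = outer w \<beta> - outer n \<phi>"
    using \<beta> n by (simp add: lie_bracket_outer_left vector_matrix_mult_add_rdistrib matrix_vector_mult_add_rdistrib
        vec_mult_outer outer_mult_vec pair_vw S_def)
  then have Y': "outer w \<beta> - outer n \<phi> \<in> g" using bracket[OF f_in Y] by simp
  have "lie_bracket (outer v b) (outer w \<beta> - outer n \<phi>) = outer n b - mat (pair b n) ** outer v \<phi>"
    using \<beta> b n by (simp add: lie_bracket_outer_left vector_matrix_mult_diff_rdistrib matrix_vector_mult_diff_rdistrib
        vec_mult_outer outer_mult_vec pair_vw S_def outer_linear outer_scale_right)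
  then show ?thesis using bracket[OF b(1) Y'] by simp
qed

text \<open>From \<open>v \<otimes> a\<close> brackets produce first some \<open>k \<otimes> \<phi>0\<close> with \<open>a k = 1\<close> and then, for all \<open>n\<close> in \<open>M\<close> and all
  covectors \<open>b\<close> on \<open>M\<close>, the matrices \<open>n \<otimes> \<phi>0\<close>, \<open>v \<otimes> b\<close>, \<open>w \<otimes> b\<close> and \<open>n \<otimes> \<phi>\<close>, and
  \<open>n \<otimes> b\<close> up to a multiple of \<open>v \<otimes> \<phi>\<close>. A matrix annihilating all of these and \<open>e\<close>, \<open>f\<close>, \<open>h\<close> is
  scalar.\<close>

lemma full_if_v_times_covector:
  assumes a: "a \<noteq> 0" "S a 0" and X: "trace X = 0"
  shows "X \<in> g"
proof -
  have a': "outer v a \<in> g" "pair a v = 0" "pair a w = 0" using a(2) by (simp_all add: S_def)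
  obtain k0 where k0: "pair a k0 = 1" using exists_pair_one[OF a(1)] .
  define k where "k = proj k0"
  have k: "pair \<phi> k = 0" "pair \<phi>0 k = 0" "pair a k = 1"
    using a' k0 by (simp_all add: k_def pair_proj) (simp add: proj_def pair_simps)
  obtain \<gamma> where \<gamma>: "S \<gamma> k" using S_total_right[OF k(1,2)] by blast
  define Y where "Y = outer v \<gamma> + outer k \<phi>0"
  have Y: "Y \<in> g" using \<gamma> by (simp add: S_def Y_def)
  have Z: "outer n a - mat (pair a n) ** outer v \<phi> \<in> g" if "pair \<phi> n = 0" "pair \<phi>0 n = 0" for n
    by (rule M_times_covector[OF a' that])
  have "lie_bracket (outer k a - mat (pair a k) ** outer v \<phi>) Y
      = outer k \<phi>0 - outer v \<gamma> - mat (pair \<gamma> k) ** outer v a"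
    using \<gamma> k a' by (simp add: Y_def lie_bracket_def matrix_add_ldistrib matrix_add_rdistrib matrix_diff_ldistrib
        matrix_diff_rdistrib outer_mult_outer pair_vw S_def outer_scale_left)
  then have "outer k \<phi>0 - outer v \<gamma> - mat (pair \<gamma> k) ** outer v a \<in> g"
    using bracket[OF Z[OF k(1,2)] Y] by simp
  then have "Y - (outer k \<phi>0 - outer v \<gamma> - mat (pair \<gamma> k) ** outer v a) - mat (pair \<gamma> k) ** outer v a \<in> g"
    using Y g_diff g_scale[OF a'(1)] by blast
  moreover have "Y - (outer k \<phi>0 - outer v \<gamma> - mat (pair \<gamma> k) ** outer v a) - mat (pair \<gamma> k) ** outer v a
      = mat 2 ** outer v \<gamma>"
    by (simp add: Y_def vec_eq_iff mat_mult_entry)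
  ultimately have "mat 2 ** outer v \<gamma> \<in> g" by simp
  then have v\<gamma>: "outer v \<gamma> \<in> g" using g_scale_iff[of 2] by simp
  have "outer k \<phi>0 = Y - outer v \<gamma>" by (simp add: Y_def)
  then have k\<phi>0: "outer k \<phi>0 \<in> g" using Y v\<gamma> g_diff by simp
  have n\<phi>0: "outer n \<phi>0 \<in> g" if n: "pair \<phi> n = 0" "pair \<phi>0 n = 0" for n
  proof -
    have "lie_bracket (outer n a - mat (pair a n) ** outer v \<phi>) (outer k \<phi>0) = outer n \<phi>0"
      using k n by (simp add: lie_bracket_outer matrix_vector_mult_diff_rdistrib mat_mult_vec_assoc outer_mult_vec
          vector_matrix_mult_diff_rdistrib vec_mult_outer outer_scale_right[symmetric] pair_vw pair_simps)
    then show ?thesis using bracket[OF Z[OF n] k\<phi>0] by simp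
  qed
  have vb: "outer v b \<in> g" if b: "pair b v = 0" "pair b w = 0" for b
  proof -
    obtain m where m: "S b m" using S_total_left[OF b] by blast
    then have "outer m \<phi>0 \<in> g" by (intro n\<phi>0) (simp_all add: S_def)
    moreover have "outer v b = (outer v b + outer m \<phi>0) - outer m \<phi>0" by simp
    ultimately show ?thesis using m g_diff unfolding S_def by metis
  qed
  have wb: "outer w b \<in> g" if b: "pair b v = 0" "pair b w = 0" for b
  proof -
    have "lie_bracket (outer w \<phi>) (outer v b) = outer w b"
      using b by (simp add: lie_bracket_outer outer_mult_vec vec_mult_outer pair_vw)
    then show ?thesis using bracket[OF f_in vb[OF b]] by simp
  qed
  have n\<phi>: "outer n \<phi> \<in> g" if n: "pair \<phi> n = 0" "pair \<phi>0 n = 0" for n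
  proof -
    have "lie_bracket (outer w \<phi>) (outer n \<phi>0) = - outer n \<phi>"
      using n by (simp add: lie_bracket_outer outer_mult_vec vec_mult_outer pair_vw)
    then show ?thesis using bracket[OF f_in n\<phi>0[OF n]] g_neg by fastforce
  qed
  have "trace (X ** d) = 0" if d: "d \<in> ann g" for d
  proof -
    have D: "pair b (d *v x) = 0" if "outer x b \<in> g" for x b
      using that d outer_in_g_iff by blast
    define \<mu> where "\<mu> = pair \<phi> (d *v v)"
    have tr: "trace (d ** Y) = 0" if "Y \<in> g" for Y using that d by (simp add: ann_def)
    have trd: "trace (d ** outer x b) = pair b (d *v x)" for x b
      by (simp add: mult_outer trace_outer)
    have dv: "d *v v = \<mu> *s v"
      by (rule coordinates_eqI) (simp_all add: \<mu>_def pair_simps pair_vw D[OF e_in] D[OF vb])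
    have "pair \<phi>0 (d *v w) = \<mu>"
      using tr[OF h_in] by (simp add: matrix_diff_ldistrib trace_sub trd \<mu>_def)
    then have dw: "d *v w = \<mu> *s w"
      by (intro coordinates_eqI) (simp_all add: pair_simps pair_vw D[OF f_in] D[OF wb])
    have dn: "d *v n = \<mu> *s n" if n: "pair \<phi> n = 0" "pair \<phi>0 n = 0" for n
    proof (rule coordinates_eqI)
      show "pair \<phi> (d *v n) = pair \<phi> (\<mu> *s n)" "pair \<phi>0 (d *v n) = pair \<phi>0 (\<mu> *s n)"
        using n by (simp_all add: pair_simps D[OF n\<phi>] D[OF n\<phi>0])
      fix b assume b: "pair b v = 0" "pair b w = 0"
      have "trace (d ** (outer n b - mat (pair b n) ** outer v \<phi>)) = 0"
        by (intro tr M_times_covector vb b n)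
      then show "pair b (d *v n) = pair b (\<mu> *s n)"
        by (simp add: matrix_diff_ldistrib trace_sub trd outer_scale_left[symmetric] pair_simps vec.scale \<mu>_def)
    qed
    have "d *v x = mat \<mu> *v x" for x
    proof -
      have "d *v x = pair \<phi> x *s (d *v v) + pair \<phi>0 x *s (d *v w) + d *v proj x"
        by (subst (1) proj_decomp[of x]) (simp only: vec.add vec.scale)
      also have "\<dots> = \<mu> *s (pair \<phi> x *s v + pair \<phi>0 x *s w + proj x)"
        by (simp add: dv dw dn[OF pair_proj] vec.scale_right_distrib mult.commute)
      also have "\<dots> = mat \<mu> *v x" by (simp only: proj_decomp[symmetric] mat_mult_vec)
      finally show ?thesis .
    qed
    then have "d = mat \<mu>" by (simp add: matrix_eq)
    then show ?thesis using X by (simp add: mat_mult_comm[symmetric] trace_mat_mult)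
  qed
  then show ?thesis by (subst g_eq) simp
qed

text \<open>Now \<open>S\<close> is the graph of a map \<open>t\<close> from \<open>M\<close> to its dual. Together with the area form of the plane of
  \<open>v\<close> and \<open>w\<close> it defines a bilinear form \<open>op\<close> on the whole space, and the brackets of elements of \<open>S\<close> with
  \<open>g\<close> say that \<open>g\<close> preserves this form up to a factor \<open>lam\<close>. The form is nondegenerate because its
  kernel is invariant, and the factor vanishes because \<open>g\<close> is traceless.\<close>

lemma symplectic_if_no_v_times_covector:
  assumes no: "\<And>a. S a 0 \<Longrightarrow> a = 0"
  obtains J where "invertible J" "transpose J = - J" "\<And>X. X \<in> g \<Longrightarrow> J ** X + transpose X ** J = 0"
proof -
  have uniq: "a = b" if "S a m" "S b m" for a b m
    using no[of "a - b"] S_add[OF that(1) S_minus[OF that(2)]] by simp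
  define t where "t x = (SOME a. S a (proj x))" for x
  have St: "S (t x) (proj x)" for x
    unfolding t_def by (rule someI_ex[OF S_total_right[OF pair_proj]])
  have t_eq: "t x = a" if "S a (proj x)" for a x
    using uniq[OF St that] .
  have t_add: "t (x + y) = t x + t y" for x y
    by (rule t_eq) (simp add: proj_add S_add St)
  have t_scale: "t (c *s x) = c *s t x" for c x
    by (rule t_eq) (simp add: proj_scale S_scale St)
  have t_pair: "pair (t x) v = 0" "pair (t x) w = 0" for x
    using St[of x] by (simp_all add: S_def)
  have t_vw: "t v = 0" "t w = 0"
    by (rule t_eq, simp add: proj_vw S_zero)+
  have pp: "proj (proj x) = proj x" for x by (rule proj_id[OF pair_proj])
  have t_proj: "t (proj x) = t x" for x
    by (rule t_eq) (simp add: pp St)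
  have pair_t_proj: "pair (t x) (proj y) = pair (t x) y" for x y
    by (simp add: proj_def pair_simps t_pair)
  define lam where "lam X = pair \<phi> (X *v v) + pair \<phi>0 (X *v w)" for X
  \<comment> \<open>the weight one part of \<open>[X, v \<otimes> t m + m \<otimes> \<phi>0]\<close>, expressed by \<open>S_of_w\<close>\<close>
  have key: "t (X *v m) = lam X *s t m - (t m v* X - pair (t m) (X *v v) *s \<phi> - pair (t m) (X *v w) *s \<phi>0)"
    if X: "X \<in> g" and m: "pair \<phi> m = 0" "pair \<phi>0 m = 0" for X m
  proof -
    have Sm: "S (t m) m" using St[of m] proj_id[OF m] by simp
    define Y where "Y = outer v (t m) + outer m \<phi>0"
    have Y: "Y \<in> g" using Sm by (simp add: S_def Y_def)
    have Yx: "Y *v z = pair (t m) z *s v + pair \<phi>0 z *s m" for z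
      unfolding Y_def by (rule S_image_of_v[OF Sm])
    have xY: "a v* Y = pair a v *s t m + pair a m *s \<phi>0" for a
      by (simp add: Y_def vector_matrix_mult_add_rdistrib vec_mult_outer)
    have 1: "coproj (\<phi> v* lie_bracket X Y) = pair \<phi> (X *v v) *s t m - coproj (t m v* X)"
      by (simp add: vector_matrix_mult_lie_bracket xY pair_vw m pair_vector_matrix coproj_add coproj_diff
          coproj_scale proj_vw coproj_id[OF t_pair])
    have 2: "proj (lie_bracket X Y *v w) = proj (X *v m) - pair \<phi>0 (X *v w) *s m"
      by (simp add: matrix_vector_mult_lie_bracket Yx t_pair pair_vw proj_diff proj_add proj_scale proj_vw proj_id[OF m])
    have "S (pair \<phi> (X *v v) *s t m - coproj (t m v* X) + pair \<phi>0 (X *v w) *s t m)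
        (proj (X *v m) - pair \<phi>0 (X *v w) *s m + pair \<phi>0 (X *v w) *s m)"
      using S_add[OF S_of_w[OF bracket[OF X Y]] S_scale[OF Sm, of "pair \<phi>0 (X *v w)"]] by (simp only: 1 2)
    then have "S (pair \<phi> (X *v v) *s t m - coproj (t m v* X) + pair \<phi>0 (X *v w) *s t m) (proj (X *v m))"
      by simp
    from t_eq[OF this] show ?thesis
      by (simp add: coproj_def pair_vector_matrix lam_def vec.scale_left_distrib)
  qed
  \<comment> \<open>for \<open>X = [Y, [f, Y]]\<close> with \<open>Y = v \<otimes> t m + m \<otimes> \<phi>0\<close>, the previous identity paired with \<open>m\<close> reads
    \<open>2 a\<^sup>2 = - 4 a\<^sup>2\<close> where \<open>a = t m m\<close>\<close>
  have alt: "pair (t x) x = 0" for x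
  proof -
    define m where "m = proj x"
    have m: "pair \<phi> m = 0" "pair \<phi>0 m = 0" "t m = t x" "pair (t x) m = pair (t x) x"
      by (simp_all add: m_def pair_proj t_proj pair_t_proj)
    define a where "a = pair (t m) m"
    have Sm: "S (t m) m" using St[of m] proj_id[OF m(1,2)] by simp
    define Y where "Y = outer v (t m) + outer m \<phi>0"
    define Y' where "Y' = outer w (t m) - outer m \<phi>"
    have Y: "Y \<in> g" using Sm by (simp add: S_def Y_def)
    have "Y' = lie_bracket (outer w \<phi>) Y"
      using Sm by (simp add: Y_def Y'_def lie_bracket_outer_left vector_matrix_mult_add_rdistrib
          matrix_vector_mult_add_rdistrib vec_mult_outer outer_mult_vec pair_vw S_def)
    then have Y': "Y' \<in> g" using bracket[OF f_in Y] by simp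
    have Yx: "Y *v z = pair (t m) z *s v + pair \<phi>0 z *s m" for z
      unfolding Y_def by (rule S_image_of_v[OF Sm])
    have Yx': "Y' *v z = pair (t m) z *s w - pair \<phi> z *s m" for z
      by (simp add: Y'_def matrix_vector_mult_diff_rdistrib outer_mult_vec)
    define X where "X = lie_bracket Y Y'"
    have X: "X \<in> g" unfolding X_def by (rule bracket[OF Y Y'])
    have Xm: "X *v m = (2 * a) *s m"
      by (simp add: X_def matrix_vector_mult_lie_bracket Yx Yx' pair_simps m(1,2) pair_vw t_pair a_def[symmetric]
          vec.scale_left_distrib[symmetric])
    have "pair \<phi> (X *v v) = - a" "pair \<phi>0 (X *v w) = - a"
      by (simp_all add: X_def matrix_vector_mult_lie_bracket Yx Yx' pair_simps m(1,2) pair_vw t_pair a_def[symmetric])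
    then have lam: "lam X = - 2 * a" by (simp add: lam_def)
    have "2 * a * a = pair (t (X *v m)) m"
      by (simp only: Xm t_scale pair_scale_left a_def)
    also have "\<dots> = - 2 * a * a - 2 * a * a"
      unfolding key[OF X m(1,2)]
      by (simp add: lam pair_simps pair_vector_matrix m(1,2) Xm a_def[symmetric])
    finally have "6 * (a * a) = 0" by (simp add: algebra_simps)
    then have "a = 0" by simp
    then show ?thesis using m by (simp add: a_def)
  qed
  have anti: "pair (t x) y = - pair (t y) x" for x y
    using alt[of "x + y"] alt[of x] alt[of y] by (simp add: t_add pair_simps add_eq_0_iff)
  define op where "op x = pair \<phi> x *s \<phi>0 - pair \<phi>0 x *s \<phi> + t x" for x
  have pop: "pair (op x) y = pair \<phi> x * pair \<phi>0 y - pair \<phi>0 x * pair \<phi> y + pair (t x) y" for x y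
    by (simp add: op_def pair_simps)
  have op_add: "op (x + y) = op x + op y" for x y
    by (rule pair_ext) (simp add: pop pair_simps t_add algebra_simps)
  have op_scale: "op (c *s x) = c *s op x" for c x
    by (rule pair_ext) (simp add: pop pair_simps t_scale algebra_simps)
  have op_anti: "pair (op x) y = - pair (op y) x" for x y
    using anti[of x y] by (simp add: pop algebra_simps)
  have t_Xv: "t (X *v v) = - (\<phi>0 v* X - pair \<phi>0 (X *v v) *s \<phi> - pair \<phi>0 (X *v w) *s \<phi>0)" if "X \<in> g" for X
    by (rule t_eq) (use S_minus[OF S_of_v[OF that]] in \<open>simp add: coproj_def pair_vector_matrix\<close>)
  have t_Xw: "t (X *v w) = \<phi> v* X - pair \<phi> (X *v v) *s \<phi> - pair \<phi> (X *v w) *s \<phi>0" if "X \<in> g" for X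
    by (rule t_eq) (use S_of_w[OF that] in \<open>simp add: coproj_def pair_vector_matrix\<close>)
  have conf_v: "pair (op (X *v v)) y + pair (op v) (X *v y) = lam X * pair (op v) y" if "X \<in> g" for X y
    by (simp add: pop t_Xv[OF that] t_vw pair_simps pair_vw pair_vector_matrix lam_def algebra_simps)
  have conf_w: "pair (op (X *v w)) y + pair (op w) (X *v y) = lam X * pair (op w) y" if "X \<in> g" for X y
    by (simp add: pop t_Xw[OF that] t_vw pair_simps pair_vw pair_vector_matrix lam_def algebra_simps)
  have conf_m: "pair (op (X *v m)) y + pair (op m) (X *v y) = lam X * pair (op m) y"
    if X: "X \<in> g" and m: "pair \<phi> m = 0" "pair \<phi>0 m = 0" for X m y
  proof -
    have "pair (t m) (X *v w) = - pair \<phi> (X *v m)" "pair (t m) (X *v v) = pair \<phi>0 (X *v m)"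
      using m by (simp_all add: anti[of m] t_Xv[OF X] t_Xw[OF X] pair_simps pair_vector_matrix)
    then show ?thesis
      by (simp add: pop key[OF X m] m pair_simps pair_vector_matrix algebra_simps)
  qed
  have conf: "pair (op (X *v x)) y + pair (op x) (X *v y) = lam X * pair (op x) y" if X: "X \<in> g" for X x y
  proof -
    have x: "op (X *v x) = pair \<phi> x *s op (X *v v) + pair \<phi>0 x *s op (X *v w) + op (X *v proj x)"
      by (subst (1) proj_decomp[of x]) (simp only: vec.add vec.scale op_add op_scale)
    have x': "op x = pair \<phi> x *s op v + pair \<phi>0 x *s op w + op (proj x)"
      by (subst (1) proj_decomp[of x]) (simp only: op_add op_scale)
    show ?thesis
      using arg_cong2[OF conf_v[OF X, of y] conf_w[OF X, of y],
          of "\<lambda>a b. pair \<phi> x * a + pair \<phi>0 x * b"] conf_m[OF X pair_proj, of x y]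
      unfolding x x' by (simp add: pair_simps algebra_simps)
  qed
  have op0: "op x = 0 \<Longrightarrow> x = 0" for x
  proof -
    let ?K = "{x. op x = 0}"
    have "op 0 = 0" using op_scale[of 0 0] by simp
    then have "vec.subspace ?K"
      by (simp add: vec.subspace_def op_add op_scale)
    moreover have "X *v x \<in> ?K" if "X \<in> g" "x \<in> ?K" for X x
    proof -
      have "pair (op (X *v x)) y = pair 0 y" for y
        using conf[OF that(1), of x y] that(2) by simp
      then show ?thesis using pair_ext by blast
    qed
    ultimately have "?K = {0} \<or> ?K = UNIV" by (rule irreducible)
    moreover have "pair (op v) w = 1" by (simp add: pop pair_vw t_vw)
    then have "v \<notin> ?K" by auto
    ultimately show "op x = 0 \<Longrightarrow> x = 0" by blast
  qed
  define J where "J = matrix op"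
  have Jx: "J *v x = op x" for x
    unfolding J_def by (rule matrix_works) (unfold_locales; simp add: op_add op_scale)
  have invJ: "invertible J"
    using op0 by (simp add: invertible_left_inverse matrix_left_invertible_ker Jx)
  have trJ: "transpose J = - J"
  proof -
    have "transpose J *v x = (- J) *v x" for x
    proof (rule pair_ext)
      fix y
      have "pair (transpose J *v x) y = pair (op y) x"
        by (simp add: pair_vector_matrix Jx pair_commute[of x])
      also have "\<dots> = pair (- (J *v x)) y" using op_anti[of y x] by (simp add: pair_simps Jx)
      also have "- (J *v x) = (- J) *v x"
        using matrix_vector_mult_diff_rdistrib[of 0 J x] by simp
      finally show "pair (transpose J *v x) y = pair ((- J) *v x) y" .
    qed
    then show ?thesis unfolding matrix_eq by blast
  qed
  have inv: "J ** X + transpose X ** J = 0" if X: "X \<in> g" for X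
  proof -
    have eq: "J ** X + transpose X ** J = mat (lam X) ** J"
    proof -
      have "(J ** X + transpose X ** J) *v x = (mat (lam X) ** J) *v x" for x
      proof (rule pair_ext)
        fix y
        show "pair ((J ** X + transpose X ** J) *v x) y = pair ((mat (lam X) ** J) *v x) y"
          using conf[OF X, of x y]
          by (simp add: matrix_vector_mult_add_rdistrib matrix_vector_mul_assoc[symmetric] Jx
              mat_mult_vec pair_simps pair_vector_matrix)
      qed
      then show ?thesis unfolding matrix_eq by blast
    qed
    obtain P where P: "J ** P = mat 1" "P ** J = mat 1"
      using invJ unfolding invertible_def by blast
    \<comment> \<open>multiply by the inverse of \<open>J\<close> and take traces: \<open>2 tr X = lam X N\<close>\<close>
    have "trace (P ** (J ** X + transpose X ** J)) = trace (P ** J ** X) + trace (transpose X ** (J ** P))"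
      using trace_mul_sym[of P "transpose X ** J"] by (simp add: matrix_add_ldistrib trace_add matrix_mul_assoc)
    also have "\<dots> = 2 * trace X" by (simp add: P trace_def transpose_def)
    also have "\<dots> = 0" using traceless[OF X] by simp
    finally have "trace (P ** (mat (lam X) ** J)) = 0" by (simp only: eq)
    moreover have "P ** (mat (lam X) ** J) = mat (lam X) ** mat 1"
      by (metis P(2) mat_mult_comm matrix_mul_assoc)
    ultimately have "lam X * of_nat CARD('d) = 0"
      by (simp only: trace_mat_mult trace_I)
    then have "lam X = 0" by simp
    then show ?thesis using eq by simp
  qed
  show ?thesis using that[OF invJ trJ] inv by blast
qed

end

lemma alternating_invertible_imp_even_card:
  fixes J :: "complex^'d^'d"
  assumes "invertible J" "transpose J = - J"
  shows "even CARD('d)"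
proof -
  have "- J = mat (- 1) ** J"
    by (simp add: vec_eq_iff mat_mult_entry)
  then have "det J = det (mat (- 1) :: complex^'d^'d) * det J"
    using assms(2) det_transpose[of J] by (simp only: det_mul)
  moreover have "det J \<noteq> 0" using assms(1) invertible_det_nz by blast
  moreover have "det (mat (- 1) :: complex^'d^'d) = (- 1) ^ CARD('d)"
    by (subst det_diagonal) (simp_all add: mat_def)
  ultimately have "(- 1 :: complex) ^ CARD('d) = 1" by simp
  then show ?thesis by (metis neg_one_odd_power one_neq_neg_one)
qed

text \<open>In the symplectic case \<open>X \<mapsto> J X\<close> embeds \<open>g\<close> into the symmetric matrices, so its real dimension is at
  most \<open>N (N + 1)\<close>. Since it is also at least \<open>2 N\<^sup>2 - 4 N + 4\<close>, this forces \<open>N \<le> 4\<close>, and \<open>N = 3\<close> is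
  excluded because \<open>J\<close> is alternating and invertible.\<close>

theorem (in irreducible_lie_algebra) large_irreducible_is_full_or_symplectic:
  "(\<forall>X. trace X = 0 \<longrightarrow> X \<in> g) \<or>
   CARD('d) = 4 \<and> dim g \<le> 20 \<and> (\<exists>v a. v \<noteq> 0 \<and> a \<noteq> 0 \<and> outer v a \<in> g) \<and>
     (\<exists>J. invertible J \<and> transpose J = - J \<and> (\<forall>X\<in>g. J ** X + transpose X ** J = 0))"
proof -
  obtain v w \<phi> \<phi>0 where vw: "pair \<phi> v = 1" "pair \<phi> w = 0" "pair \<phi>0 v = 0" "pair \<phi>0 w = 1"
    "outer v \<phi>0 \<in> g" "outer w \<phi> \<in> g"
    by (rule opposite_rank_ones)
  interpret irreducible_lie_algebra_with_sl2 g v w \<phi> \<phi>0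
    by unfold_locales (use vw in auto)
  show ?thesis
  proof (cases "\<exists>a. a \<noteq> 0 \<and> S a 0")
    case True
    then show ?thesis using full_if_v_times_covector by blast
  next
    case False
    then obtain J where J: "invertible J" "transpose J = - J"
        "\<And>X. X \<in> g \<Longrightarrow> J ** X + transpose X ** J = 0"
      using symplectic_if_no_v_times_covector by blast
    let ?N = "CARD('d)"
    obtain P where P: "P ** J = mat 1" using J(1) unfolding invertible_def by blast
    have lin: "linear (\<lambda>X :: complex^'d^'d. J ** X)"
      by (rule linearI) (rule matrix_add_ldistrib, rule matrix_scaleR_mult_right)
    have "inj (\<lambda>X :: complex^'d^'d. J ** X)"
      by (rule inj_on_inverseI[of _ "\<lambda>Y. P ** Y"]) (simp add: matrix_mul_assoc P)
    then have "dim ((\<lambda>X. J ** X) ` g) = dim g"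
      using dim_image_eq[OF lin, of g] inj_on_subset by blast
    moreover have "(\<lambda>X. J ** X) ` g \<subseteq> {G. transpose G = G}"
    proof
      fix G assume "G \<in> (\<lambda>X. J ** X) ` g"
      then obtain X where X: "X \<in> g" "G = J ** X" by blast
      have "transpose G = transpose X ** transpose J" by (simp add: X matrix_transpose_mul)
      also have "\<dots> = - (transpose X ** J)"
        using matrix_diff_ldistrib[of "transpose X" 0 J] by (simp add: J(2))
      also have "\<dots> = G" using J(3)[OF X(1)] X(2) by (simp add: add_eq_0_iff2 minus_equation_iff)
      finally show "G \<in> {G. transpose G = G}" by simp
    qed
    ultimately have d: "dim g \<le> ?N * (?N + 1)"
      using dim_subset[of "(\<lambda>X. J ** X) ` g" "{G. transpose G = G}"] dim_symmetric_matrices_le[where 'd='d]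
      by linarith
    have "2 * ?N^2 + 4 \<le> ?N * (?N + 1) + 4 * ?N"
      using d dim_ann[OF csub] small_codim by linarith
    then have le: "?N * ?N + 4 \<le> 5 * ?N" by (simp add: power2_eq_square algebra_simps)
    have "?N \<le> 4"
    proof (rule ccontr)
      assume "\<not> ?thesis"
      then have "5 * ?N \<le> ?N * ?N" by simp
      then show False using le by linarith
    qed
    moreover have "?N \<noteq> 3" using alternating_invertible_imp_even_card[OF J(1,2)] by auto
    ultimately have "?N = 4" using card_ge_3 by linarith
    moreover have "v \<noteq> 0" "\<phi>0 \<noteq> 0" using vw by auto
    ultimately show ?thesis using d J vw(5) by auto
  qed
qed

section \<open>Hermitian forms\<close>

locale hermitian_space =
  fixes B :: "complex^'d \<Rightarrow> complex^'d \<Rightarrow> complex" and p q :: nat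
  assumes herm: "hermitian_form B" and sig: "has_signature B p q"
    and p_ge_1: "1 \<le> p" and p_le_q: "p \<le> q" and card_eq: "CARD('d) = p + q"
begin

lemma B_add_left: "B (x + y) z = B x z + B y z"
  and B_scale_left: "B (c *s x) y = c * B x y"
  and B_cnj: "B y x = cnj (B x y)"
  using herm unfolding hermitian_form_def by blast+

lemma B_add_right: "B x (y + z) = B x y + B x z"
  by (simp only: B_cnj[of x] B_add_left complex_cnj_add)

lemma B_scale_right: "B x (c *s y) = cnj c * B x y"
  by (simp only: B_cnj[of x] B_scale_left complex_cnj_mult complex_cnj_cnj)

lemma B_zero_left [simp]: "B 0 x = 0"
  using B_scale_left[of 0 0 x] by simp

lemma B_zero_right [simp]: "B x 0 = 0"
  using B_scale_right[of x 0 0] by simp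

lemma B_minus_left: "B (- x) y = - B x y"
  using B_scale_left[of "- 1" x y] by simp

lemma B_minus_right: "B x (- y) = - B x y"
  using B_scale_right[of x "- 1" y] by simp

lemma B_diff_left: "B (x - y) z = B x z - B y z"
  using B_add_left[of x "- y" z] by (simp add: B_minus_left)

lemma B_diff_right: "B x (y - z) = B x y - B x z"
  using B_add_right[of x y "- z"] by (simp add: B_minus_right)

lemmas B_simps = B_add_left B_add_right B_scale_left B_scale_right B_minus_left B_minus_right
  B_diff_left B_diff_right

lemma B_sum_left: "B (\<Sum>i\<in>A. f i) y = (\<Sum>i\<in>A. B (f i) y)"
  by (induction A rule: infinite_finite_induct) (simp_all add: B_simps)

lemma B_sum_right: "B x (\<Sum>i\<in>A. f i) = (\<Sum>i\<in>A. B x (f i))"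
  by (induction A rule: infinite_finite_induct) (simp_all add: B_simps)

lemma B_self_real: "B x x = complex_of_real (Re (B x x))"
  using B_cnj[of x x] by (simp add: complex_eq_iff)

lemma B_zero_sym: "B x y = 0 \<longleftrightarrow> B y x = 0"
  using B_cnj[of x y] by simp

lemma vec_subspace_B_left: "vec.subspace {x. B x y = 0}"
  and vec_subspace_B_right: "vec.subspace {y. B x y = 0}"
  by (auto simp: vec.subspace_def B_simps)

lemma B_span_left: "x \<in> vec.span S \<Longrightarrow> (\<And>s. s \<in> S \<Longrightarrow> B s y = 0) \<Longrightarrow> B x y = 0"
  using vec.span_minimal[OF _ vec_subspace_B_left, of S y] by blast

lemma B_span_right: "y \<in> vec.span S \<Longrightarrow> (\<And>s. s \<in> S \<Longrightarrow> B x s = 0) \<Longrightarrow> B x y = 0"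
  using vec.span_minimal[OF _ vec_subspace_B_right, of S x] by blast

lemma orthogonal_basis:
  obtains E where "finite E" "vec.independent E" "vec.span E = UNIV"
    "\<And>x y. x \<in> E \<Longrightarrow> y \<in> E \<Longrightarrow> x \<noteq> y \<Longrightarrow> B x y = 0"
    "\<And>x. x \<in> E \<Longrightarrow> B x x = 1 \<or> B x x = -1"
    "card {x\<in>E. B x x = 1} = p" "card {x\<in>E. B x x = -1} = q"
proof -
  obtain E where E: "vec.independent E \<and> vec.span E = UNIV \<and>
        (\<forall>x\<in>E. \<forall>y\<in>E. x \<noteq> y \<longrightarrow> B x y = 0) \<and>
        (\<forall>x\<in>E. B x x = 1 \<or> B x x = -1) \<and>
        card {x\<in>E. B x x = 1} = p \<and> card {x\<in>E. B x x = -1} = q"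
    using sig unfolding has_signature_def by blast
  moreover have "finite E" using E vec.finiteI_independent by blast
  ultimately show ?thesis using that by blast
qed

lemma nondegenerate:
  assumes "\<And>y. B x y = 0"
  shows "x = 0"
proof -
  obtain E where "vec.independent E" and E: "finite E" "vec.span E = UNIV"
    "\<And>x y. x \<in> E \<Longrightarrow> y \<in> E \<Longrightarrow> x \<noteq> y \<Longrightarrow> B x y = 0"
    "\<And>x. x \<in> E \<Longrightarrow> B x x = 1 \<or> B x x = -1"
    by (rule orthogonal_basis) (rule that)
  have "x \<in> vec.span E" using E(2) by simp
  then obtain u where u: "x = (\<Sum>e\<in>E. u e *s e)"
    using vec.span_finite[OF E(1)] by auto
  have "u f = 0" if f: "f \<in> E" for f
  proof -
    have "B x f = (\<Sum>e\<in>E. u e * B e f)" by (simp add: u B_sum_left B_scale_left)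
    also have "\<dots> = (\<Sum>e\<in>E. if e = f then u f * B f f else 0)"
      by (rule sum.cong) (use E(3) f in auto)
    also have "\<dots> = u f * B f f" using E(1) f by simp
    finally show "u f = 0" using assms[of f] E(4)[OF f] by auto
  qed
  then show ?thesis by (simp add: u)
qed

lemma B_right_eqI:
  assumes "\<And>x. B x u = B x u'"
  shows "u = u'"
proof -
  have "B (u - u') y = 0" for y
    using assms[of y] by (subst B_cnj) (simp add: B_simps)
  then have "u - u' = 0" by (rule nondegenerate)
  then show ?thesis by simp
qed

definition cnjv :: "complex^'d \<Rightarrow> complex^'d" where
  "cnjv y = (\<chi> i. cnj (y$i))"

definition gram :: "complex^'d^'d" where
  "gram = (\<chi> i j. B (axis i 1) (axis j 1))"

text \<open>The antilinear isomorphism onto covectors that the Hermitian form induces.\<close>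

definition flat :: "complex^'d \<Rightarrow> complex^'d" where
  "flat y = gram *v cnjv y"

lemma cnjv_cnjv [simp]: "cnjv (cnjv y) = y"
  by (simp add: cnjv_def vec_eq_iff)

lemma B_eq_pair: "B x y = pair (flat y) x"
proof -
  have x: "x = (\<Sum>i\<in>UNIV. x$i *s axis i 1)" and y: "y = (\<Sum>i\<in>UNIV. y$i *s axis i 1)"
    by (simp_all only: basis_expansion)
  have y': "B (axis i 1) y = (\<Sum>j\<in>UNIV. cnj (y$j) * B (axis i 1) (axis j 1))" for i
    by (subst (1) y) (simp add: B_sum_right B_scale_right)
  have "B x y = (\<Sum>i\<in>UNIV. x$i * B (axis i 1) y)"
    by (subst (1) x) (simp add: B_sum_left B_scale_left)
  also have "\<dots> = pair (flat y) x"
    by (simp add: y' pair_def flat_def gram_def cnjv_def matrix_vector_mult_def mult.commute)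
  finally show ?thesis .
qed

lemma flat_add: "flat (x + y) = flat x + flat y"
  and flat_scale: "flat (c *s x) = cnj c *s flat x"
  and flat_scaleR: "flat (r *\<^sub>R x) = r *\<^sub>R flat x"
  by (rule pair_ext; simp add: B_eq_pair[symmetric] pair_simps B_simps vec_scaleR_scale)+

lemma flat_eq_0: "flat x = 0 \<Longrightarrow> x = 0"
  using nondegenerate[of x] B_zero_sym[of x] B_eq_pair[of _ x] by simp

lemma flat_inj: "inj flat"
proof (rule injI)
  fix x y assume "flat x = flat y"
  moreover have "flat (x - y) = flat x - flat y"
    by (rule pair_ext) (simp add: B_eq_pair[symmetric] pair_simps B_simps)
  ultimately have "x - y = 0" using flat_eq_0[of "x - y"] by simp
  then show "x = y" by simp
qed

lemma linear_flat: "linear flat"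
  by (rule linearI) (simp_all add: flat_add flat_scaleR)

lemma flat_surj: "surj flat"
proof -
  have "dim (range flat) = dim (UNIV :: (complex^'d) set)"
    using dim_image_eq[OF linear_flat, of UNIV] flat_inj by simp
  then have "range flat = UNIV"
    using dim_eq_full[of "range flat"] linear_subspace_image[OF linear_flat subspace_UNIV]
    by (simp add: span_eq_iff[THEN iffD2])
  then show ?thesis .
qed

lemma riesz:
  obtains u where "\<And>x. pair a x = B x u"
proof -
  obtain u where "flat u = a" using flat_surj by (metis surjD)
  then show ?thesis using that[of u] by (simp add: B_eq_pair)
qed

definition perp :: "(complex^'d) set \<Rightarrow> (complex^'d) set" where
  "perp W = {x. \<forall>w\<in>W. B x w = 0}"

lemma vec_subspace_perp: "vec.subspace (perp W)"
  by (auto simp: perp_def vec.subspace_def B_simps)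

lemma vec_dim_perp:
  assumes W: "vec.subspace W"
  shows "vec.dim (perp W) + vec.dim W = CARD('d)"
proof -
  have "perp W = ann_vec (flat ` W)"
    unfolding perp_def ann_vec_def by (auto simp: B_eq_pair pair_commute)
  moreover have fW: "vec.subspace (flat ` W)"
    unfolding vec.subspace_def
  proof (intro conjI ballI allI)
    show "0 \<in> flat ` W" using W flat_scale[of 0 0] by (auto simp: vec.subspace_def intro!: image_eqI[of _ _ 0])
    show "x + y \<in> flat ` W" if xy: "x \<in> flat ` W" "y \<in> flat ` W" for x y
    proof -
      obtain a b where "a \<in> W" "b \<in> W" "x = flat a" "y = flat b" using xy by blast
      then have "a + b \<in> W" "x + y = flat (a + b)"
        using W by (simp_all add: flat_add vec.subspace_add)
      then show ?thesis by blast
    qed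
    show "c *s x \<in> flat ` W" if x: "x \<in> flat ` W" for c x
    proof -
      obtain a where "a \<in> W" "x = flat a" using x by blast
      then have "cnj c *s a \<in> W" "c *s x = flat (cnj c *s a)"
        using W by (simp_all add: flat_scale vec.subspace_scale)
      then show ?thesis by blast
    qed
  qed
  moreover have "dim (flat ` W) = dim W"
    using dim_image_eq[OF linear_flat, of W] inj_on_subset[OF flat_inj] by blast
  ultimately have "dim (perp W) + dim W = 2 * CARD('d)"
    using dim_ann_vec[OF fW] by simp
  then show ?thesis
    using dim_eq_twice_vec_dim[OF W] dim_eq_twice_vec_dim[OF vec_subspace_perp[of W]] by simp
qed

lemma perp_perp:
  assumes W: "vec.subspace W"
  shows "perp (perp W) = W"
proof -
  have sub: "W \<subseteq> perp (perp W)" by (auto simp: perp_def B_zero_sym)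
  have "vec.dim (perp (perp W)) \<le> vec.dim W"
    using vec_dim_perp[OF W] vec_dim_perp[OF vec_subspace_perp[of W]] by linarith
  then show ?thesis
    using vec.subspace_dim_equal[OF W vec_subspace_perp sub] by simp
qed

section \<open>Dimensions of subalgebras of the unitary Lie algebra\<close>

definition skew :: "complex^'d^'d \<Rightarrow> bool" where
  "skew A \<longleftrightarrow> (\<forall>x y. B (A *v x) y + B x (A *v y) = 0)"

lemma skewD: "skew A \<Longrightarrow> B (A *v x) y = - B x (A *v y)"
  by (simp add: skew_def add_eq_0_iff2)

lemma su_alg_eq: "su_alg B = {A. trace A = 0 \<and> skew A}"
  by (simp add: su_alg_def skew_def)

lemma skew_add: "skew A \<Longrightarrow> skew C \<Longrightarrow> skew (A + C)"
  unfolding skew_def by (simp add: matrix_vector_mult_add_rdistrib B_simps algebra_simps)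

lemma skew_scaleR: "skew A \<Longrightarrow> skew (r *\<^sub>R A)"
  unfolding skew_def mat_scaleR_scale mat_mult_vec_assoc
  by (simp add: B_simps distrib_left[symmetric])

lemma skew_zero: "skew 0"
  by (simp add: skew_def)

lemma skew_mat_i: "skew (mat \<i>)"
  by (simp add: skew_def mat_mult_vec B_simps)

lemma skew_bracket:
  assumes A: "skew A" and C: "skew C"
  shows "skew (lie_bracket A C)"
  unfolding skew_def matrix_vector_mult_lie_bracket
  by (simp add: B_simps skewD[OF A] skewD[OF C])

text \<open>Both signs occur: \<open>B (A x) y\<close> is \<open>- B x (A y)\<close> as \<open>A\<close> is skew and \<open>B x (A y)\<close> as \<open>\<i> A\<close> is.\<close>

lemma skew_i_mult:
  assumes "skew A" "skew (mat \<i> ** A)"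
  shows "A = 0"
proof -
  have "B (A *v x) y = 0" for x y
  proof -
    have "\<i> * B (A *v x) y - \<i> * B x (A *v y) = 0"
      using assms(2) by (simp add: skew_def mat_mult_vec_assoc B_simps)
    then show ?thesis using skewD[OF assms(1), of x y] by (simp add: right_diff_distrib[symmetric])
  qed
  then have "A *v x = 0" for x using nondegenerate by blast
  then show ?thesis by (simp add: matrix_eq)
qed

text \<open>In terms of the Gram matrix \<open>G\<close> skewness reads \<open>A\<^sup>T G = - G C\<close>, where \<open>C\<close> is the complex
  conjugate of \<open>A\<close>; hence \<open>A\<^sup>T\<close> is conjugate to \<open>- C\<close> and has the same trace.\<close>

lemma skew_trace:
  assumes "skew A"
  shows "Re (trace A) = 0"
proof -
  have "invertible gram"
    unfolding invertible_left_inverse matrix_left_invertible_ker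
  proof (intro allI impI)
    fix x assume "gram *v x = 0"
    then have "flat (cnjv x) = 0" by (simp add: flat_def)
    then have "cnjv x = 0" by (rule flat_eq_0)
    then show "x = 0" by (simp add: cnjv_def vec_eq_iff)
  qed
  then obtain H where H: "gram ** H = mat 1" "H ** gram = mat 1"
    unfolding invertible_def by blast
  define C where "C = (\<chi> i j. cnj (A$i$j))"
  have C: "cnjv (A *v y) = C *v cnjv y" for y
    by (simp add: cnjv_def C_def matrix_vector_mult_def)
  have "transpose A ** gram = - (gram ** C)"
  proof -
    have "(transpose A ** gram) *v z = (- (gram ** C)) *v z" for z
    proof (rule pair_ext)
      fix x
      have "pair ((transpose A ** gram) *v z) x = B (A *v x) (cnjv z)"
        by (simp add: B_eq_pair flat_def matrix_vector_mul_assoc[symmetric] pair_vector_matrix)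
      also have "\<dots> = - B x (A *v cnjv z)" by (rule skewD[OF assms])
      also have "\<dots> = pair (- ((gram ** C) *v z)) x"
        by (simp add: B_eq_pair flat_def C pair_simps matrix_vector_mul_assoc[symmetric])
      also have "- ((gram ** C) *v z) = (- (gram ** C)) *v z"
        using matrix_vector_mult_diff_rdistrib[of 0 "gram ** C" z] by simp
      finally show "pair ((transpose A ** gram) *v z) x = pair ((- (gram ** C)) *v z) x" .
    qed
    then show ?thesis unfolding matrix_eq by blast
  qed
  then have "trace (transpose A ** gram ** H) = - trace (H ** (gram ** C))"
    using trace_mul_sym[of "- (gram ** C)" H] matrix_diff_ldistrib[of H 0 "gram ** C"] trace_sub[of 0 "H ** (gram ** C)"]
    by simp
  moreover have "transpose A ** gram ** H = transpose A"
    by (simp only: matrix_mul_assoc[symmetric] H matrix_mul_rid)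
  moreover have "H ** (gram ** C) = C" by (simp add: matrix_mul_assoc H)
  ultimately have "trace (transpose A) = - trace C" by simp
  moreover have "trace (transpose A) = trace A" by (simp add: trace_def transpose_def)
  moreover have "trace C = cnj (trace A)" by (simp add: trace_def C_def cnj_sum)
  ultimately have "Re (trace A) = - Re (trace A)" by (metis complex_cnj uminus_complex.sel(1) cnj.sel(1))
  then show ?thesis by simp
qed

text \<open>Traces of skew matrices are imaginary, so the trace condition is a single real equation, and the
  skew matrix \<open>\<i>\<close> violates it.\<close>

lemma dim_trace_zero_part:
  assumes K: "subspace K" "\<And>A. A \<in> K \<Longrightarrow> skew A" "mat \<i> \<in> K"
  shows "dim {A \<in> K. trace A = 0} + 1 = dim K"
proof -
  let ?T = "{A \<in> K. trace A = 0}"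
  have T: "subspace ?T"
    using K(1) by (auto simp: subspace_def trace_add trace_scaleR)
  have tri: "trace (mat \<i> :: complex^'d^'d) = \<i> * of_nat CARD('d)"
    using trace_mat_mult[of \<i> "mat 1 :: complex^'d^'d"] by (simp add: trace_I)
  have "mat \<i> \<notin> span ?T"
    using T tri by (simp add: span_eq_iff[THEN iffD2])
  moreover have "span (insert (mat \<i>) ?T) = K"
  proof
    show "span (insert (mat \<i>) ?T) \<subseteq> K"
      by (rule span_minimal) (use K in auto)
    show "K \<subseteq> span (insert (mat \<i>) ?T)"
    proof
      fix A assume A: "A \<in> K"
      define r where "r = Im (trace A) / of_nat CARD('d)"
      have "trace (A - r *\<^sub>R mat \<i>) = 0"
        using skew_trace[OF K(2)[OF A]]
        by (simp add: trace_sub trace_scaleR tri r_def complex_eq_iff)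
      moreover have "A - r *\<^sub>R mat \<i> \<in> K"
        using A K by (simp add: subspace_diff subspace_scale)
      ultimately have "A - r *\<^sub>R mat \<i> \<in> ?T" by simp
      then have "(A - r *\<^sub>R mat \<i>) + r *\<^sub>R mat \<i> \<in> span (insert (mat \<i>) ?T)"
        by (intro span_add span_scale span_base) auto
      then show "A \<in> span (insert (mat \<i>) ?T)" by simp
    qed
  qed
  ultimately show ?thesis
    using dim_insert[of "mat \<i>" ?T] dim_span[of "insert (mat \<i>) ?T"] by simp
qed

text \<open>In a basis \<open>b\<close> the numbers \<open>B (A b\<^sub>i) b\<^sub>j\<close> form a skew-Hermitian matrix when \<open>A\<close> is skew, and every
  skew-Hermitian matrix arises in this way. Adding the real and the imaginary part of each entry is a
  real linear bijection from skew-Hermitian matrices to all real matrices, and it respects the zeros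
  outside the symmetric pattern \<open>Z\<close>.\<close>

lemma dim_skew_supported:
  fixes P :: "complex^'d^'d" and Z :: "('d \<times> 'd) set"
  assumes P: "invertible P" and Z: "\<And>i j. (i, j) \<in> Z \<Longrightarrow> (j, i) \<in> Z"
  shows "dim {A. skew A \<and> (\<forall>i j. (i, j) \<notin> Z \<longrightarrow> B (A *v column i P) (column j P) = 0)} = card Z"
proof -
  let ?b = "\<lambda>i. column i P"
  let ?K = "{A. skew A \<and> (\<forall>i j. (i, j) \<notin> Z \<longrightarrow> B (A *v ?b i) (?b j) = 0)}"
  let ?R = "{M :: real^'d^'d. \<forall>i j. (i, j) \<notin> Z \<longrightarrow> M$i$j = 0}"
  define m where "m A i j = B (A *v ?b i) (?b j)" for A i j
  define f where "f A = (\<chi> i j. Re (m A i j) + Im (m A i j))" for A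
  have spanP: "vec.span (range ?b) = UNIV"
    using P matrix_right_invertible_span_columns[of P] invertible_right_inverse[of P]
    by (simp add: columns_def full_SetCompr_eq)
  have eq0: "x = 0" if "\<And>j. B x (?b j) = 0" for x
  proof (rule nondegenerate)
    fix y
    have "y \<in> vec.span (range ?b)" using spanP by simp
    then show "B x y = 0" by (rule B_span_right) (use that in auto)
  qed
  have msym: "m A j i = - cnj (m A i j)" if "skew A" for A i j
    unfolding m_def by (subst skewD[OF that]) (simp add: B_cnj[of "?b j"])
  have madd: "m (A + C) i j = m A i j + m C i j" for A C i j
    by (simp add: m_def matrix_vector_mult_add_rdistrib B_simps)
  have mscale: "m (r *\<^sub>R A) i j = of_real r * m A i j" for A r i j
    by (simp add: m_def mat_scaleR_scale mat_mult_vec_assoc B_simps)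
  have lin: "linear f"
    by (rule linearI) (simp_all add: f_def madd mscale vec_eq_iff algebra_simps)
  have K: "subspace ?K"
    unfolding m_def[symmetric] subspace_def
    by (auto simp: skew_zero skew_add skew_scaleR madd mscale) (simp add: m_def)
  have inj: "inj_on f ?K"
  proof (rule inj_onI)
    fix A C assume AC: "A \<in> ?K" "C \<in> ?K" "f A = f C"
    have D: "A - C \<in> ?K" using AC(1,2) by (rule subspace_diff[OF K])
    have "f (A - C) = 0" using AC(3) by (simp add: linear_diff[OF lin])
    then have z: "Re (m (A - C) i j) + Im (m (A - C) i j) = 0" for i j
      by (simp add: f_def vec_eq_iff)
    have "m (A - C) i j = 0" for i j
    proof -
      have "skew (A - C)" using D by simp
      from msym[OF this, of j i] z[of i j] z[of j i] show ?thesis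
        by (simp add: complex_eq_iff)
    qed
    then have "(A - C) *v ?b i = 0" for i using eq0 by (simp add: m_def)
    moreover have "vec.subspace {x. (A - C) *v x = 0}"
      by (simp add: vec.subspace_def vec.add vec.scale)
    ultimately have "vec.span (range ?b) \<subseteq> {x. (A - C) *v x = 0}"
      by (intro vec.span_minimal) auto
    then have "\<forall>x. (A - C) *v x = 0 *v x" using spanP by auto
    then have "A - C = 0" unfolding matrix_eq .
    then show "A = C" by simp
  qed
  have "f ` ?K = ?R"
  proof (intro equalityI subsetI)
    fix M assume "M \<in> f ` ?K"
    then show "M \<in> ?R" by (auto simp: f_def m_def)
  next
    fix M :: "real^'d^'d" assume M: "M \<in> ?R"
    \<comment> \<open>the skew-Hermitian matrix whose real and imaginary parts add up to \<open>M\<close>\<close>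
    define N where "N i j = Complex ((M$i$j - M$j$i) / 2) ((M$i$j + M$j$i) / 2)" for i j
    obtain Q where Q: "P ** Q = mat 1" "Q ** P = mat 1"
      using P unfolding invertible_def by blast
    have Qb: "Q *v ?b i = axis i 1" for i
    proof -
      have "?b i = P *v axis i 1" by (simp add: column_def matrix_vector_mult_def axis_def vec_eq_iff
          if_distrib[of "\<lambda>z. _ * z"] cong: if_cong)
      then show ?thesis by (simp add: matrix_vector_mul_assoc Q)
    qed
    have "\<exists>u. \<forall>j. B u (?b j) = N i j" for i
    proof -
      let ?n = "\<chi> j. cnj (N i j)"
      obtain u where u: "\<And>x. pair (?n v* Q) x = B x u" using riesz by blast
      have "B (?b j) u = cnj (N i j)" for j
        using u[of "?b j"] by (simp add: pair_vector_matrix Qb pair_axis_left pair_commute[of _ "axis j 1"])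
      then have "B u (?b j) = N i j" for j using B_cnj[of "u" "?b j"] by simp
      then show ?thesis by blast
    qed
    then obtain u where u: "\<And>i j. B (u i) (?b j) = N i j" by metis
    define A where "A = (\<chi> k i. u i $ k) ** Q"
    have Ab: "A *v ?b i = u i" for i
    proof -
      have "A *v ?b i = (\<chi> k i. u i $ k) *v axis i 1"
        by (simp add: A_def matrix_vector_mul_assoc[symmetric] Qb)
      then show ?thesis
        by (simp add: matrix_vector_mult_def axis_def vec_eq_iff if_distrib[of "\<lambda>z. _ * z"] cong: if_cong)
    qed
    have mA: "m A i j = N i j" for i j by (simp add: m_def Ab u)
    have bb: "B (A *v ?b i) (?b j) + B (?b i) (A *v ?b j) = 0" for i j
      using B_cnj[of "?b i" "A *v ?b j"] mA[of i j] mA[of j i]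
      by (simp add: m_def N_def complex_eq_iff)
    have "skew A"
      unfolding skew_def
    proof (intro allI)
      fix x y
      have s1: "vec.subspace {x. B (A *v x) y + B x (A *v y) = 0}" for y
      proof -
        have eq: "B (A *v x) y + B x (A *v y) = pair (flat y v* A + flat (A *v y)) x" for x
          by (simp add: B_eq_pair pair_simps pair_vector_matrix)
        show ?thesis
          unfolding eq by (rule vec_subspace_pair_kernel)
      qed
      have s2: "vec.subspace {y. B (A *v x) y + B x (A *v y) = 0}" for x
      proof -
        have "B (A *v x) y + B x (A *v y) = 0 \<longleftrightarrow> B (A *v y) x + B y (A *v x) = 0" for y
          using B_cnj[of "A *v x" y] B_cnj[of x "A *v y"]
          by (metis add.commute complex_cnj_add complex_cnj_zero_iff)
        then show ?thesis using s1[of x] by simp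
      qed
      have 1: "B (A *v ?b i) y + B (?b i) (A *v y) = 0" for i y
      proof -
        have "vec.span (range ?b) \<subseteq> {y. B (A *v ?b i) y + B (?b i) (A *v y) = 0}"
          by (rule vec.span_minimal[OF _ s2]) (use bb in auto)
        then show ?thesis using spanP by auto
      qed
      have "vec.span (range ?b) \<subseteq> {x. B (A *v x) y + B x (A *v y) = 0}"
        by (rule vec.span_minimal[OF _ s1]) (use 1 in auto)
      then show "B (A *v x) y + B x (A *v y) = 0" using spanP by auto
    qed
    moreover have "B (A *v ?b i) (?b j) = 0" if "(i, j) \<notin> Z" for i j
    proof -
      have "(j, i) \<notin> Z" using Z that by blast
      then show ?thesis using M that mA[of i j] by (simp add: m_def N_def complex_eq_iff)
    qed
    moreover have "f A = M"
      by (simp add: f_def mA N_def vec_eq_iff field_simps)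
    ultimately show "M \<in> f ` ?K" by blast
  qed
  moreover have "dim (f ` ?K) = dim ?K"
    using dim_image_eq[OF lin, of ?K] inj by (simp only: span_eq_iff[THEN iffD2, OF K])
  ultimately show ?thesis
    using dim_supported_matrices[of Z, where 'b=real] by simp
qed

end

section \<open>Flags and Borel subalgebras\<close>

lemma nested_enumeration:
  assumes "E1 \<subseteq> E2" "E2 \<subseteq> E3" "finite E3"
  obtains e :: "nat \<Rightarrow> 'a" where "inj_on e {..<card E3}" "e ` {..<card E1} = E1"
    "e ` {..<card E2} = E2" "e ` {..<card E3} = E3"
proof -
  have "finite E2" using finite_subset[OF assms(2,3)] .
  then have fin: "finite E1" "finite (E2 - E1)" "finite (E3 - E2)"
    using finite_subset[OF assms(1)] assms(3) by auto
  obtain xs1 xs2 xs3 where xs: "set xs1 = E1" "distinct xs1" "set xs2 = E2 - E1" "distinct xs2"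
      "set xs3 = E3 - E2" "distinct xs3"
    using finite_distinct_list[OF fin(1)] finite_distinct_list[OF fin(2)] finite_distinct_list[OF fin(3)]
    by metis
  have len: "length xs1 = card E1" "length (xs1 @ xs2) = card E2" "length (xs1 @ xs2 @ xs3) = card E3"
  proof -
    have "distinct (xs1 @ xs2)" "set (xs1 @ xs2) = E2" using xs assms by auto
    then show "length (xs1 @ xs2) = card E2" using distinct_card by metis
    have "distinct (xs1 @ xs2 @ xs3)" "set (xs1 @ xs2 @ xs3) = E3" using xs assms by auto
    then show "length (xs1 @ xs2 @ xs3) = card E3" using distinct_card by metis
    show "length xs1 = card E1" using xs distinct_card by metis
  qed
  let ?xs = "xs1 @ xs2 @ xs3"
  have d: "distinct ?xs" using xs assms by auto
  have "inj_on (nth ?xs) {..<card E3}"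
    using d len(3) by (intro inj_on_nth) auto
  moreover have "nth ?xs ` {..<card E1} = E1"
    using nth_image[of "card E1" ?xs] len(1) xs by (simp add: atLeast0LessThan)
  moreover have "nth ?xs ` {..<card E2} = E2"
  proof -
    have "nth ?xs ` {0..<card E2} = set (take (card E2) ?xs)"
      by (rule nth_image) (use len in simp)
    also have "take (card E2) ?xs = xs1 @ xs2"
      using len(2) by simp
    finally show ?thesis using xs assms by (auto simp: atLeast0LessThan)
  qed
  moreover have "nth ?xs ` {..<card E3} = E3"
    using nth_image[of "card E3" ?xs] len(3) xs assms by (auto simp: atLeast0LessThan)
  ultimately show ?thesis by (rule that)
qed

lemma adapted_basis:
  fixes W W1 :: "(complex^'d) set"
  assumes "vec.subspace W" "vec.subspace W1" "W \<subseteq> W1"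
  obtains e where "vec.span (e ` {..<vec.dim W}) = W" "vec.span (e ` {..<vec.dim W1}) = W1"
    "vec.span (e ` {..<CARD('d)}) = UNIV"
proof -
  obtain E1 where E1: "E1 \<subseteq> W" "vec.independent E1" "W \<subseteq> vec.span E1" "card E1 = vec.dim W"
    using vec.basis_exists by blast
  obtain E2 where E2: "E1 \<subseteq> E2" "E2 \<subseteq> W1" "vec.independent E2" "W1 \<subseteq> vec.span E2"
    by (rule vec.maximal_independent_subset_extend[of E1 W1]) (use E1 assms in blast)+
  obtain E3 where E3: "E2 \<subseteq> E3" "vec.independent E3" "UNIV \<subseteq> vec.span E3"
    by (rule vec.maximal_independent_subset_extend[of E2 UNIV]) (use E2 in blast)+
  have fin: "finite E3" using E3(2) vec.finiteI_independent by blast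
  have c2: "card E2 = vec.dim W1" using E2 vec.basis_card_eq_dim by metis
  have c3: "card E3 = CARD('d)"
    using vec.basis_card_eq_dim[of E3 UNIV] E3 by (simp add: card_cart_basis)
  have sp: "vec.span E1 = W" "vec.span E2 = W1" "vec.span E3 = UNIV"
    using E1 E2 E3 assms vec.span_minimal by blast+
  obtain e where "e ` {..<card E1} = E1" "e ` {..<card E2} = E2" "e ` {..<card E3} = E3"
    using nested_enumeration[OF E2(1) E3(1) fin] by metis
  then show ?thesis using that[of e] sp E1(4) c2 c3 by simp
qed

lemma matrix_of_basis:
  fixes e :: "nat \<Rightarrow> complex^'d"
  assumes "vec.span (e ` {..<CARD('d)}) = UNIV"
  obtains P :: "complex^'d^'d" and r :: "'d \<Rightarrow> nat" where "invertible P" "bij_betw r UNIV {..<CARD('d)}"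
    "\<And>i. column i P = e (r i)"
proof -
  obtain r :: "'d \<Rightarrow> nat" where r: "bij_betw r UNIV {..<CARD('d)}"
    using ex_bij_betw_finite_nat[of "UNIV :: 'd set"] by (auto simp: atLeast0LessThan)
  define P :: "complex^'d^'d" where "P = (\<chi> i j. e (r j) $ i)"
  have col: "column i P = e (r i)" for i by (simp add: column_def P_def)
  have "columns P = e ` r ` UNIV" by (auto simp: columns_def col)
  also have "r ` UNIV = {..<CARD('d)}" using r by (rule bij_betw_imp_surj_on)
  finally have "invertible P"
    using assms matrix_right_invertible_span_columns[of P] invertible_right_inverse[of P] by simp
  then show ?thesis using that r col by blast
qed

lemma csubspace_derived:
  assumes "csubspace D"
  shows "csubspace (derived_alg D)"
proof -
  let ?S = "{lie_bracket A C | A C. A \<in> D \<and> C \<in> D}"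
  have "mat \<i> ** A \<in> span ?S" if "A \<in> span ?S" for A
    using that
  proof (induction rule: span_induct_alt)
    case base then show ?case by (simp add: span_zero)
  next
    case (step c x y)
    then obtain A C where AC: "x = lie_bracket A C" "A \<in> D" "C \<in> D" by blast
    have "mat \<i> ** x = lie_bracket (mat \<i> ** A) C"
      unfolding AC lie_bracket_def matrix_diff_ldistrib
      by (metis mat_mult_comm matrix_mul_assoc)
    then have "mat \<i> ** x \<in> span ?S"
      using AC assms by (intro span_base) (auto simp: csubspace_def)
    moreover have "mat \<i> ** (c *\<^sub>R x + y) = c *\<^sub>R (mat \<i> ** x) + mat \<i> ** y"
      by (simp add: matrix_add_ldistrib matrix_scaleR_mult_right)
    ultimately show ?case using step by (simp add: span_add span_scale)
  qed
  then show ?thesis by (simp add: csubspace_def derived_alg_def)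
qed

text \<open>The elements \<open>x \<otimes> \<psi>\<close> and \<open>A\<close> behave like the two root vectors of an \<open>sl\<^sub>2\<close>. With
  \<open>h = [x \<otimes> \<psi>, A]\<close>, the bracket \<open>[x \<otimes> \<psi>, h]\<close> is a nonzero multiple of \<open>x \<otimes> \<psi>\<close>, and \<open>[h, A]\<close> again
  satisfies \<open>\<psi> ([h, A] x) \<noteq> 0\<close>; so the hypotheses pass to the derived algebra, and the derived series
  never reaches zero.\<close>

lemma not_solvable_if_sl2_like:
  assumes c: "csubspace c" "\<And>A C. A \<in> c \<Longrightarrow> C \<in> c \<Longrightarrow> lie_bracket A C \<in> c"
    and x: "outer x \<psi> \<in> c" "pair \<psi> x = 0" and A: "A \<in> c" "pair \<psi> (A *v x) \<noteq> 0"
  shows "\<not> solvable_alg c"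
proof
  assume "solvable_alg c"
  then obtain k where k: "(derived_alg ^^ k) c = {0}" unfolding solvable_alg_def by blast
  let ?inv = "\<lambda>D. csubspace D \<and> (\<forall>A\<in>D. \<forall>C\<in>D. lie_bracket A C \<in> D) \<and> outer x \<psi> \<in> D \<and>
      (\<exists>A\<in>D. pair \<psi> (A *v x) \<noteq> 0)"
  have step: "?inv (derived_alg D)" if D: "?inv D" for D
  proof -
    let ?S = "{lie_bracket A C | A C. A \<in> D \<and> C \<in> D}"
    obtain A where A: "A \<in> D" "pair \<psi> (A *v x) \<noteq> 0" using D by blast
    have br: "lie_bracket X Y \<in> derived_alg D" if "X \<in> D" "Y \<in> D" for X Y
      unfolding derived_alg_def by (rule span_base) (use that in blast)
    have sub: "derived_alg D \<subseteq> D"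
      unfolding derived_alg_def using D by (intro span_minimal) (auto simp: csubspace_def)
    define \<alpha> where "\<alpha> = pair \<psi> (A *v x)"
    define h where "h = lie_bracket (outer x \<psi>) A"
    have h: "h \<in> D" unfolding h_def using D A by blast
    have hx: "h *v x = \<alpha> *s x"
      by (simp add: h_def matrix_vector_mult_lie_bracket outer_mult_vec \<alpha>_def x(2))
    have \<psi>h: "pair \<psi> (h *v y) = - \<alpha> * pair \<psi> y" for y
      by (simp add: h_def matrix_vector_mult_lie_bracket outer_mult_vec \<alpha>_def x(2) pair_simps vec.scale)
    have cs: "csubspace (derived_alg D)" using D csubspace_derived by blast
    have "lie_bracket (outer x \<psi>) h = mat (- 2 * \<alpha>) ** outer x \<psi>"
    proof -
      have "\<psi> v* h = (- \<alpha>) *s \<psi>"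
        by (rule pair_ext) (simp add: pair_vector_matrix \<psi>h pair_simps)
      then show ?thesis
        by (simp only: lie_bracket_outer_left hx) (simp add: vec_eq_iff mat_mult_entry outer_def)
    qed
    then have "mat (- 2 * \<alpha>) ** outer x \<psi> \<in> derived_alg D"
      using br[of "outer x \<psi>" h] D h by simp
    then have "mat (1 / (- 2 * \<alpha>)) ** (mat (- 2 * \<alpha>) ** outer x \<psi>) \<in> derived_alg D"
      by (rule csubspace_scale[OF cs])
    then have e: "outer x \<psi> \<in> derived_alg D" using A(2) by (simp add: mat_mult_mat \<alpha>_def)
    have "pair \<psi> (lie_bracket h A *v x) = - 2 * \<alpha> * \<alpha>"
      by (simp add: matrix_vector_mult_lie_bracket pair_simps \<psi>h hx vec.scale \<alpha>_def)
    then have "pair \<psi> (lie_bracket h A *v x) \<noteq> 0" using A(2) by (simp add: \<alpha>_def)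
    then show ?thesis using cs br sub e br[OF h A(1)] by blast
  qed
  have "?inv ((derived_alg ^^ k) c)"
    by (induction k) (use assms step in auto)
  then have "outer x \<psi> = 0" "\<exists>A\<in>{0}. pair \<psi> (A *v x) \<noteq> 0" using k by auto
  then show False by simp
qed

text \<open>The stabilizer is solvable: its brackets lower the flag by one step, and brackets of matrices that
  lower it by \<open>m\<close> steps lower it by \<open>2 m\<close> steps. It is maximal: a larger algebra contains a matrix \<open>A\<close> that
  moves some \<open>e i\<close> with \<open>i < k\<close> out of \<open>F k\<close>. Choose a covector \<open>a\<close> that kills \<open>F k\<close> but not
  \<open>A (e i)\<close>. Then \<open>e i \<otimes> a\<close> preserves the flag, and together with \<open>A\<close> it prevents solvability.\<close>

lemma flag_stabilizer_is_borel:
  fixes e :: "nat \<Rightarrow> complex^'d"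
  assumes e: "vec.span (e ` {..<CARD('d)}) = UNIV"
  defines "F \<equiv> \<lambda>k. vec.span (e ` {..<k})"
  shows "borel_subalgebra {A. trace A = 0 \<and> (\<forall>k. \<forall>x\<in>F k. A *v x \<in> F k)}"
proof -
  let ?b = "{A. trace A = 0 \<and> (\<forall>k. \<forall>x\<in>F k. A *v x \<in> F k)}"
  have Fsub: "vec.subspace (F k)" for k by (simp add: F_def)
  have F_add: "x \<in> F k \<Longrightarrow> y \<in> F k \<Longrightarrow> x + y \<in> F k" for x y k
    by (simp add: F_def vec.span_add)
  have F_diff: "x \<in> F k \<Longrightarrow> y \<in> F k \<Longrightarrow> x - y \<in> F k" for x y k
    by (simp add: F_def vec.span_diff)
  have F_scale: "x \<in> F k \<Longrightarrow> c *s x \<in> F k" for x k c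
    by (simp add: F_def vec.span_scale)
  have F_zero: "0 \<in> F k" for k by (simp add: F_def vec.span_zero)
  have F_mono: "F j \<subseteq> F k" if "j \<le> k" for j k
    unfolding F_def by (rule vec.span_mono) (use that in auto)
  have F_e: "e i \<in> F k" if "i < k" for i k
    unfolding F_def using that by (intro vec.span_base) auto
  have F_top: "F CARD('d) = UNIV" using e by (simp add: F_def)
  have F_min: "(\<forall>x\<in>F k. A *v x \<in> U)" if "vec.subspace U" "\<And>i. i < k \<Longrightarrow> A *v e i \<in> U" for A :: "complex^'d^'d" and U k
  proof -
    have "vec.subspace {x. A *v x \<in> U}"
      using that(1) by (auto simp: vec.subspace_def vec.add vec.scale)
    then have "F k \<subseteq> {x. A *v x \<in> U}"
      unfolding F_def using that(2) by (intro vec.span_minimal) auto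
    then show ?thesis by blast
  qed
  have b: "complex_lie_subalgebra sl_alg ?b"
    unfolding complex_lie_subalgebra_def lie_subalgebra_def
  proof (intro conjI ballI)
    show "subspace ?b"
      by (auto simp: subspace_def trace_add trace_scaleR matrix_vector_mult_add_rdistrib F_add F_zero
          mat_scaleR_scale mat_mult_vec_assoc F_scale trace_mat_mult)
    show "?b \<subseteq> sl_alg" by (auto simp: sl_alg_def)
    show "lie_bracket A C \<in> ?b" if "A \<in> ?b" "C \<in> ?b" for A C
      using that trace_mul_sym[of A C]
      by (auto simp: matrix_vector_mult_lie_bracket F_diff lie_bracket_def trace_sub) (simp add: matrix_vector_mult_diff_rdistrib matrix_vector_mul_assoc[symmetric] F_diff)
    show "mat \<i> ** A \<in> ?b" if "A \<in> ?b" for A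
      using that by (auto simp: trace_mat_mult mat_mult_vec_assoc F_scale)
  qed
  have "solvable_alg ?b"
  proof -
    define n where "n m = {A :: complex^'d^'d. \<forall>k. \<forall>x\<in>F k. A *v x \<in> F (k - m)}" for m
    have n_sub: "subspace (n m)" for m
      by (auto simp: n_def subspace_def matrix_vector_mult_add_rdistrib F_add F_zero mat_scaleR_scale
          mat_mult_vec_assoc F_scale)
    have n_mono: "n m \<subseteq> n l" if "l \<le> m" for l m
    proof
      fix A assume "A \<in> n m"
      then have "A *v x \<in> F (k - m)" if "x \<in> F k" for x k using that by (simp add: n_def)
      moreover have "F (k - m) \<subseteq> F (k - l)" for k by (rule F_mono) (use that in auto)
      ultimately show "A \<in> n l" by (auto simp: n_def)
    qed
    have n_br: "lie_bracket A C \<in> n (m + m)" if "A \<in> n m" "C \<in> n m" for A C m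
      unfolding n_def
    proof (intro CollectI allI ballI)
      fix k x assume x: "x \<in> F k"
      have "A *v x \<in> F (k - m)" "C *v x \<in> F (k - m)"
        using x that unfolding n_def by blast+
      then have "A *v (C *v x) \<in> F (k - m - m)" "C *v (A *v x) \<in> F (k - m - m)"
        using that unfolding n_def by blast+
      then show "lie_bracket A C *v x \<in> F (k - (m + m))"
        by (simp add: matrix_vector_mult_lie_bracket F_diff)
    qed
    have derived_sub: "derived_alg D \<subseteq> n l" if "\<And>A C. A \<in> D \<Longrightarrow> C \<in> D \<Longrightarrow> lie_bracket A C \<in> n l" for D l
      unfolding derived_alg_def using that by (intro span_minimal n_sub) auto
    have diag: "\<exists>c. A *v e i - c *s e i \<in> F i" if "A \<in> ?b" for A i
    proof -
      have "A *v e i \<in> F (Suc i)" using that F_e[of i "Suc i"] by auto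
      moreover have "e ` {..<Suc i} = insert (e i) (e ` {..<i})" by (simp add: lessThan_Suc)
      ultimately show ?thesis unfolding F_def by (auto simp: vec.span_insert)
    qed
    have first: "lie_bracket A C \<in> n 1" if AC: "A \<in> ?b" "C \<in> ?b" for A C
      unfolding n_def
    proof (rule CollectI, rule allI, rule F_min[OF Fsub])
      fix k i :: nat assume i: "i < k"
      obtain c d where cd: "A *v e i - c *s e i \<in> F i" "C *v e i - d *s e i \<in> F i"
        using diag AC by meson
      have "lie_bracket A C *v e i =
          A *v (C *v e i - d *s e i) + d *s (A *v e i - c *s e i)
          - (C *v (A *v e i - c *s e i) + c *s (C *v e i - d *s e i))"
        by (simp add: matrix_vector_mult_lie_bracket matrix_vector_mult_diff_distrib vec.scale
            vec.scale_right_diff_distrib algebra_simps)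
      also have "\<dots> \<in> F i"
        by (intro F_diff F_add F_scale cd) (use AC cd in auto)
      finally have 1: "lie_bracket A C *v e i \<in> F i" .
      have "i \<le> k - 1" using i by simp
      from 1 show "lie_bracket A C *v e i \<in> F (k - 1)" by (rule subsetD[OF F_mono[OF \<open>i \<le> k - 1\<close>]])
    qed
    have chain: "(derived_alg ^^ Suc k) ?b \<subseteq> n (Suc k)" for k
    proof (induction k)
      case 0
      have "derived_alg ?b \<subseteq> n 1" by (rule derived_sub) (rule first)
      then show ?case by simp
    next
      case (Suc k)
      have "derived_alg ((derived_alg ^^ Suc k) ?b) \<subseteq> n (Suc (Suc k))"
      proof (rule derived_sub)
        fix A C assume "A \<in> (derived_alg ^^ Suc k) ?b" "C \<in> (derived_alg ^^ Suc k) ?b"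
        then have "lie_bracket A C \<in> n (Suc k + Suc k)" using Suc n_br by blast
        then show "lie_bracket A C \<in> n (Suc (Suc k))" using n_mono[of "Suc (Suc k)" "Suc k + Suc k"] by auto
      qed
      then show ?case by simp
    qed
    obtain k where k: "CARD('d) = Suc k" by (metis gr0_implies_Suc zero_less_card_finite)
    have "n CARD('d) \<subseteq> {0}"
    proof
      fix A assume "A \<in> n CARD('d)"
      then have "A *v x \<in> F (CARD('d) - CARD('d))" for x using F_top unfolding n_def by blast
      then have "\<forall>x. A *v x = 0 *v x" by (simp add: F_def)
      then show "A \<in> {0}" unfolding singleton_iff matrix_eq .
    qed
    then have "(derived_alg ^^ Suc k) ?b \<subseteq> {0}" using chain[of k] k by auto
    moreover have "0 \<in> (derived_alg ^^ Suc k) ?b" by (simp add: derived_alg_def span_zero)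
    ultimately show ?thesis unfolding solvable_alg_def by blast
  qed
  moreover have "c = ?b" if c: "complex_lie_subalgebra sl_alg c" "solvable_alg c" "?b \<subseteq> c" for c
  proof (rule ccontr)
    assume "c \<noteq> ?b"
    then obtain A where A: "A \<in> c" "A \<notin> ?b" using c(3) by blast
    have cc: "csubspace c" "\<And>A C. A \<in> c \<Longrightarrow> C \<in> c \<Longrightarrow> lie_bracket A C \<in> c"
      using c(1) by (auto simp: complex_lie_subalgebra_def lie_subalgebra_def csubspace_def)
    have "trace A = 0" using c(1) A(1) by (auto simp: complex_lie_subalgebra_def lie_subalgebra_def sl_alg_def)
    then obtain k where "\<not> (\<forall>x\<in>F k. A *v x \<in> F k)" using A(2) by blast
    then obtain i where i: "i < k" "A *v e i \<notin> F k"
      using F_min[OF Fsub, of k A k] by blast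
    obtain a where a: "\<And>x. x \<in> F k \<Longrightarrow> pair a x = 0" "pair a (A *v e i) = 1"
      by (rule functional_separating_subspace[OF Fsub i(2)]) (rule that)
    have ia: "pair a (e i) = 0" using a(1) F_e[OF i(1)] by blast
    have "outer (e i) a *v x \<in> F m" if x: "x \<in> F m" for x m
    proof (cases "m \<le> k")
      case True
      then have "pair a x = 0" using a(1) F_mono x by blast
      then show ?thesis by (simp add: outer_mult_vec F_zero)
    next
      case False
      then have "e i \<in> F m" using i by (intro F_e) auto
      then show ?thesis by (simp add: outer_mult_vec F_scale)
    qed
    then have "outer (e i) a \<in> ?b" using ia by (simp add: trace_outer)
    then have "outer (e i) a \<in> c" using c(3) by blast
    then show False using not_solvable_if_sl2_like[OF cc _ ia A(1)] a(2) c(2) by simp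
  qed
  ultimately show ?thesis using b unfolding borel_subalgebra_def by blast
qed

section \<open>Stabilizers\<close>

context hermitian_space
begin

lemma perpD: "x \<in> perp W \<Longrightarrow> w \<in> W \<Longrightarrow> B x w = 0"
  and perpD': "x \<in> perp W \<Longrightarrow> w \<in> W \<Longrightarrow> B w x = 0"
proof -
  assume "x \<in> perp W" "w \<in> W"
  then show "B x w = 0" by (simp add: perp_def)
  then show "B w x = 0" by (simp add: B_cnj[of w x])
qed

lemma stabilizer_eq: "stabilizer_alg B W = {A \<in> {A. skew A \<and> (\<forall>w\<in>W. A *v w \<in> W)}. trace A = 0}"
  by (auto simp: stabilizer_alg_def su_alg_eq)

lemma scaleR_matrix_vector: "(r *\<^sub>R (A :: complex^'d^'d)) *v x = complex_of_real r *s (A *v x)"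
  by (simp add: mat_scaleR_scale mat_mult_vec_assoc)

lemma subspace_skew_stabilizer:
  assumes "vec.subspace W"
  shows "subspace {A. skew A \<and> (\<forall>w\<in>W. A *v w \<in> W)}"
  using assms unfolding subspace_def vec.subspace_def
  by (auto simp: skew_zero skew_add skew_scaleR matrix_vector_mult_add_rdistrib scaleR_matrix_vector)

lemma dim_skew_stabilizer:
  assumes "vec.subspace W"
  shows "dim (stabilizer_alg B W) + 1 = dim {A. skew A \<and> (\<forall>w\<in>W. A *v w \<in> W)}"
  unfolding stabilizer_eq
  by (rule dim_trace_zero_part[OF subspace_skew_stabilizer[OF assms]])
    (use assms in \<open>auto simp: skew_mat_i mat_mult_vec vec.subspace_scale\<close>)

lemma lie_subalgebra_stabilizer:
  assumes "vec.subspace W"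
  shows "lie_subalgebra (su_alg B) (stabilizer_alg B W)"
  unfolding lie_subalgebra_def
proof (intro conjI ballI)
  have "subspace {A :: complex^'d^'d. trace A = 0}"
    by (simp add: subspace_def trace_add trace_scaleR)
  from subspace_inter[OF subspace_skew_stabilizer[OF assms] this]
  show "subspace (stabilizer_alg B W)" unfolding stabilizer_eq by (simp add: Int_def)
  show "stabilizer_alg B W \<subseteq> su_alg B" by (auto simp: stabilizer_alg_def)
  fix A C assume AC: "A \<in> stabilizer_alg B W" "C \<in> stabilizer_alg B W"
  have "trace (lie_bracket A C) = 0"
    using trace_mul_sym[of A C] by (simp add: lie_bracket_def trace_sub)
  then show "lie_bracket A C \<in> stabilizer_alg B W"
    using AC assms unfolding stabilizer_eq
    by (auto simp: skew_bracket matrix_vector_mult_lie_bracket vec.subspace_diff)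
qed

lemma card_positions:
  fixes r :: "'d \<Rightarrow> nat"
  assumes "bij_betw r UNIV {..<CARD('d)}"
  shows "card {(i, j). R (r i) (r j)} = card {(a, b). a < CARD('d) \<and> b < CARD('d) \<and> R a b}"
proof -
  have inj: "inj (\<lambda>(i, j). (r i, r j))"
    using assms by (auto simp: inj_def bij_betw_def)
  have "(\<lambda>(i, j). (r i, r j)) ` {(i, j). R (r i) (r j)} = {(a, b). a < CARD('d) \<and> b < CARD('d) \<and> R a b}"
  proof (intro equalityI subsetI)
    fix z assume "z \<in> (\<lambda>(i, j). (r i, r j)) ` {(i, j). R (r i) (r j)}"
    then show "z \<in> {(a, b). a < CARD('d) \<and> b < CARD('d) \<and> R a b}"
      using assms by (auto simp: bij_betw_def)
  next
    fix z assume z: "z \<in> {(a, b). a < CARD('d) \<and> b < CARD('d) \<and> R a b}"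
    obtain a b where ab: "z = (a, b)" "a < CARD('d)" "b < CARD('d)" "R a b" using z by auto
    have "a \<in> range r" "b \<in> range r" using ab assms by (auto simp: bij_betw_def)
    then obtain i j where "a = r i" "b = r j" by blast
    then show "z \<in> (\<lambda>(i, j). (r i, r j)) ` {(i, j). R (r i) (r j)}" using ab by auto
  qed
  from this[symmetric] show ?thesis
    by (simp only: card_image[OF inj_on_subset[OF inj subset_UNIV]])
qed

lemma column_mem_basis_span:
  assumes "bij_betw r (UNIV :: 'd set) {..<CARD('d)}" "\<And>i. column i P = e (r i)" "m \<le> CARD('d)"
  shows "vec.span (e ` {..<m}) = vec.span ((\<lambda>i. column i P) ` {i. r i < m})"
proof -
  have "{..<m} = r ` {i. r i < m}"
  proof (intro equalityI subsetI)
    fix a assume "a \<in> {..<m}"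
    then have "a < m" "a \<in> range r" using assms(1,3) by (auto simp: bij_betw_def)
    then show "a \<in> r ` {i. r i < m}" by auto
  qed auto
  then have "e ` {..<m} = (\<lambda>i. column i P) ` {i. r i < m}"
    by (simp add: assms(2) image_image)
  then show ?thesis by simp
qed

lemma maximal_negative_subspace:
  obtains N where "vec.subspace N" "vec.dim N = q" "\<And>x. x \<in> N \<Longrightarrow> x \<noteq> 0 \<Longrightarrow> Re (B x x) < 0"
proof -
  obtain E where E: "finite E" "vec.independent E" "vec.span E = UNIV"
    "\<And>x y. x \<in> E \<Longrightarrow> y \<in> E \<Longrightarrow> x \<noteq> y \<Longrightarrow> B x y = 0"
    "\<And>x. x \<in> E \<Longrightarrow> B x x = 1 \<or> B x x = -1"
    "card {x\<in>E. B x x = 1} = p" "card {x\<in>E. B x x = -1} = q"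
    by (rule orthogonal_basis) (rule that)
  define N where "N = {x\<in>E. B x x = -1}"
  have fin: "finite N" using E(1) by (simp add: N_def)
  have neg: "Re (B x x) < 0" if x: "x \<in> vec.span N" "x \<noteq> 0" for x
  proof -
    obtain u where u: "x = (\<Sum>e\<in>N. u e *s e)"
      using x(1) vec.span_finite[OF fin] by auto
    have Be: "B e f = (if f = e then -1 else 0)" if "e \<in> N" "f \<in> N" for e f
      using that E(4)[of e f] by (auto simp: N_def)
    have Bex: "B e x = - cnj (u e)" if e: "e \<in> N" for e
    proof -
      have "B e x = (\<Sum>f\<in>N. cnj (u f) * B e f)"
        by (simp only: u B_sum_right B_scale_right)
      also have "\<dots> = (\<Sum>f\<in>N. if f = e then - cnj (u e) else 0)"
        by (rule sum.cong) (use e in \<open>auto simp: Be\<close>)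
      also have "\<dots> = - cnj (u e)" using e fin by simp
      finally show ?thesis .
    qed
    have "B x x = (\<Sum>e\<in>N. u e * B e x)"
      by (subst (1) u) (simp only: B_sum_left B_scale_left)
    also have "\<dots> = (\<Sum>e\<in>N. - (u e * cnj (u e)))"
      by (rule sum.cong) (simp_all add: Bex)
    finally have "Re (B x x) = - (\<Sum>e\<in>N. (cmod (u e))\<^sup>2)"
      by (simp only: sum_negf complex_mult_cnj cmod_power2) (simp add: Re_sum)
    moreover have "(\<Sum>e\<in>N. (cmod (u e))\<^sup>2) > 0"
    proof (rule ccontr)
      assume "\<not> ?thesis"
      then have "(\<Sum>e\<in>N. (cmod (u e))\<^sup>2) = 0"
        using sum_nonneg[of N "\<lambda>e. (cmod (u e))\<^sup>2"] by simp
      then have "\<forall>e\<in>N. u e = 0"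
        using fin by (subst (asm) sum_nonneg_eq_0_iff) auto
      then have "x = 0" by (simp add: u)
      then show False using x(2) by simp
    qed
    ultimately show ?thesis by simp
  qed
  have "N \<subseteq> E" by (auto simp: N_def)
  then have "vec.independent N" using E(2) by (rule vec.independent_mono[rotated])
  then have "vec.dim (vec.span N) = q"
    using E(7) by (simp add: vec.dim_eq_card_independent N_def)
  then show ?thesis using that[of "vec.span N"] neg by simp
qed

text \<open>Such a subspace meets a negative definite subspace of dimension \<open>q\<close> only in zero.\<close>

lemma nonnegative_subspace_dim_le:
  assumes W: "vec.subspace W" "\<And>x. x \<in> W \<Longrightarrow> 0 \<le> Re (B x x)"
  shows "vec.dim W \<le> p"
proof -
  obtain N where N: "vec.subspace N" "vec.dim N = q" "\<And>x. x \<in> N \<Longrightarrow> x \<noteq> 0 \<Longrightarrow> Re (B x x) < 0"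
    by (rule maximal_negative_subspace) (rule that)
  have "N \<inter> W \<subseteq> {0}"
  proof
    fix x assume "x \<in> N \<inter> W"
    then show "x \<in> {0}" using N(3)[of x] W(2)[of x] by auto
  qed
  then have "vec.dim (N \<inter> W) = 0" by (simp only: vec.dim_eq_0)
  moreover have "vec.dim {x + y |x y. x \<in> N \<and> y \<in> W} \<le> CARD('d)"
    by (rule dim_subset_UNIV_cart_gen)
  ultimately show ?thesis
    using vec.dim_sums_Int[OF N(1) W(1)] N(2) card_eq by linarith
qed

lemma null_subspace_dim_le:
  assumes "null_subspace B s W"
  shows "s \<le> p"
  using nonnegative_subspace_dim_le[of W] assms by (auto simp: null_subspace_def)

lemma null_subspace_perp:
  assumes "null_subspace B s W"
  shows "W \<subseteq> perp W" "vec.dim (perp W) = CARD('d) - s" "s \<le> CARD('d) - s" "vec.subspace W" "vec.dim W = s"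
proof -
  show W: "vec.subspace W" "vec.dim W = s" using assms by (auto simp: null_subspace_def)
  show "W \<subseteq> perp W" using assms by (auto simp: null_subspace_def perp_def)
  show "vec.dim (perp W) = CARD('d) - s" using vec_dim_perp[OF W(1)] W(2) by simp
  show "s \<le> CARD('d) - s" using null_subspace_dim_le[OF assms] p_le_q card_eq by simp
qed

text \<open>In a basis \<open>b\<close> adapted to \<open>W \<subseteq> perp W\<close>, a skew matrix \<open>A\<close> preserves \<open>W\<close> exactly when
  \<open>B (A b\<^sub>i) b\<^sub>j = 0\<close> for \<open>b\<^sub>i\<close> in \<open>W\<close> and \<open>b\<^sub>j\<close> in \<open>perp W\<close>, and by skewness also for \<open>i\<close> and \<open>j\<close>
  exchanged. These are \<open>2 s (N - s) - s\<^sup>2\<close> of the \<open>N\<^sup>2\<close> positions.\<close>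

lemma dim_stabilizer_null:
  assumes nW: "null_subspace B s W"
  shows "dim (stabilizer_alg B W) + 1 + 2 * s * CARD('d) = CARD('d)^2 + 3 * s^2"
proof -
  note W = null_subspace_perp[OF nW]
  let ?n = "CARD('d)"
  let ?t = "?n - s"
  obtain e where e: "vec.span (e ` {..<s}) = W" "vec.span (e ` {..<?t}) = perp W" "vec.span (e ` {..<?n}) = UNIV"
    using adapted_basis[OF W(4) vec_subspace_perp W(1)] W(2,5) by metis
  obtain P :: "complex^'d^'d" and r where P: "invertible P" and r: "bij_betw r UNIV {..<?n}" and col: "\<And>i. column i P = e (r i)"
    using matrix_of_basis[OF e(3)] by blast
  let ?R = "\<lambda>a b :: nat. \<not> (a < s \<and> b < ?t) \<and> \<not> (b < s \<and> a < ?t)"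
  let ?Z = "{(i, j). ?R (r i) (r j)}"
  have spW: "W = vec.span ((\<lambda>i. column i P) ` {i. r i < s})"
    using column_mem_basis_span[OF r col, of s] e(1) W(3) by simp
  have spP: "perp W = vec.span ((\<lambda>i. column i P) ` {i. r i < ?t})"
    using column_mem_basis_span[OF r col, of ?t] e(2) by simp
  have iff: "(\<forall>w\<in>W. A *v w \<in> W) \<longleftrightarrow> (\<forall>i j. (i, j) \<notin> ?Z \<longrightarrow> B (A *v column i P) (column j P) = 0)"
    if A: "skew A" for A
  proof
    assume st: "\<forall>w\<in>W. A *v w \<in> W"
    have 1: "B (A *v column i P) (column j P) = 0" if "r i < s" "r j < ?t" for i j
    proof -
      have "column i P \<in> W" "column j P \<in> perp W"
        using that by (subst spW, auto intro!: vec.span_base) (subst spP, auto intro!: vec.span_base)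
      then show ?thesis using st perpD' by blast
    qed
    moreover have "B (A *v column i P) (column j P) = 0" if "r j < s" "r i < ?t" for i j
    proof -
      have "B (column i P) (A *v column j P) = 0" using 1[OF that] by (subst B_cnj) simp
      then show ?thesis using skewD[OF A, of "column i P" "column j P"] by simp
    qed
    ultimately show "\<forall>i j. (i, j) \<notin> ?Z \<longrightarrow> B (A *v column i P) (column j P) = 0" by auto
  next
    assume z: "\<forall>i j. (i, j) \<notin> ?Z \<longrightarrow> B (A *v column i P) (column j P) = 0"
    have 1: "B (A *v column i P) y = 0" if "r i < s" "y \<in> perp W" for i y
      using that(2) unfolding spP by (rule B_span_right) (use z that(1) in auto)
    have "A *v column i P \<in> W" if "r i < s" for i
    proof -
      have "A *v column i P \<in> perp (perp W)" unfolding perp_def[of "perp W"] using 1 that by blast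
      then show ?thesis using perp_perp[OF W(4)] by simp
    qed
    moreover have "vec.subspace {x. A *v x \<in> W}"
      using W(4) by (auto simp: vec.subspace_def vec.add vec.scale)
    ultimately have "vec.span ((\<lambda>i. column i P) ` {i. r i < s}) \<subseteq> {x. A *v x \<in> W}"
      by (intro vec.span_minimal) auto
    then show "\<forall>w\<in>W. A *v w \<in> W" using spW by blast
  qed
  have "{A. skew A \<and> (\<forall>w\<in>W. A *v w \<in> W)} =
      {A. skew A \<and> (\<forall>i j. (i, j) \<notin> ?Z \<longrightarrow> B (A *v column i P) (column j P) = 0)}"
    using iff by blast
  then have "dim (stabilizer_alg B W) + 1 = card ?Z"
    using dim_skew_stabilizer[OF W(4)] dim_skew_supported[OF P, of ?Z] by simp
  also have "card ?Z = card {(a, b). a < ?n \<and> b < ?n \<and> ?R a b}"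
    by (rule card_positions[OF r])
  also have "\<dots> + 2 * s * ?t = ?n^2 + s^2"
  proof -
    let ?X = "{..<s} \<times> {..<?t}" and ?Y = "{..<?t} \<times> {..<s}" and ?C = "{(a, b). a < ?n \<and> b < ?n \<and> ?R a b}"
    have st: "s \<le> ?t" "?t \<le> ?n" using W(3) by auto
    have "?X \<inter> ?Y = {..<s} \<times> {..<s}" using st by auto
    then have "s * ?t + ?t * s = card (?X \<union> ?Y) + s * s"
      using card_Un_Int[of ?X ?Y] by (simp add: card_cartesian_product)
    moreover have "2 * s * ?t = s * ?t + ?t * s"
      by (simp only: mult_2 distrib_right mult.commute[of ?t s])
    ultimately have 1: "card (?X \<union> ?Y) + s * s = 2 * s * ?t" by linarith
    have "?C \<union> (?X \<union> ?Y) = {..<?n} \<times> {..<?n}" "?C \<inter> (?X \<union> ?Y) = {}"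
      using st by auto
    moreover have "finite ?C" by (rule finite_subset[of _ "{..<?n} \<times> {..<?n}"]) auto
    ultimately have "card ?C + card (?X \<union> ?Y) = ?n * ?n"
      using card_Un_disjoint[of ?C "?X \<union> ?Y"] by (simp add: card_cartesian_product)
    then show ?thesis using 1 by (simp add: power2_eq_square)
  qed
  finally have *: "dim (stabilizer_alg B W) + 1 + 2 * s * ?t = ?n^2 + s^2" by simp
  have "?n = ?t + s" using W(3) by linarith
  then have "2 * s * ?n = 2 * s * (?t + s)" by (rule arg_cong)
  then have "2 * s * ?n = 2 * s * ?t + 2 * s * s" by (simp only: distrib_left)
  then show ?thesis using * by (simp add: power2_eq_square)
qed

text \<open>The space is the direct sum of \<open>U\<close> and \<open>perp U\<close>, and a skew matrix preserving \<open>U\<close> is block diagonal. With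
  \<open>a\<close> the dimension of \<open>U\<close> this leaves dimension \<open>a\<^sup>2 + (N - a)\<^sup>2 - 1\<close>, which for \<open>1 \<le> a \<le> N - 1\<close> is
  greatest at the ends.\<close>

lemma dim_nondegenerate_stabilizer:
  assumes U: "vec.subspace U" "U \<inter> perp U = {0}" "U \<noteq> {0}" "U \<noteq> UNIV"
    and h: "h \<subseteq> stabilizer_alg B U"
  shows "dim h \<le> (CARD('d) - 1)^2"
proof -
  let ?n = "CARD('d)"
  define a where "a = vec.dim U"
  have pd: "vec.dim (perp U) = ?n - a" "a \<le> ?n" using vec_dim_perp[OF U(1)] by (simp_all add: a_def)
  have a0: "a \<noteq> 0" using U(1,3) by (auto simp: a_def vec.subspace_def)
  have an: "a \<noteq> ?n"
    using vec.dim_eq_full[of U] U(1,4) by (auto simp: a_def vec.span_eq_iff[THEN iffD2] vec.dimension_def card_cart_basis)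
  obtain E1 where E1: "E1 \<subseteq> U" "vec.independent E1" "U \<subseteq> vec.span E1" "card E1 = a"
    using vec.basis_exists a_def by metis
  obtain E2 where E2: "E2 \<subseteq> perp U" "vec.independent E2" "perp U \<subseteq> vec.span E2" "card E2 = ?n - a"
    using vec.basis_exists pd by metis
  have fin: "finite E1" "finite E2" using E1 E2 vec.finiteI_independent by blast+
  have disj: "E1 \<inter> E2 = {}"
  proof -
    have "0 \<notin> E1" using E1(2) vec.dependent_zero[of E1] by auto
    moreover have "E1 \<inter> E2 \<subseteq> {0}" unfolding U(2)[symmetric] using E1(1) E2(1) by (rule Int_mono)
    ultimately show ?thesis by blast
  qed
  then have c: "card (E1 \<union> E2) = ?n"
    using fin E1(4) E2(4) pd(2) by (simp add: card_Un_disjoint)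
  have "vec.dim {x + y |x y. x \<in> U \<and> y \<in> perp U} = ?n"
    using vec.dim_sums_Int[OF U(1) vec_subspace_perp[of U]] U(2) pd by (simp add: a_def)
  then have "vec.span {x + y |x y. x \<in> U \<and> y \<in> perp U} = UNIV"
    using vec.dim_eq_full[of "{x + y |x y. x \<in> U \<and> y \<in> perp U}"]
    by (simp add: vec.dimension_def card_cart_basis)
  moreover have "vec.span {x + y |x y. x \<in> U \<and> y \<in> perp U} \<subseteq> vec.span (E1 \<union> E2)"
  proof (rule vec.span_minimal)
    show "{x + y |x y. x \<in> U \<and> y \<in> perp U} \<subseteq> vec.span (E1 \<union> E2)"
      using E1(3) E2(3) vec.span_mono[of E1 "E1 \<union> E2"] vec.span_mono[of E2 "E1 \<union> E2"]
      by (auto intro!: vec.span_add)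
  qed simp
  ultimately have sp: "vec.span (E1 \<union> E2) = UNIV" by blast
  obtain e where e: "inj_on e {..<?n}" "e ` {..<a} = E1" "e ` {..<?n} = E1 \<union> E2"
    using nested_enumeration[of E1 "E1 \<union> E2" "E1 \<union> E2"] fin c E1(4) by auto
  obtain P :: "complex^'d^'d" and r where P: "invertible P" and r: "bij_betw r UNIV {..<?n}" and col: "\<And>i. column i P = e (r i)"
    using matrix_of_basis[of e] e sp by metis
  have rn: "r i < ?n" for i using r by (auto simp: bij_betw_def)
  have colU: "column i P \<in> U" if "r i < a" for i
    using that e(2) E1(1) col by (metis imageI lessThan_iff subsetD)
  have colP: "column i P \<in> perp U" if "\<not> r i < a" for i
  proof -
    have "e (r i) \<in> E1 \<union> E2" using e(3) rn by blast
    moreover have "e (r i) \<notin> E1"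
    proof
      assume "e (r i) \<in> E1"
      then obtain k where "k < a" "e (r i) = e k" using e(2) by auto
      then show False using e(1) rn[of i] pd(2) that by (auto dest: inj_onD)
    qed
    ultimately show ?thesis using E2(1) col by auto
  qed
  let ?R = "\<lambda>x y :: nat. x < a \<longleftrightarrow> y < a"
  let ?Z = "{(i, j). ?R (r i) (r j)}"
  have "{A. skew A \<and> (\<forall>w\<in>U. A *v w \<in> U)} \<subseteq>
      {A. skew A \<and> (\<forall>i j. (i, j) \<notin> ?Z \<longrightarrow> B (A *v column i P) (column j P) = 0)}"
  proof
    fix A assume "A \<in> {A. skew A \<and> (\<forall>w\<in>U. A *v w \<in> U)}"
    then have A: "skew A" "\<And>w. w \<in> U \<Longrightarrow> A *v w \<in> U" by blast+
    have "B (A *v column i P) (column j P) = 0" if "(i, j) \<notin> ?Z" for i j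
    proof (cases "r i < a")
      case True
      then have "A *v column i P \<in> U" "column j P \<in> perp U" using A(2) colU colP that by auto
      then show ?thesis using perpD' by blast
    next
      case False
      then have "A *v column j P \<in> U" "column i P \<in> perp U" using A(2) colU colP that by auto
      then show ?thesis using skewD[OF A(1)] perpD by simp
    qed
    then show "A \<in> {A. skew A \<and> (\<forall>i j. (i, j) \<notin> ?Z \<longrightarrow> B (A *v column i P) (column j P) = 0)}"
      using A(1) by blast
  qed
  then have "dim {A. skew A \<and> (\<forall>w\<in>U. A *v w \<in> U)} \<le> card ?Z"
    using dim_subset dim_skew_supported[OF P, of ?Z] by (metis (mono_tags, lifting) case_prodD case_prodI mem_Collect_eq)
  also have "card ?Z = card {(x, y). x < ?n \<and> y < ?n \<and> ?R x y}"
    by (rule card_positions[OF r])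
  also have "{(x, y). x < ?n \<and> y < ?n \<and> ?R x y} = ({..<a} \<times> {..<a}) \<union> ({a..<?n} \<times> {a..<?n})"
    using pd(2) by auto
  also have "card \<dots> = a * a + (?n - a) * (?n - a)"
    by (subst card_Un_disjoint) (auto simp: card_cartesian_product)
  finally have 1: "dim (stabilizer_alg B U) + 1 \<le> a * a + (?n - a) * (?n - a)"
    using dim_skew_stabilizer[OF U(1)] by simp
  have "a * a + (?n - a) * (?n - a) \<le> (?n - 1)^2 + 1"
  proof -
    obtain x where x: "a = Suc x" using a0 not0_implies_Suc by blast
    obtain y where y: "?n - a = Suc y" using an pd(2) not0_implies_Suc by (metis diff_is_0_eq le_antisym)
    have n: "?n - 1 = x + y + 1" using x y by simp
    show ?thesis unfolding y unfolding n unfolding x by (simp add: power2_eq_square algebra_simps)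
  qed
  then show ?thesis using 1 dim_subset[OF h] by linarith
qed

lemma adjoint_exists:
  obtains A' where "\<And>x y. B (A *v x) y = B x (A' *v y)"
proof -
  have "\<exists>u. flat u = flat y v* A" for y using flat_surj by (metis surjD)
  then obtain f where f: "\<And>y. flat (f y) = flat y v* A" by metis
  have fB: "B (A *v x) y = B x (f y)" for x y
    by (simp add: B_eq_pair f pair_vector_matrix)
  have "f (x + y) = f x + f y" "f (c *s x) = c *s f x" for x y c
    by (rule B_right_eqI; simp add: B_simps fB[symmetric])+
  then have "matrix f *v x = f x" for x
    by (intro matrix_works) (unfold_locales; simp)
  then show ?thesis using that[of "matrix f"] fB by simp
qed

text \<open>Take a complete flag through \<open>W\<close> and \<open>perp W\<close>. A matrix preserving it preserves \<open>perp W\<close>, so its adjoint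
  preserves \<open>W\<close>; hence both summands of its decomposition into a skew matrix and \<open>\<i>\<close> times a skew matrix
  preserve \<open>W\<close>, and the Borel subalgebra of the flag lies in the complexified stabilizer.\<close>

lemma parabolic_stabilizer_null:
  assumes nW: "null_subspace B s W"
  shows "parabolic_subalgebra B (stabilizer_alg B W)"
proof -
  note W = null_subspace_perp[OF nW]
  obtain e where e: "vec.span (e ` {..<s}) = W" "vec.span (e ` {..<CARD('d) - s}) = perp W"
      "vec.span (e ` {..<CARD('d)}) = UNIV"
    using adapted_basis[OF W(4) vec_subspace_perp W(1)] W(2,5) by metis
  let ?b = "{A. trace A = 0 \<and> (\<forall>k. \<forall>x\<in>vec.span (e ` {..<k}). A *v x \<in> vec.span (e ` {..<k}))}"
  have "?b \<subseteq> complexification (stabilizer_alg B W)"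
  proof
    fix A assume A: "A \<in> ?b"
    have AW: "A *v w \<in> W" if "w \<in> W" for w using A that e(1) by blast
    have AP: "A *v w \<in> perp W" if "w \<in> perp W" for w using A that e(2) by blast
    obtain A' where A': "\<And>x y. B (A *v x) y = B x (A' *v y)" by (rule adjoint_exists) (rule that)
    have A'': "B (A' *v x) y = B x (A *v y)" for x y
      using A'[of y x] B_cnj[of "A *v y" x] B_cnj[of y "A' *v x"] by simp
    have A'W: "A' *v w \<in> W" if "w \<in> W" for w
    proof -
      have "B (A' *v w) y = 0" if "y \<in> perp W" for y
        using perpD'[OF AP[OF that] \<open>w \<in> W\<close>] A''[of w y] by simp
      then have "A' *v w \<in> perp (perp W)" unfolding perp_def[of "perp W"] by blast
      then show ?thesis using perp_perp[OF W(4)] by simp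
    qed
    define X where "X = mat (1 / 2) ** (A - A')"
    define Y where "Y = mat (- \<i> / 2) ** (A + A')"
    have Xx: "X *v x = (1/2) *s (A *v x - A' *v x)" and Yx: "Y *v x = (- \<i> / 2) *s (A *v x + A' *v x)" for x
      by (simp_all only: X_def Y_def mat_mult_vec_assoc matrix_vector_mult_diff_rdistrib matrix_vector_mult_add_rdistrib)
    have AXY: "A = X + mat \<i> ** Y"
      by (simp add: X_def Y_def mat_mult_mat) (simp add: vec_eq_iff mat_mult_entry field_simps)
    have sX: "skew X" unfolding skew_def Xx by (simp add: B_simps A' A'' algebra_simps)
    have sY: "skew Y" unfolding skew_def Yx by (simp add: B_simps A' A'' algebra_simps)
    have "trace A = trace X + \<i> * trace Y"
      by (subst AXY) (simp only: trace_add trace_mat_mult)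
    then have "trace X + \<i> * trace Y = 0" using A by simp
    then have "trace X = 0" "trace Y = 0"
      using skew_trace[OF sX] skew_trace[OF sY] by (auto simp: complex_eq_iff)
    moreover have "X *v w \<in> W" "Y *v w \<in> W" if "w \<in> W" for w
      unfolding Xx Yx
      by (rule vec.subspace_scale[OF W(4)], rule vec.subspace_diff[OF W(4) AW[OF that] A'W[OF that]])
        (rule vec.subspace_scale[OF W(4)], rule vec.subspace_add[OF W(4) AW[OF that] A'W[OF that]])
    ultimately have "X \<in> stabilizer_alg B W" "Y \<in> stabilizer_alg B W"
      using sX sY by (simp_all add: stabilizer_eq)
    then show "A \<in> complexification (stabilizer_alg B W)"
      unfolding complexification_def using AXY by blast
  qed
  then show ?thesis
    unfolding parabolic_subalgebra_def
    using lie_subalgebra_stabilizer[OF W(4)] flag_stabilizer_is_borel[OF e(3)] by blast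
qed

end

section \<open>Conjugacy of null subspaces\<close>

lemma matrix_inv_works:
  assumes "invertible (M :: complex^'d^'d)"
  shows "M ** matrix_inv M = mat 1" "matrix_inv M ** M = mat 1"
proof -
  have "\<exists>A'. M ** A' = mat 1 \<and> A' ** M = mat 1" using assms by (simp add: invertible_def)
  then have "M ** matrix_inv M = mat 1 \<and> matrix_inv M ** M = mat 1"
    unfolding matrix_inv_def by (rule someI_ex)
  then show "M ** matrix_inv M = mat 1" "matrix_inv M ** M = mat 1" by auto
qed

context hermitian_space
begin

text \<open>The condition on the determinant allows rescaling into \<open>SU(p, q)\<close> by a complex number of modulus
  one.\<close>

definition isometry :: "complex^'d^'d \<Rightarrow> bool" where
  "isometry g \<longleftrightarrow> (\<forall>x y. B (g *v x) (g *v y) = B x y) \<and> cmod (det g) = 1"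

definition isometric :: "(complex^'d) set \<Rightarrow> (complex^'d) set \<Rightarrow> bool" where
  "isometric W W' \<longleftrightarrow> (\<exists>g. isometry g \<and> (\<lambda>x. g *v x) ` W = W')"

lemma isometric_refl: "isometric W W"
  unfolding isometric_def isometry_def by (rule exI[of _ "mat 1"]) simp

lemma isometric_trans:
  assumes "isometric W W'" "isometric W' W''"
  shows "isometric W W''"
proof -
  obtain g g' where g: "isometry g" "(\<lambda>x. g *v x) ` W = W'" "isometry g'" "(\<lambda>x. g' *v x) ` W' = W''"
    using assms unfolding isometric_def by blast
  have "isometry (g' ** g)"
    using g(1,3) by (simp add: isometry_def matrix_vector_mul_assoc[symmetric] det_mul norm_mult)
  moreover have "(\<lambda>x. (g' ** g) *v x) ` W = W''"
    unfolding g(4)[symmetric] g(2)[symmetric] image_image by (simp add: matrix_vector_mul_assoc)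
  ultimately show ?thesis unfolding isometric_def by blast
qed

text \<open>The reflection in the hyperplane orthogonal to \<open>u\<close>; as an involution it has determinant \<open>1\<close> or
  \<open>- 1\<close>.\<close>

lemma reflection_isometry:
  assumes u: "B u u = - 2"
  shows "isometry (mat 1 + outer u (flat u))"
    and "(mat 1 + outer u (flat u)) *v z = z + B z u *s u"
proof -
  let ?r = "mat 1 + outer u (flat u)"
  have r: "?r *v z = z + B z u *s u" for z
    by (simp add: matrix_vector_mult_add_rdistrib outer_mult_vec B_eq_pair)
  then show "?r *v z = z + B z u *s u" .
  have 1: "B (?r *v x) (?r *v y) = B x y" for x y
  proof -
    have "B (?r *v x) (?r *v y) = B x y + cnj (B y u) * B x u + B x u * B u y + B x u * cnj (B y u) * B u u"
      by (simp only: r) (simp add: B_simps algebra_simps)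
    also have "B u y = cnj (B y u)" by (rule B_cnj)
    finally show ?thesis by (simp add: u)
  qed
  have "(?r ** ?r) *v z = mat 1 *v z" for z
    by (simp add: matrix_vector_mul_assoc[symmetric] r B_simps u vec.scale_left_distrib[symmetric])
  then have "?r ** ?r = mat 1" unfolding matrix_eq by blast
  then have "det (?r ** ?r) = 1" by (simp only: det_I)
  then have "det ?r * det ?r = 1" by (simp only: det_mul)
  then have "(cmod (det ?r))\<^sup>2 = 1" by (simp only: power2_eq_square norm_mult[symmetric] norm_one)
  then have "cmod (det ?r) = 1"
    using power2_eq_1_iff[of "cmod (det ?r)"] norm_ge_zero[of "det ?r"] by linarith
  then show "isometry ?r" using 1 by (simp add: isometry_def)
qed

text \<open>Rescale \<open>y\<close> to \<open>y'\<close> with \<open>B x y' = 1\<close>. Then \<open>x - y'\<close> has square \<open>- 2\<close>, and the reflection it defines maps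
  \<open>x\<close> to \<open>y'\<close> and fixes \<open>K\<close> pointwise.\<close>

lemma isometric_if_paired:
  assumes K: "vec.subspace K" and x: "B x x = 0" "\<And>k. k \<in> K \<Longrightarrow> B k x = 0"
    and y: "B y y = 0" "\<And>k. k \<in> K \<Longrightarrow> B k y = 0" and xy: "B x y \<noteq> 0"
  shows "isometric (vec.span (insert x K)) (vec.span (insert y K))"
proof -
  define c where "c = 1 / cnj (B x y)"
  define y' where "y' = c *s y"
  define u where "u = x - y'"
  have c: "c \<noteq> 0" using xy by (simp add: c_def)
  have xy': "B x y' = 1" "B y' x = 1" "B y' y' = 0"
    using xy y(1) B_cnj[of x y] by (simp_all add: y'_def c_def B_simps)
  have "B u u = - 2" by (simp add: u_def B_simps x(1) xy')
  note r = reflection_isometry[OF this]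
  let ?r = "mat 1 + outer u (flat u)"
  have rx: "?r *v x = y'" by (simp only: r(2)) (simp add: u_def B_simps x(1) xy')
  have rk: "?r *v k = k" if "k \<in> K" for k
    using x(2)[OF that] y(2)[OF that] by (simp only: r(2)) (simp add: u_def y'_def B_simps)
  have "(\<lambda>z. ?r *v z) ` vec.span (insert x K) = vec.span (insert y K)"
  proof (intro equalityI subsetI)
    fix z assume "z \<in> (\<lambda>z. ?r *v z) ` vec.span (insert x K)"
    then obtain w k where w: "z = ?r *v w" "w - k *s x \<in> K"
      by (auto simp: mem_span_insert_subspace[OF K])
    have "z = ?r *v (w - k *s x) + k *s (?r *v x)" unfolding w(1) by (simp only: vec.diff vec.scale) simp
    then have "z - (k * c) *s y = w - k *s x" by (simp only: rk[OF w(2)] rx) (simp add: y'_def)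
    then have "z - (k * c) *s y \<in> K" using w(2) by simp
    then show "z \<in> vec.span (insert y K)" by (auto simp: mem_span_insert_subspace[OF K])
  next
    fix z assume "z \<in> vec.span (insert y K)"
    then obtain k where k: "z - k *s y \<in> K" by (auto simp: mem_span_insert_subspace[OF K])
    define w where "w = (z - k *s y) + (k / c) *s x"
    have "?r *v w = (z - k *s y) + (k / c) *s y'"
      unfolding w_def by (simp only: vec.add vec.scale rk[OF k] rx)
    also have "\<dots> = z" using c by (simp add: y'_def)
    finally have "z = ?r *v w" ..
    moreover have "w - (k / c) *s x \<in> K" using k by (simp add: w_def)
    then have "w \<in> vec.span (insert x K)" by (auto simp: mem_span_insert_subspace[OF K])
    ultimately show "z \<in> (\<lambda>z. ?r *v z) ` vec.span (insert x K)" by blast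
  qed
  then show ?thesis unfolding isometric_def using r(1) by blast
qed

text \<open>If \<open>x\<close> and \<open>y\<close> are orthogonal, pass through a null vector \<open>z\<close> that is orthogonal to \<open>K\<close> but to neither
  \<open>x\<close> nor \<open>y\<close>.\<close>

lemma isometric_if_adjacent:
  assumes K: "vec.subspace K" and x: "B x x = 0" "\<And>k. k \<in> K \<Longrightarrow> B k x = 0"
    and y: "B y y = 0" "\<And>k. k \<in> K \<Longrightarrow> B k y = 0"
    and xK: "x \<notin> K" and yK: "y \<notin> vec.span (insert x K)"
  shows "isometric (vec.span (insert x K)) (vec.span (insert y K))"
proof (cases "B x y = 0")
  case False
  then show ?thesis using isometric_if_paired[OF K x y] by blast
next
  case True
  then have yx: "B y x = 0" by (subst B_cnj) simp
  have xK': "x \<notin> vec.span (insert y K)"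
  proof
    assume "x \<in> vec.span (insert y K)"
    then obtain k where k: "x - k *s y \<in> K" by (auto simp: mem_span_insert_subspace[OF K])
    then have "k \<noteq> 0" using xK by auto
    then have "y - (1 / k) *s x = (- 1 / k) *s (x - k *s y)"
      by (simp add: vec.scale_right_diff_distrib)
    also have "\<dots> \<in> K" using K k by (rule vec.subspace_scale)
    finally show False using yK by (auto simp: mem_span_insert_subspace[OF K])
  qed
  obtain a where a: "\<And>u. u \<in> vec.span (insert y K) \<Longrightarrow> pair a u = 0" "pair a x = 1"
    by (rule functional_separating_subspace[OF _ xK']) (simp, rule that)
  obtain b where b: "\<And>u. u \<in> vec.span (insert x K) \<Longrightarrow> pair b u = 0" "pair b y = 1"
    by (rule functional_separating_subspace[OF _ yK]) (simp, rule that)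
  obtain z0 where z0: "\<And>z. pair (a + b) z = B z z0"
    by (rule riesz) (rule that)
  have z0x: "B x z0 = 1" "B y z0 = 1"
    using a b vec.span_base[of x "insert x K"] vec.span_base[of y "insert y K"]
    by (simp_all add: z0[symmetric] pair_simps)
  have z0k: "B k z0 = 0" if "k \<in> K" for k
    using a(1)[OF vec.span_base, of k] b(1)[OF vec.span_base, of k] that by (simp add: z0[symmetric] pair_simps)
  \<comment> \<open>adding \<open>t x\<close> makes \<open>z0\<close> null and leaves its products with \<open>x\<close>, \<open>y\<close> and \<open>K\<close> as they are\<close>
  define t where "t = - B z0 z0 / 2"
  have t: "cnj t = t" by (simp add: t_def) (metis B_cnj)
  define z where "z = z0 + t *s x"
  have "B z0 x = 1" using z0x(1) by (subst B_cnj) simp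
  then have zz: "B z z = 0" by (simp add: z_def B_simps z0x x(1) t) (simp add: t_def)
  have xz: "B x z = 1" "B y z = 1" by (simp_all add: z_def B_simps z0x x(1) yx)
  have kz: "B k z = 0" if "k \<in> K" for k using z0k[OF that] x(2)[OF that] by (simp add: z_def B_simps)
  have zy: "B z y = 1" using xz(2) by (subst B_cnj) simp
  have "isometric (vec.span (insert x K)) (vec.span (insert z K))"
    by (rule isometric_if_paired[OF K x zz kz]) (simp_all add: xz)
  moreover have "isometric (vec.span (insert z K)) (vec.span (insert y K))"
    by (rule isometric_if_paired[OF K zz kz y]) (simp_all add: zy)
  ultimately show ?thesis by (rule isometric_trans)
qed

text \<open>Witt's theorem for null subspaces. The induction moves \<open>W1\<close> towards \<open>W2\<close> one dimension at a time: a vector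
  \<open>x\<close> of \<open>W1\<close> is replaced by a vector \<open>y\<close> of \<open>W2\<close>, while a hyperplane \<open>K\<close> of \<open>W1\<close> that contains \<open>W1 \<inter> W2\<close> and
  is orthogonal to \<open>y\<close> stays fixed.\<close>

lemma null_subspaces_isometric:
  assumes "null_subspace B s W1" "null_subspace B s W2"
  shows "isometric W1 W2"
  using assms(1)
proof (induction "s - vec.dim (W1 \<inter> W2)" arbitrary: W1 rule: less_induct)
  case less
  have W1: "vec.subspace W1" "vec.dim W1 = s" "\<And>x y. x \<in> W1 \<Longrightarrow> y \<in> W1 \<Longrightarrow> B x y = 0"
    using less.prems by (auto simp: null_subspace_def)
  have W2: "vec.subspace W2" "vec.dim W2 = s" "\<And>x y. x \<in> W2 \<Longrightarrow> y \<in> W2 \<Longrightarrow> B x y = 0"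
    using assms(2) by (auto simp: null_subspace_def)
  show ?case
  proof (cases "W2 \<subseteq> W1")
    case True
    then have "W2 = W1" using vec.subspace_dim_equal[OF W2(1) W1(1) True] W1(2) W2(2) by simp
    then show ?thesis using isometric_refl by simp
  next
    case False
    then obtain y where y: "y \<in> W2" "y \<notin> W1" by blast
    \<comment> \<open>the equation of the hyperplane \<open>K\<close>: the product with \<open>y\<close> if this is not zero on \<open>W1\<close>, and
      otherwise any covector killing \<open>W2\<close> but not \<open>W1\<close>\<close>
    have "\<exists>a x. x \<in> W1 \<and> pair a x = 1 \<and> (\<forall>u\<in>W1 \<inter> W2. pair a u = 0) \<and>
        (\<forall>k\<in>W1. pair a k = 0 \<longrightarrow> B k y = 0)"
    proof (cases "\<exists>x0\<in>W1. B x0 y \<noteq> 0")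
      case True
      then obtain x0 where x0: "x0 \<in> W1" "B x0 y \<noteq> 0" by blast
      have "pair ((1 / B x0 y) *s flat y) z = B z y / B x0 y" for z
        by (simp add: pair_simps B_eq_pair)
      then show ?thesis
        using x0 W2(3)[OF _ y(1)] by (intro exI[of _ "(1 / B x0 y) *s flat y"] exI[of _ x0]) simp
    next
      case False
      have "\<not> W1 \<subseteq> W2"
      proof
        assume "W1 \<subseteq> W2"
        then have "W1 = W2" using vec.subspace_dim_equal[OF W1(1) W2(1)] W1(2) W2(2) by simp
        then show False using y by simp
      qed
      then obtain x where x: "x \<in> W1" "x \<notin> W2" by blast
      obtain a where a: "\<And>u. u \<in> W2 \<Longrightarrow> pair a u = 0" "pair a x = 1"
        by (rule functional_separating_subspace[OF W2(1) x(2)]) (rule that)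
      show ?thesis using x(1) a False by (intro exI[of _ a] exI[of _ x]) simp
    qed
    then obtain a x where x: "x \<in> W1" "pair a x = 1" and a: "\<And>u. u \<in> W1 \<Longrightarrow> u \<in> W2 \<Longrightarrow> pair a u = 0"
      and ay: "\<And>k. k \<in> W1 \<Longrightarrow> pair a k = 0 \<Longrightarrow> B k y = 0" by blast
    define K where "K = W1 \<inter> {k. pair a k = 0}"
    have K: "vec.subspace K" unfolding K_def by (rule vec.subspace_inter[OF W1(1) vec_subspace_pair_kernel])
    have KK: "vec.span K = K" using K by (rule vec.span_eq_iff[THEN iffD2])
    have KW: "K \<subseteq> W1" by (simp add: K_def)
    have spx: "vec.span (insert x K) = W1"
    proof (intro equalityI subsetI)
      show "z \<in> W1" if "z \<in> vec.span (insert x K)" for z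
        using that vec.span_minimal[OF _ W1(1), of "insert x K"] x(1) KW by blast
      fix z assume z: "z \<in> W1"
      have "z - pair a z *s x \<in> K"
        using z x W1(1) by (simp add: K_def pair_simps vec.subspace_diff vec.subspace_scale)
      then show "z \<in> vec.span (insert x K)" by (auto simp: mem_span_insert_subspace[OF K])
    qed
    define W1' where "W1' = vec.span (insert y K)"
    have yK: "y \<notin> vec.span (insert x K)" using y spx by simp
    have xK: "x \<notin> K" using x by (simp add: K_def)
    have yK': "y \<notin> K" using y KW by blast
    have By: "B y y = 0" using W2(3)[OF y(1) y(1)] .
    have Bky: "B k y = 0" if "k \<in> K" for k using that ay by (simp add: K_def)
    have Bkx: "B k x = 0" if "k \<in> K" for k using W1(3)[OF _ x(1)] KW that by blast
    have iso: "isometric W1 W1'"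
      unfolding W1'_def using isometric_if_adjacent[OF K W1(3)[OF x(1) x(1)] Bkx By Bky xK yK] spx by simp
    have dK: "vec.dim K + 1 = s"
      using vec.dim_insert[of x K] xK KK spx W1(2) vec.dim_span[of "insert x K"] by simp
    have "null_subspace B s W1'"
      unfolding null_subspace_def
    proof (intro conjI ballI)
      show "vec.subspace W1'" by (simp add: W1'_def)
      show "vec.dim W1' = s"
        using vec.dim_insert[of y K] yK' KK dK by (simp add: W1'_def)
      have gen: "B u v = 0" if "u \<in> insert y K" "v \<in> insert y K" for u v
      proof -
        have "B y k = 0" if "k \<in> K" for k using Bky[OF that] by (subst B_cnj) simp
        then show ?thesis using that By Bky W1(3) KW by blast
      qed
      fix u v assume "u \<in> W1'" "v \<in> W1'"
      then show "B u v = 0"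
        unfolding W1'_def by (intro B_span_left[of u "insert y K"] B_span_right[of v "insert y K"]) (use gen in auto)
    qed
    moreover have "s - vec.dim (W1' \<inter> W2) < s - vec.dim (W1 \<inter> W2)"
    proof -
      have i1: "vec.subspace (W1 \<inter> W2)" "vec.subspace (W1' \<inter> W2)"
        using W1(1) W2(1) by (simp_all add: vec.subspace_inter W1'_def)
      have "W1 \<inter> W2 \<subseteq> K" using a by (auto simp: K_def)
      then have "W1 \<inter> W2 \<subseteq> W1' \<inter> W2" unfolding W1'_def using vec.span_base[of _ "insert y K"] by blast
      moreover have "y \<in> W1' \<inter> W2" unfolding W1'_def using y(1) vec.span_base[of y "insert y K"] by blast
      ultimately have "W1 \<inter> W2 \<subset> W1' \<inter> W2" using y(2) by blast
      then have "vec.span (W1 \<inter> W2) \<subset> vec.span (W1' \<inter> W2)"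
        by (simp only: vec.span_eq_iff[THEN iffD2, OF i1(1)] vec.span_eq_iff[THEN iffD2, OF i1(2)])
      then have "vec.dim (W1 \<inter> W2) < vec.dim (W1' \<inter> W2)" by (rule vec.dim_psubset)
      moreover have "vec.dim (W1' \<inter> W2) \<le> s"
        unfolding W2(2)[symmetric] by (rule vec.dim_subset) simp
      ultimately show ?thesis by linarith
    qed
    ultimately have "isometric W1' W2" using less.hyps by blast
    with iso show ?thesis by (rule isometric_trans)
  qed
qed

text \<open>Multiply \<open>g\<close> by a complex number of modulus one whose \<open>N\<close>-th power is the inverse of the
  determinant.\<close>

lemma isometry_in_SU:
  assumes g: "isometry g" and W: "vec.subspace W'" and gW: "(\<lambda>x. g *v x) ` W = W'"
  obtains g' where "g' \<in> SU_group B" "(\<lambda>x. g' *v x) ` W = W'"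
proof -
  define \<theta> where "\<theta> = - Arg (det g) / of_nat CARD('d)"
  define l where "l = cis \<theta>"
  have l0: "l \<noteq> 0" by (simp add: l_def)
  have ll: "l * cnj l = 1" by (simp add: l_def cis_cnj cis_mult)
  have "det g = cis (Arg (det g))"
    using g complex_norm_square[of "det g"] by (metis Arg_zero cis_Arg cis_zero isometry_def norm_zero sgn_eq div_by_1 of_real_1 zero_neq_one)
  moreover have "l ^ CARD('d) = cis (- Arg (det g))"
    by (simp add: l_def Complex.DeMoivre \<theta>_def)
  ultimately have "l ^ CARD('d) * det g = 1"
    by (metis add.left_inverse cis_mult cis_zero)
  moreover have "det (mat l ** g) = l ^ CARD('d) * det g"
  proof -
    have "det (mat l :: complex^'d^'d) = l ^ CARD('d)"
      by (subst det_diagonal) (simp_all add: mat_def)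
    then show ?thesis by (simp add: det_mul)
  qed
  moreover have "B ((mat l ** g) *v x) ((mat l ** g) *v y) = B x y" for x y
  proof -
    have "B ((mat l ** g) *v x) ((mat l ** g) *v y) = (l * cnj l) * B (g *v x) (g *v y)"
      by (simp add: mat_mult_vec_assoc B_simps)
    then show ?thesis using g by (simp add: ll isometry_def)
  qed
  ultimately have "mat l ** g \<in> SU_group B" by (simp add: SU_group_def)
  moreover have "(\<lambda>x. (mat l ** g) *v x) ` W = W'"
  proof (intro equalityI subsetI)
    fix z assume "z \<in> (\<lambda>x. (mat l ** g) *v x) ` W"
    then obtain x where x: "x \<in> W" "z = l *s (g *v x)" by (auto simp: mat_mult_vec_assoc)
    have "g *v x \<in> W'" using x(1) gW by blast
    then show "z \<in> W'" using W x(2) by (simp add: vec.subspace_scale)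
  next
    fix z assume z: "z \<in> W'"
    then have "(1 / l) *s z \<in> W'" using W by (simp add: vec.subspace_scale)
    then obtain x where x: "x \<in> W" "(1 / l) *s z = g *v x" using gW by blast
    have "(mat l ** g) *v x = z" using l0 by (simp add: mat_mult_vec_assoc x(2)[symmetric])
    then show "z \<in> (\<lambda>x. (mat l ** g) *v x) ` W" using x(1) by blast
  qed
  ultimately show ?thesis by (rule that)
qed

lemma stabilizers_conjugate:
  assumes W: "null_subspace B s W" and W': "null_subspace B s W'"
  shows "conjugate_in_SU B (stabilizer_alg B W) (stabilizer_alg B W')"
proof -
  have subs: "vec.subspace W" "vec.subspace W'" using W W' by (auto simp: null_subspace_def)
  obtain g0 where "isometry g0" "(\<lambda>x. g0 *v x) ` W = W'"
    using null_subspaces_isometric[OF W W'] unfolding isometric_def by blast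
  then obtain g where g: "g \<in> SU_group B" "(\<lambda>x. g *v x) ` W = W'"
    using isometry_in_SU[OF _ subs(2)] by blast
  have gB: "B (g *v x) (g *v y) = B x y" for x y using g(1) by (simp add: SU_group_def)
  have "invertible g" using g(1) invertible_det_nz[of g] by (simp add: SU_group_def)
  note gi = matrix_inv_works[OF this]
  define k where "k = matrix_inv g"
  have gk: "g ** k = mat 1" "k ** g = mat 1" using gi by (simp_all add: k_def)
  have gkx: "g *v (k *v x) = x" "k *v (g *v x) = x" for x
    by (simp_all add: matrix_vector_mul_assoc gk)
  have kB: "B (k *v x) (k *v y) = B x y" for x y using gB[of "k *v x" "k *v y"] by (simp add: gkx)
  have gkB: "B (g *v x) y = B x (k *v y)" "B (k *v x) y = B x (g *v y)" for x y
    using gB[of x "k *v y"] kB[of x "g *v y"] by (simp_all add: gkx)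
  have gW: "g *v w \<in> W'" if "w \<in> W" for w using that g(2) by blast
  have kW: "k *v w \<in> W" if "w \<in> W'" for w using that g(2) by (auto simp: gkx)
  have conj: "a ** A ** b \<in> stabilizer_alg B V'"
    if ab: "a ** b = mat 1" "b ** a = mat 1" "\<And>x y. B (a *v x) y = B x (b *v y)" "\<And>x y. B (b *v x) y = B x (a *v y)"
      and V: "\<And>w. w \<in> V \<Longrightarrow> a *v w \<in> V'" "\<And>w. w \<in> V' \<Longrightarrow> b *v w \<in> V"
      and A: "A \<in> stabilizer_alg B V" for a b A V V'
  proof -
    have "trace (a ** A ** b) = trace (b ** (a ** A))" by (rule trace_mul_sym)
    then have "trace (a ** A ** b) = trace A" by (simp add: matrix_mul_assoc ab)
    moreover have "skew (a ** A ** b)"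
      using A unfolding stabilizer_eq skew_def
      by (simp add: matrix_vector_mul_assoc[symmetric] ab(3) ab(4)[symmetric])
    ultimately show ?thesis
      using A V unfolding stabilizer_eq by (simp add: matrix_vector_mul_assoc[symmetric])
  qed
  have "stabilizer_alg B W' = (\<lambda>A. g ** A ** matrix_inv g) ` stabilizer_alg B W"
    unfolding k_def[symmetric]
  proof (intro equalityI subsetI)
    fix A assume A: "A \<in> stabilizer_alg B W'"
    have "k ** A ** g \<in> stabilizer_alg B W"
      by (rule conj[OF gk(2) gk(1) gkB(2) gkB(1) kW gW A])
    moreover have "A = g ** (k ** A ** g) ** k"
    proof -
      have "g ** (k ** A ** g) ** k = (g ** k) ** A ** (g ** k)" by (simp only: matrix_mul_assoc)
      then show ?thesis by (simp add: gk)
    qed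
    ultimately show "A \<in> (\<lambda>A. g ** A ** k) ` stabilizer_alg B W" by blast
  next
    fix A assume "A \<in> (\<lambda>A. g ** A ** k) ` stabilizer_alg B W"
    then show "A \<in> stabilizer_alg B W'"
      using conj[OF gk gkB gW kW] by blast
  qed
  then show ?thesis unfolding conjugate_in_SU_def using g(1) by blast
qed

end

section \<open>Invariant symplectic forms in Lorentzian signature\<close>

context hermitian_space
begin

text \<open>Otherwise \<open>x\<close> and \<open>y\<close> span a nonnegative subspace of dimension two.\<close>

lemma orthogonal_of_positive_negative:
  assumes p: "p = 1" and x: "Re (B x x) > 0" and xy: "B x y = 0" and y: "y \<noteq> 0"
  shows "Re (B y y) < 0"
proof (rule ccontr)
  assume neg: "\<not> ?thesis"
  have yx: "B y x = 0" using xy by (subst B_cnj) simp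
  let ?W = "vec.span {y, x}"
  have x0: "x \<noteq> 0" using x by auto
  have ynx: "y \<notin> vec.span {x}"
  proof
    assume "y \<in> vec.span {x}"
    then obtain k where k: "y = k *s x" by (auto simp: vec.span_singleton)
    then have "cnj k * B x x = 0" using xy by (simp add: B_simps)
    moreover have "B x x \<noteq> 0" using x by auto
    ultimately show False using k y by simp
  qed
  have "vec.dim ?W = 2"
    using ynx x0 by (simp add: vec.dim_insert)
  moreover have "0 \<le> Re (B z z)" if "z \<in> ?W" for z
  proof -
    obtain k where "z - k *s y \<in> vec.span {x}" using \<open>z \<in> ?W\<close> by (auto simp: vec.span_insert)
    then obtain l where "z - k *s y = l *s x" by (auto simp: vec.span_singleton)
    then have z: "z = k *s y + l *s x" by (simp add: algebra_simps)
    have "B z z = (k * cnj k) * B y y + (l * cnj l) * B x x"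
      unfolding z by (simp add: B_simps xy yx algebra_simps)
    also have "\<dots> = complex_of_real ((cmod k)\<^sup>2 * Re (B y y) + (cmod l)\<^sup>2 * Re (B x x))"
      by (subst B_self_real[of y], subst B_self_real[of x]) (simp add: complex_norm_square[symmetric])
    finally have "Re (B z z) = (cmod k)\<^sup>2 * Re (B y y) + (cmod l)\<^sup>2 * Re (B x x)" by simp
    then show ?thesis using x neg by simp
  qed
  ultimately show False
    using nonnegative_subspace_dim_le[of ?W] p by simp
qed

text \<open>The symplectic form \<open>J\<close> and the Hermitian form together define an antilinear map \<open>K\<close> by
  \<open>B x (K y) = J y x\<close>. It commutes with \<open>h\<close> and satisfies \<open>B x (K y) = - B y (K x)\<close>. Its square is complex
  linear and commutes with the complexification of \<open>h\<close>, in particular with the rank-one matrix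
  \<open>v \<otimes> a\<close>, so \<open>v\<close> is an eigenvector; by irreducibility \<open>K\<^sup>2\<close> is a scalar \<open>c\<close>, and
  \<open>B (K x) (K x) = - cnj c B x x\<close>. A positive vector \<open>x\<close> is orthogonal to \<open>K x\<close>, so \<open>K x\<close> is negative and
  \<open>c\<close> has positive real part. A nonzero vector \<open>y\<close> orthogonal to \<open>x\<close> and \<open>K x\<close> is negative, and so is
  \<open>K y\<close>, which is orthogonal to \<open>x\<close> as well; so \<open>c\<close> has negative real part.\<close>

lemma no_invariant_symplectic_form:
  assumes p: "p = 1" and q: "3 \<le> q"
    and J: "invertible J" "transpose J = - J"
    and h: "\<And>X. X \<in> h \<Longrightarrow> skew X" "\<And>X. X \<in> h \<Longrightarrow> J ** X + transpose X ** J = 0"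
    and irr: "\<And>U. vec.subspace U \<Longrightarrow> (\<And>X u. X \<in> h \<Longrightarrow> u \<in> U \<Longrightarrow> X *v u \<in> U) \<Longrightarrow> U = {0} \<or> U = UNIV"
    and rank_one: "v \<noteq> 0" "a \<noteq> 0" "outer v a = A + mat \<i> ** C" "A \<in> h" "C \<in> h"
  shows False
proof -
  have ex: "\<exists>u. flat u = J *v y" for y using flat_surj by (metis surjD)
  obtain K where K: "\<And>y. flat (K y) = J *v y" using ex by metis
  have BK: "B x (K y) = pair (J *v y) x" for x y by (simp add: B_eq_pair K)
  have K_add: "K (x + y) = K x + K y" for x y
    by (rule B_right_eqI) (simp add: BK B_simps vec.add pair_simps)
  have K_scale: "K (c *s y) = cnj c *s K y" for c y
    by (rule B_right_eqI) (simp add: BK B_simps vec.scale pair_simps)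
  have K_zero: "y = 0" if "K y = 0" for y
  proof -
    have "J *v y = 0" using K[of y] that flat_scale[of 0 0] by simp
    then show ?thesis using J(1) by (metis invertible_left_inverse matrix_left_invertible_ker)
  qed
  have anti: "B x (K y) = - B y (K x)" for x y
  proof -
    have "pair (J *v y) x = pair y (transpose J *v x)"
      by (simp add: pair_commute[of _ x] pair_vector_matrix[symmetric]) (simp add: pair_commute)
    also have "transpose J *v x = - (J *v x)"
      using matrix_vector_mult_diff_rdistrib[of 0 J x] by (simp only: J(2)) simp
    finally show ?thesis by (simp add: BK pair_simps pair_commute[of y])
  qed
  have K_comm: "K (X *v y) = X *v K y" if X: "X \<in> h" for X y
  proof (rule B_right_eqI)
    fix x
    have "pair (J *v (X *v y)) x + pair (transpose X *v (J *v y)) x = pair ((J ** X + transpose X ** J) *v y) x"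
      by (simp only: matrix_vector_mult_add_rdistrib matrix_vector_mul_assoc pair_add_left)
    then have "pair (J *v (X *v y)) x = - pair (J *v y) (X *v x)"
      by (simp add: h(2)[OF X] pair_vector_matrix add_eq_0_iff2)
    then have "B x (K (X *v y)) = - B (X *v x) (K y)" by (simp add: BK)
    then show "B x (K (X *v y)) = B x (X *v K y)" by (simp add: skewD[OF h(1)[OF X]])
  qed
  define T where "T y = K (K y)" for y
  have T_add: "T (x + y) = T x + T y" and T_scale: "T (c *s y) = c *s T y" for x y c
    by (simp_all add: T_def K_add K_scale)
  have T_comm: "T (X *v y) = X *v T y" if "X \<in> h" for X y
    using K_comm[OF that] by (simp add: T_def)
  have "T (outer v a *v y) = outer v a *v T y" for y
    by (simp add: rank_one(3) matrix_vector_mult_add_rdistrib mat_mult_vec_assoc T_add T_scale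
        T_comm[OF rank_one(4)] T_comm[OF rank_one(5)])
  then have Tv': "pair a y *s T v = pair a (T y) *s v" for y
    by (simp add: outer_mult_vec T_scale)
  obtain y0 where y0: "pair a y0 = 1" using exists_pair_one[OF rank_one(2)] .
  define c where "c = pair a (T y0)"
  have Tv: "T v = c *s v" using Tv'[of y0] y0 by (simp add: c_def)
  have "vec.subspace {y. T y = c *s y}"
    using T_scale[of 0 0] by (simp add: vec.subspace_def T_add T_scale vec.scale_right_distrib mult.commute)
  moreover have "X *v u \<in> {y. T y = c *s y}" if "X \<in> h" "u \<in> {y. T y = c *s y}" for X u
    using that T_comm[OF that(1)] by (simp add: vec.scale)
  ultimately have "{y. T y = c *s y} = {0} \<or> {y. T y = c *s y} = UNIV" by (rule irr)
  then have T: "T y = c *s y" for y using Tv rank_one(1) by blast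
  have BKK: "B (K x) (K y) = - cnj c * B y x" for x y
    using anti[of "K x" y] T[of x] by (simp add: T_def B_simps)
  obtain E where "finite E" "vec.independent E" "vec.span E = UNIV"
    "\<And>x y. x \<in> E \<Longrightarrow> y \<in> E \<Longrightarrow> x \<noteq> y \<Longrightarrow> B x y = 0"
    "\<And>x. x \<in> E \<Longrightarrow> B x x = 1 \<or> B x x = -1"
    and E: "card {x\<in>E. B x x = 1} = p" "card {x\<in>E. B x x = -1} = q"
    by (rule orthogonal_basis) (rule that)
  have "{x\<in>E. B x x = 1} \<noteq> {}" using E(1) p by (metis card.empty zero_neq_one)
  then obtain x where "B x x = 1" by blast
  then have x: "Re (B x x) > 0" "B x x = 1" by simp_all
  have Kx: "B x (K x) = 0" using anti[of x x] by simp
  have "x \<noteq> 0" using x by auto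
  then have "K x \<noteq> 0" using K_zero by blast
  then have "Re (B (K x) (K x)) < 0"
    by (rule orthogonal_of_positive_negative[OF p x(1) Kx])
  then have c: "Re c > 0" by (simp add: BKK x(2))
  let ?S = "vec.span {x, K x}"
  have "vec.dim ?S \<le> card {x, K x}" by (rule vec.dim_le_card) auto
  also have "\<dots> \<le> 2" by (simp add: card_insert_if)
  finally have "vec.dim (perp ?S) \<noteq> 0"
    using vec_dim_perp[OF vec.subspace_span, of "{x, K x}"] card_eq p q by linarith
  then have "\<not> perp ?S \<subseteq> {0}" by (simp only: vec.dim_eq_0 not_False_eq_True)
  then obtain y where y: "y \<in> perp ?S" "y \<noteq> 0" by blast
  have yx: "B x y = 0" and yK: "B y (K x) = 0"
    using perpD'[OF y(1) vec.span_base] perpD[OF y(1) vec.span_base] by simp_all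
  have "Re (B y y) < 0" by (rule orthogonal_of_positive_negative[OF p x(1) yx y(2)])
  moreover have "B x (K y) = 0" using anti[of x y] yK by simp
  moreover have "K y \<noteq> 0" using K_zero y(2) by blast
  ultimately have "Re (B y y) < 0" "Re (B (K y) (K y)) < 0"
    using orthogonal_of_positive_negative[OF p x(1)] by blast+
  moreover have "Re (B (K y) (K y)) = - Re c * Re (B y y)"
    unfolding BKK by (subst B_self_real[of y]) simp
  ultimately show False using c by (simp add: mult_pos_neg mult_less_0_iff zero_less_mult_iff)
qed

section \<open>Subalgebras of maximal dimension\<close>

lemma dim_complexification:
  assumes h: "subspace h" "\<And>X. X \<in> h \<Longrightarrow> skew X"
  shows "dim (complexification h) = 2 * dim h"
proof -
  let ?i = "\<lambda>X :: complex^'d^'d. mat \<i> ** X"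
  have lin: "linear ?i"
    by (rule linearI) (rule matrix_add_ldistrib, rule matrix_scaleR_mult_right)
  have "inj ?i"
    by (rule inj_on_inverseI[of _ "\<lambda>X. mat (- \<i>) ** X"]) (simp add: mat_mult_mat)
  then have di: "dim (?i ` h) = dim h"
    using dim_image_eq[OF lin, of h] inj_on_subset by blast
  have "h \<inter> ?i ` h \<subseteq> {0}"
  proof
    fix X assume "X \<in> h \<inter> ?i ` h"
    then obtain Y where Y: "Y \<in> h" "X = mat \<i> ** Y" "X \<in> h" by blast
    then have "Y = 0" using skew_i_mult[of Y] h(2) by blast
    then show "X \<in> {0}" using Y(2) by simp
  qed
  then have "dim (h \<inter> ?i ` h) = 0" by (simp only: dim_eq_0)
  moreover have "complexification h = {x + y |x y. x \<in> h \<and> y \<in> ?i ` h}"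
    unfolding complexification_def by blast
  then have "dim (complexification h) = dim {x + y |x y. x \<in> h \<and> y \<in> ?i ` h}" by (rule arg_cong)
  moreover have "dim {x + y |x y. x \<in> h \<and> y \<in> ?i ` h} + dim (h \<inter> ?i ` h) = dim h + dim (?i ` h)"
    by (rule dim_sums_Int[OF h(1) linear_subspace_image[OF lin h(1)]])
  ultimately show ?thesis unfolding di by linarith
qed

lemma complexification_bracket:
  assumes h: "subspace h" "\<And>A C. A \<in> h \<Longrightarrow> C \<in> h \<Longrightarrow> lie_bracket A C \<in> h"
    and "X \<in> complexification h" "Y \<in> complexification h"
  shows "lie_bracket X Y \<in> complexification h"
proof -
  obtain A C where X: "X = A + mat \<i> ** C" "A \<in> h" "C \<in> h"
    using assms(3) unfolding complexification_def by blast
  obtain A' C' where Y: "Y = A' + mat \<i> ** C'" "A' \<in> h" "C' \<in> h"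
    using assms(4) unfolding complexification_def by blast
  have "lie_bracket X Y *v x = ((lie_bracket A A' - lie_bracket C C') +
      mat \<i> ** (lie_bracket A C' + lie_bracket C A')) *v x" for x
    unfolding X(1) Y(1)
    by (simp add: matrix_vector_mult_lie_bracket matrix_vector_mult_add_rdistrib matrix_vector_mult_diff_rdistrib
        mat_mult_vec_assoc vec.add vec.scale vec.scale_right_distrib vec.scale_right_diff_distrib algebra_simps)
  then have "lie_bracket X Y = (lie_bracket A A' - lie_bracket C C') + mat \<i> ** (lie_bracket A C' + lie_bracket C A')"
    unfolding matrix_eq by blast
  moreover have "lie_bracket A A' - lie_bracket C C' \<in> h" "lie_bracket A C' + lie_bracket C A' \<in> h"
    using h X Y by (simp_all add: subspace_diff subspace_add)
  ultimately show ?thesis unfolding complexification_def by blast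
qed

text \<open>The complexification \<open>g\<close> of \<open>h\<close> is an irreducible algebra of small codimension. It is not all of
  \<open>sl(N, \<complex>)\<close>: a skew \<open>X = A + \<i> C\<close> with \<open>A\<close> and \<open>C\<close> in \<open>h\<close> has \<open>C = 0\<close>, so \<open>h\<close> would be all of
  \<open>su(p, q)\<close>. So \<open>g\<close> preserves a symplectic form in dimension four, which is impossible for
  \<open>p = 1\<close>.\<close>

lemma irreducible_large_subalgebra:
  assumes h: "lie_subalgebra (su_alg B) h" "h \<noteq> su_alg B" and N: "3 \<le> CARD('d)"
    and large: "(CARD('d) - 1)^2 + 1 \<le> dim h"
    and irr: "\<And>U. vec.subspace U \<Longrightarrow> (\<And>X u. X \<in> h \<Longrightarrow> u \<in> U \<Longrightarrow> X *v u \<in> U) \<Longrightarrow> U = {0} \<or> U = UNIV"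
  shows "CARD('d) = 4 \<and> dim h \<le> 10 \<and> p \<noteq> 1"
proof -
  have hs: "subspace h" and hsub: "h \<subseteq> su_alg B" and hb: "\<And>A C. A \<in> h \<Longrightarrow> C \<in> h \<Longrightarrow> lie_bracket A C \<in> h"
    using h(1) by (auto simp: lie_subalgebra_def)
  have hk: "skew X" "trace X = 0" if "X \<in> h" for X
    using that hsub by (auto simp: su_alg_eq)
  let ?g = "complexification h"
  have gI: "A + mat \<i> ** C \<in> ?g" if "A \<in> h" "C \<in> h" for A C
    using that unfolding complexification_def by blast
  have dg: "dim ?g = 2 * dim h" by (rule dim_complexification[OF hs hk(1)])
  have hg: "X \<in> ?g" if "X \<in> h" for X
    using gI[OF that subspace_0[OF hs]] by simp
  have gtr: "trace X = 0" if "X \<in> ?g" for X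
    using that hk(2) unfolding complexification_def by (auto simp: trace_add trace_mat_mult)
  have gc: "csubspace ?g"
    unfolding csubspace_def
  proof
    show "subspace ?g"
      unfolding subspace_def
    proof (intro conjI ballI allI)
      show "0 \<in> ?g" using hg[OF subspace_0[OF hs]] .
      show "X + Y \<in> ?g" if XY: "X \<in> ?g" "Y \<in> ?g" for X Y
      proof -
        obtain A C A' C' where "X = A + mat \<i> ** C" "Y = A' + mat \<i> ** C'" and m: "A \<in> h" "C \<in> h" "A' \<in> h" "C' \<in> h"
          using XY unfolding complexification_def by blast
        then have "X + Y = (A + A') + mat \<i> ** (C + C')" by (simp add: matrix_add_ldistrib)
        then show ?thesis using gI m by (simp add: subspace_add[OF hs])
      qed
      show "r *\<^sub>R X \<in> ?g" if X: "X \<in> ?g" for r X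
      proof -
        obtain A C where "X = A + mat \<i> ** C" and m: "A \<in> h" "C \<in> h"
          using X unfolding complexification_def by blast
        then have "r *\<^sub>R X = r *\<^sub>R A + mat \<i> ** (r *\<^sub>R C)"
          by (simp add: matrix_scaleR_mult_right scaleR_right_distrib)
        then show ?thesis using gI m by (simp add: subspace_scale[OF hs])
      qed
    qed
    show "\<forall>X\<in>?g. mat \<i> ** X \<in> ?g"
    proof
      fix X assume "X \<in> ?g"
      then obtain A C where "X = A + mat \<i> ** C" and m: "A \<in> h" "C \<in> h"
        unfolding complexification_def by blast
      then have "mat \<i> ** X = (- C) + mat \<i> ** A"
        by (simp add: matrix_add_ldistrib mat_mult_mat) (simp add: vec_eq_iff mat_mult_entry)
      then show "mat \<i> ** X \<in> ?g" using gI[OF subspace_neg[OF hs m(2)] m(1)] by (simp only:)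
    qed
  qed
  have small: "dim (ann ?g) + 4 \<le> 4 * CARD('d)"
  proof -
    obtain k where k: "CARD('d) = Suc k" by (metis gr0_implies_Suc zero_less_card_finite)
    have "2 * CARD('d)^2 + 4 = 2 * ((CARD('d) - 1)^2 + 1) + 4 * CARD('d)"
      unfolding k by (simp add: power2_eq_square)
    moreover have "2 * ((CARD('d) - 1)^2 + 1) \<le> dim ?g"
      unfolding dg using large by (rule mult_le_mono2)
    moreover have "a + 4 \<le> 4 * c" if "2 * m + 4 = x + 4 * c" "x \<le> b" "a + b = 2 * m"
      for a b c m x :: nat using that by simp
    ultimately show ?thesis using dim_ann[OF gc] by blast
  qed
  interpret g: irreducible_lie_algebra ?g
  proof
    show "csubspace ?g" by (rule gc)
    show "lie_bracket A C \<in> ?g" if "A \<in> ?g" "C \<in> ?g" for A C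
      using complexification_bracket[OF hs hb that] by blast
    show "trace A = 0" if "A \<in> ?g" for A using gtr[OF that] .
    show "U = {0} \<or> U = UNIV" if "vec.subspace U" "\<And>X u. X \<in> ?g \<Longrightarrow> u \<in> U \<Longrightarrow> X *v u \<in> U" for U
      using irr[OF that(1)] that(2) hg by blast
  qed (use small N in auto)
  have "\<not> (\<forall>X. trace X = 0 \<longrightarrow> X \<in> ?g)"
  proof
    assume full: "\<forall>X. trace X = 0 \<longrightarrow> X \<in> ?g"
    have "su_alg B \<subseteq> h"
    proof
      fix X assume "X \<in> su_alg B"
      then have X: "trace X = 0" "skew X" by (auto simp: su_alg_eq)
      then obtain A C where AC: "X = A + mat \<i> ** C" "A \<in> h" "C \<in> h"
        using full unfolding complexification_def by blast
      have "mat \<i> ** C = X + (- 1) *\<^sub>R A" using AC(1) by simp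
      then have "skew (mat \<i> ** C)" using X(2) hk(1)[OF AC(2)] by (simp only: skew_add skew_scaleR)
      then have "C = 0" by (rule skew_i_mult[OF hk(1)[OF AC(3)]])
      then show "X \<in> h" using AC by simp
    qed
    then show False using hsub h(2) by blast
  qed
  then obtain J v a where N4: "CARD('d) = 4" "dim ?g \<le> 20" and va: "v \<noteq> 0" "a \<noteq> 0" "outer v a \<in> ?g"
    and J: "invertible J" "transpose J = - J" "\<And>X. X \<in> ?g \<Longrightarrow> J ** X + transpose X ** J = 0"
    using g.large_irreducible_is_full_or_symplectic by blast
  obtain A C where AC: "outer v a = A + mat \<i> ** C" "A \<in> h" "C \<in> h"
    using va(3) unfolding complexification_def by blast
  have "p \<noteq> 1"
  proof
    assume p1: "p = 1"
    then have "3 \<le> q" using card_eq N4(1) by simp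
    then show False
      using no_invariant_symplectic_form[OF p1 _ J(1,2) hk(1) J(3)[OF hg] irr va(1,2) AC] by blast
  qed
  then show ?thesis using N4 dg by simp
qed

lemma dim_su: "dim (su_alg B) + 1 = CARD('d)^2"
proof -
  have inv: "invertible (mat 1 :: complex^'d^'d)"
    unfolding invertible_def by (rule exI[of _ "mat 1"]) simp
  have "stabilizer_alg B UNIV = su_alg B" by (auto simp: stabilizer_alg_def)
  moreover have "{A. skew A \<and> (\<forall>w\<in>UNIV. A *v w \<in> UNIV)} =
      {A. skew A \<and> (\<forall>i j. (i, j) \<notin> UNIV \<longrightarrow> B (A *v column i (mat 1)) (column j (mat 1)) = 0)}"
    by simp
  moreover have "card (UNIV :: ('d \<times> 'd) set) = CARD('d)^2"
    by (simp only: UNIV_Times_UNIV[symmetric] card_cartesian_product power2_eq_square)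
  ultimately show ?thesis
    using dim_skew_stabilizer[of UNIV] dim_skew_supported[of "mat 1" UNIV] inv by simp
qed

lemma null_stabilizer_proper:
  assumes W: "null_subspace B s W" and s: "1 \<le> s"
  shows "proper_subalgebra (su_alg B) (stabilizer_alg B W)"
proof -
  have "stabilizer_alg B W \<noteq> su_alg B"
  proof
    assume "stabilizer_alg B W = su_alg B"
    then have "2 * s * CARD('d) = 3 * s^2"
      using dim_stabilizer_null[OF W] dim_su by simp
    then have "2 * CARD('d) = 3 * s" using s by (auto simp: power2_eq_square)
    moreover have "2 * s \<le> CARD('d)" using null_subspace_perp(3)[OF W] s by simp
    ultimately show False using s by linarith
  qed
  then show ?thesis
    using lie_subalgebra_stabilizer null_subspace_perp(4)[OF W] by (simp add: proper_subalgebra_def)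
qed

text \<open>An irreducible \<open>h\<close> would have dimension at most \<open>10\<close> and occur only for \<open>(p, q) = (2, 2)\<close>, where the
  stabilizer of a null plane has dimension \<open>11\<close>. So \<open>h\<close> preserves some \<open>U\<close>, and then also \<open>U \<inter> perp U\<close>, which
  is not zero by the bound for nondegenerate subspaces.\<close>

lemma maximal_subalgebra_is_null_stabilizer:
  assumes max: "is_arg_max dim (proper_subalgebra (su_alg B)) h" and N: "3 \<le> CARD('d)"
    and W2: "(p, q) = (2, 2) \<Longrightarrow> \<exists>W. null_subspace B 2 W"
    and W1: "null_subspace B 1 W1"
  obtains s R where "1 \<le> s" "null_subspace B s R" "h = stabilizer_alg B R"
proof -
  have h: "lie_subalgebra (su_alg B) h" "h \<noteq> su_alg B"
    and hmax: "\<And>k. proper_subalgebra (su_alg B) k \<Longrightarrow> dim k \<le> dim h"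
    using max by (auto simp: is_arg_max_def proper_subalgebra_def not_less)
  have hs: "subspace h" using h(1) by (simp add: lie_subalgebra_def)
  have hk: "skew X" "trace X = 0" if "X \<in> h" for X
    using that h(1) by (auto simp: lie_subalgebra_def su_alg_eq)
  have large: "(CARD('d) - 1)^2 + 1 \<le> dim h"
  proof -
    obtain k where k: "CARD('d) = Suc k" by (metis gr0_implies_Suc zero_less_card_finite)
    have "dim (stabilizer_alg B W1) \<le> dim h" using hmax null_stabilizer_proper[OF W1] by simp
    moreover have "(CARD('d) - 1)^2 + 1 = dim (stabilizer_alg B W1)"
      using dim_stabilizer_null[OF W1] unfolding k by (simp add: power2_eq_square)
    ultimately show ?thesis by simp
  qed
  have "\<exists>U. vec.subspace U \<and> U \<noteq> {0} \<and> U \<noteq> UNIV \<and> (\<forall>X\<in>h. \<forall>u\<in>U. X *v u \<in> U)"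
  proof (rule ccontr)
    assume no: "\<not> ?thesis"
    have c: "CARD('d) = 4 \<and> dim h \<le> 10 \<and> p \<noteq> 1"
      by (rule irreducible_large_subalgebra[OF h N large]) (use no in blast)
    then have pq: "(p, q) = (2, 2)" using card_eq p_ge_1 p_le_q by auto
    obtain W where W: "null_subspace B 2 W" using W2[OF pq] by blast
    have "dim (stabilizer_alg B W) \<le> dim h" using hmax null_stabilizer_proper[OF W] by simp
    moreover have "dim (stabilizer_alg B W) = 11" using dim_stabilizer_null[OF W] c by simp
    ultimately show False using c by simp
  qed
  then obtain U where U: "vec.subspace U" "U \<noteq> {0}" "U \<noteq> UNIV" "\<And>X u. X \<in> h \<Longrightarrow> u \<in> U \<Longrightarrow> X *v u \<in> U"
    by blast
  define R where "R = U \<inter> perp U"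
  have Rsub: "vec.subspace R" unfolding R_def by (rule vec.subspace_inter[OF U(1) vec_subspace_perp])
  have hstabU: "h \<subseteq> stabilizer_alg B U"
    using hk U(4) by (auto simp: stabilizer_eq)
  have "R \<noteq> {0}"
  proof
    assume "R = {0}"
    then have "dim h \<le> (CARD('d) - 1)^2"
      unfolding R_def by (intro dim_nondegenerate_stabilizer[OF U(1) _ U(2,3) hstabU])
    then show False using large by simp
  qed
  define s where "s = vec.dim R"
  have R: "null_subspace B s R"
    unfolding null_subspace_def using Rsub perpD' by (auto simp: s_def R_def)
  have "s \<noteq> 0"
  proof
    assume "s = 0"
    then have "R \<subseteq> {0}" by (simp only: s_def vec.dim_eq_0)
    then show False using \<open>R \<noteq> {0}\<close> Rsub by (auto simp: vec.subspace_def)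
  qed
  then have s: "1 \<le> s" by simp
  have "X *v w \<in> R" if "X \<in> h" "w \<in> R" for X w
  proof -
    have "X *v w \<in> U" using that U(4) by (auto simp: R_def)
    moreover have "B (X *v w) u = 0" if "u \<in> U" for u
      using perpD[of w U "X *v u"] U(4)[OF \<open>X \<in> h\<close> that] \<open>w \<in> R\<close> skewD[OF hk(1)[OF \<open>X \<in> h\<close>]]
      by (simp add: R_def)
    ultimately show ?thesis by (simp add: R_def perp_def)
  qed
  then have sub: "h \<subseteq> stabilizer_alg B R" using hk by (auto simp: stabilizer_eq)
  have "dim (stabilizer_alg B R) \<le> dim h" using hmax null_stabilizer_proper[OF R s] by simp
  then have "h = stabilizer_alg B R"
    using subspace_dim_equal[OF hs _ sub] lie_subalgebra_stabilizer[OF Rsub] by (simp add: lie_subalgebra_def)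
  then show ?thesis using that s R by blast
qed

end

text \<open>For \<open>s = a + 2\<close> and \<open>N = 2 s + b\<close> the last inequality becomes \<open>a\<^sup>2 + 2 a b + 2 b \<le> 1\<close>.\<close>

lemma null_dimension_arithmetic:
  fixes N s :: nat
  assumes "2 \<le> s" "2 * s \<le> N" "2 * s * N + 3 \<le> 2 * N + 3 * s^2"
  shows "(N, s) = (4, 2) \<or> (N, s) = (6, 3)"
proof -
  obtain a where a: "s = a + 2" using assms(1) by (metis add.commute le_Suc_ex)
  obtain b where b: "N = 2 * s + b" using assms(2) by (metis le_Suc_ex)
  have le: "a * a + 2 * a * b + 2 * b \<le> 1"
    using assms(3) unfolding b unfolding a by (simp add: power2_eq_square algebra_simps)
  then have "b = 0" by simp
  moreover have "a < 2"
  proof (rule ccontr)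
    assume "\<not> a < 2"
    then have "2 * 2 \<le> a * a" by (intro mult_le_mono) auto
    then show False using le by simp
  qed
  ultimately show ?thesis using a b by auto
qed

theorem theorem3p3:
  fixes n p q :: nat
    and B :: "complex^'d \<Rightarrow> complex^'d \<Rightarrow> complex"
    and W :: "nat \<Rightarrow> (complex^'d) set"
  assumes "1 \<le> p" and "p \<le> q" and "p + q = n + 2" and "n + 2 \<ge> 3"
    and "CARD('d) = n + 2"
    and "hermitian_form B" and "has_signature B p q"
    and "\<And>s. 1 \<le> s \<Longrightarrow> s \<le> p \<Longrightarrow> null_subspace B s (W s)"
  shows "(\<forall>h. is_arg_max dim (proper_subalgebra (su_alg B)) h \<longrightarrow>
            is_arg_max dim (\<lambda>k. parabolic_subalgebra B k \<and> k \<noteq> su_alg B) h \<and>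
            (if n = 2 \<and> (p, q) = (2, 2) then
               conjugate_in_SU B h (stabilizer_alg B (W 2))
             else if n = 4 \<and> (p, q) = (3, 3) then
               conjugate_in_SU B h (stabilizer_alg B (W 1)) \<or>
               conjugate_in_SU B h (stabilizer_alg B (W 3))
             else conjugate_in_SU B h (stabilizer_alg B (W 1)))) \<and>
         dim (stabilizer_alg B (W 1)) = n^2 + 2 * n + 2 \<and>
         (n = 2 \<and> (p, q) = (2, 2) \<longrightarrow> dim (stabilizer_alg B (W 2)) = 11) \<and>
         (n = 4 \<and> (p, q) = (3, 3) \<longrightarrow>
            dim (stabilizer_alg B (W 1)) = 26 \<and> dim (stabilizer_alg B (W 3)) = 26)"
proof -
  interpret hermitian_space B p q
    using assms by unfold_locales simp_all
  have N: "CARD('d) = n + 2" by (rule assms(5))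
  note W = assms(8)
  have W1: "null_subspace B 1 (W 1)" by (rule W) (use assms(1) in simp_all)
  have dW1: "dim (stabilizer_alg B (W 1)) = n^2 + 2 * n + 2"
    using dim_stabilizer_null[OF W1] unfolding N by (simp add: power2_eq_square)
  have dW2: "dim (stabilizer_alg B (W 2)) = 11" if "n = 2 \<and> (p, q) = (2, 2)"
    using dim_stabilizer_null[OF W[of 2]] that unfolding N by simp
  have dW3: "dim (stabilizer_alg B (W 3)) = 26" if "n = 4 \<and> (p, q) = (3, 3)"
    using dim_stabilizer_null[OF W[of 3]] that unfolding N by simp
  have main: "is_arg_max dim (\<lambda>k. parabolic_subalgebra B k \<and> k \<noteq> su_alg B) h \<and>
      (if n = 2 \<and> (p, q) = (2, 2) then conjugate_in_SU B h (stabilizer_alg B (W 2))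
       else if n = 4 \<and> (p, q) = (3, 3) then
         conjugate_in_SU B h (stabilizer_alg B (W 1)) \<or> conjugate_in_SU B h (stabilizer_alg B (W 3))
       else conjugate_in_SU B h (stabilizer_alg B (W 1)))"
    if max: "is_arg_max dim (proper_subalgebra (su_alg B)) h" for h
  proof -
    have N3: "3 \<le> CARD('d)" using assms(4) N by simp
    have ex2: "\<exists>U. null_subspace B 2 U" if "(p, q) = (2, 2)" using W[of 2] that by auto
    obtain s R where s: "1 \<le> s" and R: "null_subspace B s R" and h: "h = stabilizer_alg B R"
      by (rule maximal_subalgebra_is_null_stabilizer[OF max N3 ex2 W1])
    have hmax: "dim k \<le> dim h" if "proper_subalgebra (su_alg B) k" for k
      using max that by (auto simp: is_arg_max_def not_less)
    have par: "is_arg_max dim (\<lambda>k. parabolic_subalgebra B k \<and> k \<noteq> su_alg B) h"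
      unfolding is_arg_max_def
    proof (intro conjI notI)
      show "parabolic_subalgebra B h" unfolding h by (rule parabolic_stabilizer_null[OF R])
      show False if "h = su_alg B"
        using max that by (simp add: is_arg_max_def proper_subalgebra_def)
      show False if larger: "\<exists>k. (parabolic_subalgebra B k \<and> k \<noteq> su_alg B) \<and> dim h < dim k"
      proof -
        obtain k where k: "parabolic_subalgebra B k" "k \<noteq> su_alg B" "dim h < dim k" using larger by blast
        then have "proper_subalgebra (su_alg B) k"
          by (simp add: proper_subalgebra_def parabolic_subalgebra_def)
        then show False using hmax[of k] k(3) by simp
      qed
    qed
    have sp: "s \<le> p" by (rule null_subspace_dim_le[OF R])
    have sN: "2 * s \<le> n + 2" using sp assms(2,3) by linarith
    have "dim (stabilizer_alg B (W 1)) \<le> dim h"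
      by (rule hmax[OF null_stabilizer_proper[OF W1]]) simp
    then have le: "2 * s * (n + 2) + 3 \<le> 2 * (n + 2) + 3 * s^2"
      using dim_stabilizer_null[OF R] dim_stabilizer_null[OF W1] unfolding h N by simp
    have cases: "s = 1 \<or> (n = 2 \<and> (p, q) = (2, 2) \<and> s = 2) \<or> (n = 4 \<and> (p, q) = (3, 3) \<and> s = 3)"
    proof (cases "s = 1")
      case False
      then have "(n + 2, s) = (4, 2) \<or> (n + 2, s) = (6, 3)"
        by (intro null_dimension_arithmetic sN le) (use s in simp)
      then show ?thesis using sp assms(2,3) by auto
    qed simp
    have s2: "s = 2" if c: "n = 2 \<and> (p, q) = (2, 2)"
    proof (rule ccontr)
      assume "s \<noteq> 2"
      then have "s = 1" using cases c by auto
      then have "dim h = 10"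
        using dim_stabilizer_null[OF R] c unfolding h N by simp
      moreover have "dim (stabilizer_alg B (W 2)) \<le> dim h"
        by (rule hmax[OF null_stabilizer_proper[OF W]]) (use c in simp_all)
      ultimately show False using dW2[OF c] by simp
    qed
    have "conjugate_in_SU B h (stabilizer_alg B (W s))"
      unfolding h by (rule stabilizers_conjugate[OF R W[OF s sp]])
    then show ?thesis using par cases s2 by auto
  qed
  have dW1': "dim (stabilizer_alg B (W 1)) = 26" if "n = 4 \<and> (p, q) = (3, 3)"
    using dW1 that by simp
  show ?thesis
    by (rule conjI, intro allI impI, erule main, rule conjI, rule dW1, rule conjI, rule impI, erule dW2,
        intro impI conjI, erule dW1', erule dW3)
qed

end
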